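(* Assume: (1) $\phi\in\mathcal C^2_b(\mathbb R^d)$, $G=\{\phi>0\}$ is bounded, $\partial G=\{\phi=0\}$, $|\nabla\phi(x)|=1$ for all $x\in\partial G$; (2) $b$ and $\sigma$ are Lipschitz on $\mathbb R^d$; (3) there are constants $K_{\psi,x},K_{\psi,z}\ge0$ with $|\psi(x,z)-\psi(x',z')|\le K_{\psi,x}|x-x'|+K_{\psi,z}|z-z'|$ for all $x,x'\in\overline G$ and $z,z'\in\mathbb R^{1\times d}$; (4) $g\in\mathcal C^2_{lip}(\overline G)$. Fix $\mu\in\mathbb R$ and $x\in\overline G$, and consider the equation $$Y_t=Y_T+\int_t^T[\psi(X^x_s,Z_s)-\lambda]ds+\int_t^T[g(X^x_s)-\mu]dK^x_s-\int_t^TZ_sdW_s,\qquad 0\le t\le T<+\infty,$$ with unknown $(Y,Z,\lambda)$. Then $\lambda$ is unique among solutions $(Y,Z,\lambda)$ such that $Y$ is a bounded continuous adapted process and $Z\in\mathcal M^2(\mathbb R^+,\mathbb R^{1\times d})$; that is, if $(Y,Z,\lambda)$ and $(Y',Z',\lambda')$ are two such solutions then $\lambda=\lambda'$.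
   Context: $(W_t)_{t\ge0}$ is a $d$-dimensional Brownian motion on $(\Omega,\mathcal F,\mathbb P)$ with augmented natural filtration $(\mathcal F_t)$. $\mathcal M^2(\mathbb R^+,E)$ is the set of progressively measurable $E$-valued processes $X$ with $\mathbb E\int_0^T|X_s|^2ds<\infty$ for all $T>0$. $\mathcal C^k_b$: class $\mathcal C^k$, bounded with bounded partial derivatives up to order $k$. $\mathcal C^k_{lip}$: class $\mathcal C^k$ with Lipschitz partial derivatives of order $k$. Functions $b:\mathbb R^d\to\mathbb R^d$, $\sigma:\mathbb R^d\to\mathbb R^{d\times d}$, $\psi:\overline G\times\mathbb R^{1\times d}\to\mathbb R$, $g:\overline G\to\mathbb R$ are given. For $x\in\overline G$, $(X^x,K^x)$ is the unique adapted continuous pair with values in $\overline G\times\mathbb R^+$ such that $X^x_t=x+\int_0^tb(X^x_s)ds+\int_0^t\sigma(X^x_s)dW_s+\int_0^t\nabla\phi(X^x_s)dK^x_s$, $K^x_t=\int_0^t\mathbf 1_{X^x_s\in\partial G}dK^x_s$, $K^x$ nondecreasing. *)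

theory Defs
  imports "HOL-Probability.Probability"
begin

subsection \<open>Classes of smooth functions\<close>

definition partial_deriv :: "'n \<Rightarrow> (real^'n \<Rightarrow> real) \<Rightarrow> real^('n::finite) \<Rightarrow> real" where
  "partial_deriv i f x = deriv (\<lambda>t. f (x + t *\<^sub>R axis i 1)) 0"

primrec iter_partial :: "'n list \<Rightarrow> (real^'n \<Rightarrow> real) \<Rightarrow> real^('n::finite) \<Rightarrow> real" where
  "iter_partial [] f = f"
| "iter_partial (i # is) f = partial_deriv i (iter_partial is f)"

definition grad :: "(real^'n \<Rightarrow> real) \<Rightarrow> real^'n \<Rightarrow> real^('n::finite)" where
  "grad f x = (\<chi> i. partial_deriv i f x)"

text \<open>The set \<open>U\<close> is meant to be open: the partial derivatives at a point of \<open>U\<close> then depend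
  only on the restriction of the function to \<open>U\<close>.\<close>

definition class_C :: "nat \<Rightarrow> (real^'n) set \<Rightarrow> (real^('n::finite) \<Rightarrow> real) \<Rightarrow> bool" where
  "class_C k U f \<longleftrightarrow>
     (\<forall>is. length is < k \<longrightarrow>
        (\<forall>i. \<forall>x\<in>U. (\<lambda>t. iter_partial is f (x + t *\<^sub>R axis i 1)) differentiable (at 0))) \<and>
     (\<forall>is. length is \<le> k \<longrightarrow> continuous_on U (iter_partial is f))"

definition class_C_b :: "nat \<Rightarrow> (real^('n::finite) \<Rightarrow> real) \<Rightarrow> bool" where
  "class_C_b k f \<longleftrightarrow>
     class_C k UNIV f \<and> (\<forall>is. length is \<le> k \<longrightarrow> bounded (range (iter_partial is f)))"

text \<open>On the closure of an open set \<open>U\<close>, being of class \<open>C\<^sup>k\<close> means that the function is so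
  on \<open>U\<close> and that its partial derivatives up to order \<open>k\<close> extend continuously to the closure;
  \<open>D is\<close> is the extension of the derivative along \<open>is\<close>.\<close>

definition class_C_lip_closure ::
    "nat \<Rightarrow> (real^'n) set \<Rightarrow> (real^('n::finite) \<Rightarrow> real) \<Rightarrow> bool" where
  "class_C_lip_closure k U f \<longleftrightarrow>
     class_C k U f \<and>
     (\<exists>D. (\<forall>x\<in>closure U. D [] x = f x) \<and>
          (\<forall>is. length is \<le> k \<longrightarrow>
             continuous_on (closure U) (D is) \<and> (\<forall>x\<in>U. D is x = iter_partial is f x)) \<and>
          (\<forall>is. length is = k \<longrightarrow> (\<exists>L. L-lipschitz_on (closure U) (D is))))"


subsection \<open>Brownian motion and processes\<close>

text \<open>Processes are indexed by \<open>real\<close>; only times \<open>t \<ge> 0\<close> are relevant.\<close>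

definition natural_filtration ::
    "'a measure \<Rightarrow> (real \<Rightarrow> 'a \<Rightarrow> 'b::topological_space) \<Rightarrow> real \<Rightarrow> 'a measure" where
  "natural_filtration M W t =
     sigma (space M) {W s -` A \<inter> space M | s A. 0 \<le> s \<and> s \<le> t \<and> A \<in> sets borel}"

text \<open>The augmentation adds all subsets of null sets of \<open>M\<close>, so its members are only measurable
  for \<open>completion M\<close>. This is why expectations below are taken over \<open>completion M\<close>, which is
  \<open>M\<close> itself if \<open>M\<close> is complete.\<close>

definition augmented_filtration ::
    "'a measure \<Rightarrow> (real \<Rightarrow> 'a \<Rightarrow> 'b::topological_space) \<Rightarrow> real \<Rightarrow> 'a measure" where
  "augmented_filtration M W t =
     sigma (space M) (sets (natural_filtration M W t) \<union> null_sets (completion M))"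

definition continuous_process ::
    "'a measure \<Rightarrow> (real \<Rightarrow> 'a \<Rightarrow> 'b::topological_space) \<Rightarrow> bool" where
  "continuous_process M X \<longleftrightarrow> (AE \<omega> in M. continuous_on {0..} (\<lambda>t. X t \<omega>))"

definition adapted ::
    "(real \<Rightarrow> 'a measure) \<Rightarrow> (real \<Rightarrow> 'a \<Rightarrow> 'b::topological_space) \<Rightarrow> bool" where
  "adapted F X \<longleftrightarrow> (\<forall>t\<ge>0. X t \<in> borel_measurable (F t))"

definition prog_measurable ::
    "(real \<Rightarrow> 'a measure) \<Rightarrow> (real \<Rightarrow> 'a \<Rightarrow> 'b::topological_space) \<Rightarrow> bool" where
  "prog_measurable F X \<longleftrightarrow>
     (\<forall>t\<ge>0. (\<lambda>(s, \<omega>). X s \<omega>) \<in> borel_measurable (restrict_space borel {0..t} \<Otimes>\<^sub>M F t))"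

definition brownian_motion :: "'a measure \<Rightarrow> (real \<Rightarrow> 'a \<Rightarrow> real^('n::finite)) \<Rightarrow> bool" where
  "brownian_motion M W \<longleftrightarrow>
     prob_space M \<and>
     (\<forall>t\<ge>0. W t \<in> borel_measurable M) \<and>
     (AE \<omega> in M. W 0 \<omega> = 0) \<and>
     continuous_process M W \<and>
     (\<forall>s t. 0 \<le> s \<and> s < t \<longrightarrow>
        distributed M lborel (\<lambda>\<omega>. W t \<omega> - W s \<omega>)
          (\<lambda>x. ennreal (\<Prod>i\<in>UNIV. normal_density 0 (sqrt (t - s)) (x $ i))) \<and>
        prob_space.indep_set M (sets (natural_filtration M W s))
          {(\<lambda>\<omega>. W t \<omega> - W s \<omega>) -` A \<inter> space M | A. A \<in> sets borel})"

definition M2 ::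
    "'a measure \<Rightarrow> (real \<Rightarrow> 'a \<Rightarrow> real^'n) \<Rightarrow> (real \<Rightarrow> 'a \<Rightarrow> real^('n::finite)) \<Rightarrow> bool" where
  "M2 M W Z \<longleftrightarrow>
     prog_measurable (augmented_filtration M W) Z \<and>
     (\<forall>T>0. (\<integral>\<^sup>+\<omega>. (\<integral>\<^sup>+s\<in>{0..T}. ennreal ((norm (Z s \<omega>))\<^sup>2) \<partial>lborel) \<partial>completion M) < \<infinity>)"


subsection \<open>The Ito integral\<close>

text \<open>A row vector in \<open>\<real>\<^sup>1\<^sup>\<times>\<^sup>d\<close> is represented as an element of \<open>real^'n\<close>, so that \<open>Z dW\<close>
  is an inner product. The simple process given by \<open>N\<close>, \<open>\<tau>\<close>, \<open>\<xi>\<close> takes the value \<open>\<xi> i\<close>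
  on the interval from \<open>\<tau> i\<close> (excluded) to \<open>\<tau> (Suc i)\<close> (included), for \<open>i < N\<close>.\<close>

definition simple_process ::
    "nat \<Rightarrow> (nat \<Rightarrow> real) \<Rightarrow> (nat \<Rightarrow> 'a \<Rightarrow> real^('n::finite)) \<Rightarrow> real \<Rightarrow> 'a \<Rightarrow> real^'n" where
  "simple_process N \<tau> \<xi> s \<omega> = (\<Sum>i<N. indicator {\<tau> i<..\<tau> (Suc i)} s *\<^sub>R \<xi> i \<omega>)"

definition simple_integral ::
    "(real \<Rightarrow> 'a \<Rightarrow> real^'n) \<Rightarrow> nat \<Rightarrow> (nat \<Rightarrow> real) \<Rightarrow> (nat \<Rightarrow> 'a \<Rightarrow> real^('n::finite)) \<Rightarrow>
     real \<Rightarrow> 'a \<Rightarrow> real" where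
  "simple_integral W N \<tau> \<xi> t \<omega> =
     (\<Sum>i<N. \<xi> i \<omega> \<bullet> (W (min (\<tau> (Suc i)) t) \<omega> - W (min (\<tau> i) t) \<omega>))"

definition simple_data ::
    "'a measure \<Rightarrow> (real \<Rightarrow> 'a \<Rightarrow> real^'n) \<Rightarrow>
     nat \<Rightarrow> (nat \<Rightarrow> real) \<Rightarrow> (nat \<Rightarrow> 'a \<Rightarrow> real^('n::finite)) \<Rightarrow> bool" where
  "simple_data M W N \<tau> \<xi> \<longleftrightarrow>
     0 \<le> \<tau> 0 \<and> (\<forall>i<N. \<tau> i \<le> \<tau> (Suc i)) \<and>
     (\<forall>i<N. \<xi> i \<in> borel_measurable (augmented_filtration M W (\<tau> i)) \<and>
            bounded (\<xi> i ` space M))"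

text \<open>\<open>has_ito_integral M W Z I\<close>: the process \<open>I\<close> is a continuous version of the Ito integral of
  \<open>Z\<close> against \<open>W\<close>, that is, the mean square limit of the integrals of simple processes
  approximating \<open>Z\<close>. It is determined up to indistinguishability.\<close>

definition has_ito_integral ::
    "'a measure \<Rightarrow> (real \<Rightarrow> 'a \<Rightarrow> real^'n) \<Rightarrow> (real \<Rightarrow> 'a \<Rightarrow> real^('n::finite)) \<Rightarrow>
     (real \<Rightarrow> 'a \<Rightarrow> real) \<Rightarrow> bool" where
  "has_ito_integral M W Z I \<longleftrightarrow>
     M2 M W Z \<and> adapted (augmented_filtration M W) I \<and> continuous_process M I \<and>
     (\<exists>N \<tau> \<xi>. (\<forall>k. simple_data M W (N k) (\<tau> k) (\<xi> k)) \<and>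
        (\<forall>T\<ge>0.
          (\<lambda>k::nat. \<integral>\<^sup>+\<omega>. (\<integral>\<^sup>+s\<in>{0..T}.
              ennreal ((norm (Z s \<omega> - simple_process (N k) (\<tau> k) (\<xi> k) s \<omega>))\<^sup>2) \<partial>lborel)
            \<partial>completion M) \<longlonglongrightarrow> 0 \<and>
          (\<lambda>k::nat. \<integral>\<^sup>+\<omega>.
              ennreal ((I T \<omega> - simple_integral W (N k) (\<tau> k) (\<xi> k) T \<omega>)\<^sup>2)
            \<partial>completion M) \<longlonglongrightarrow> 0))"


subsection \<open>The reflected diffusion and the backward equation\<close>

text \<open>The Stieltjes measure \<open>dk\<close> of a continuous nondecreasing function \<open>k\<close> on \<open>{0..}\<close>; no mass
  is put on \<open>{..0}\<close>.\<close>

definition stieltjes :: "(real \<Rightarrow> real) \<Rightarrow> real measure" where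
  "stieltjes k = interval_measure (\<lambda>s. k (max 0 s))"

text \<open>Row \<open>i\<close> of the matrix \<open>\<sigma> y\<close> is \<open>\<sigma> y $ i\<close>, so \<open>J t \<omega> $ i\<close> is the \<open>i\<close>-th component of the
  Ito integral of \<open>\<sigma>(X)\<close>.\<close>

definition reflected_sde_solution ::
    "'a measure \<Rightarrow> (real \<Rightarrow> 'a \<Rightarrow> real^('n::finite)) \<Rightarrow> (real^'n \<Rightarrow> real^'n) \<Rightarrow>
     (real^'n \<Rightarrow> real^'n^'n) \<Rightarrow> (real^'n \<Rightarrow> real) \<Rightarrow> (real^'n) set \<Rightarrow> real^'n \<Rightarrow>
     (real \<Rightarrow> 'a \<Rightarrow> real^'n) \<Rightarrow> (real \<Rightarrow> 'a \<Rightarrow> real) \<Rightarrow> bool" where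
  "reflected_sde_solution M W b \<sigma> \<phi> G x X K \<longleftrightarrow>
     adapted (augmented_filtration M W) X \<and> continuous_process M X \<and>
     adapted (augmented_filtration M W) K \<and> continuous_process M K \<and>
     (AE \<omega> in M. \<forall>t\<ge>0. X t \<omega> \<in> closure G \<and> 0 \<le> K t \<omega>) \<and>
     (AE \<omega> in M. mono_on {0..} (\<lambda>t. K t \<omega>)) \<and>
     (AE \<omega> in M. \<forall>t\<ge>0.
        K t \<omega> = (LINT s:{0<..t}|stieltjes (\<lambda>r. K r \<omega>). indicator (frontier G) (X s \<omega>))) \<and>
     (\<exists>J. (\<forall>i. has_ito_integral M W (\<lambda>s \<omega>. \<sigma> (X s \<omega>) $ i) (\<lambda>t \<omega>. J t \<omega> $ i)) \<and>
        (AE \<omega> in M. \<forall>t\<ge>0.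
           X t \<omega> = x + (LINT s:{0..t}|lborel. b (X s \<omega>)) + J t \<omega>
             + (LINT s:{0<..t}|stieltjes (\<lambda>r. K r \<omega>). grad \<phi> (X s \<omega>))))"

definition ergodic_bsde ::
    "'a measure \<Rightarrow> (real \<Rightarrow> 'a \<Rightarrow> real^('n::finite)) \<Rightarrow>
     (real \<Rightarrow> 'a \<Rightarrow> real^'n) \<Rightarrow> (real \<Rightarrow> 'a \<Rightarrow> real) \<Rightarrow>
     (real^'n \<Rightarrow> real^'n \<Rightarrow> real) \<Rightarrow> (real^'n \<Rightarrow> real) \<Rightarrow> real \<Rightarrow>
     (real \<Rightarrow> 'a \<Rightarrow> real) \<Rightarrow> (real \<Rightarrow> 'a \<Rightarrow> real^'n) \<Rightarrow> real \<Rightarrow> bool" where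
  "ergodic_bsde M W X K \<psi> g \<mu> Y Z lam \<longleftrightarrow>
     (\<exists>I. has_ito_integral M W Z I \<and>
        (AE \<omega> in M. \<forall>t T. 0 \<le> t \<and> t \<le> T \<longrightarrow>
           Y t \<omega> = Y T \<omega> + (LINT s:{t..T}|lborel. \<psi> (X s \<omega>) (Z s \<omega>) - lam)
             + (LINT s:{t<..T}|stieltjes (\<lambda>r. K r \<omega>). g (X s \<omega>) - \<mu>)
             - (I T \<omega> - I t \<omega>)))"

definition bounded_process ::
    "'a measure \<Rightarrow> (real \<Rightarrow> 'a \<Rightarrow> 'b::real_normed_vector) \<Rightarrow> bool" where
  "bounded_process M Y \<longleftrightarrow> (\<exists>C. AE \<omega> in M. \<forall>t\<ge>0. norm (Y t \<omega>) \<le> C)"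

definition admissible_solution ::
    "'a measure \<Rightarrow> (real \<Rightarrow> 'a \<Rightarrow> real^('n::finite)) \<Rightarrow>
     (real \<Rightarrow> 'a \<Rightarrow> real^'n) \<Rightarrow> (real \<Rightarrow> 'a \<Rightarrow> real) \<Rightarrow>
     (real^'n \<Rightarrow> real^'n \<Rightarrow> real) \<Rightarrow> (real^'n \<Rightarrow> real) \<Rightarrow> real \<Rightarrow>
     (real \<Rightarrow> 'a \<Rightarrow> real) \<Rightarrow> (real \<Rightarrow> 'a \<Rightarrow> real^'n) \<Rightarrow> real \<Rightarrow> bool" where
  "admissible_solution M W X K \<psi> g \<mu> Y Z lam \<longleftrightarrow>
     bounded_process M Y \<and> continuous_process M Y \<and> adapted (augmented_filtration M W) Y \<and>
     M2 M W Z \<and> ergodic_bsde M W X K \<psi> g \<mu> Y Z lam"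

end

theory Submission
  imports Defs
begin

text \<open>The difference \<open>D\<close> of two bounded solutions satisfies
  \<open>dD = (l - h) dt + \<zeta> dW\<close> with \<open>l = \<lambda> - \<lambda>'\<close>, \<open>\<zeta> = Z - Z'\<close> and
  \<open>\<bar>h\<bar> \<le> k \<bar>\<zeta>\<bar>\<close>; the \<open>dK\<close> terms cancel. If \<open>l > 0\<close>, then for large \<open>a\<close> the
  process \<open>exp (a D)\<close> drifts upwards at a rate bounded below, because \<open>a\<^sup>2 \<bar>\<zeta>\<bar>\<^sup>2 / 2\<close> dominates
  \<open>a k \<bar>\<zeta>\<bar>\<close> up to a small constant. Its expectation then grows linearly in time, which contradicts
  boundedness. This replaces Girsanov's theorem. Ito's formula is not needed either: a convexity
  bound for \<open>exp\<close> along a fine partition suffices, together with the martingale property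
  and the conditional isometry of the stochastic integral.\<close>

subsection \<open>Gaussian increments\<close>

text \<open>Nothing is known about \<open>Z\<close> and \<open>Z'\<close> beyond square
  integrability, so exp (a D) cannot be paired with a pointwise bound on \<zeta>. What makes the
  domination work is E[w V^2] = E[w q] for every bounded weight w known at the start of a step,
  where V is the increment of the stochastic integral and q the energy of \<zeta> on that step: the
  positive term of order a^2 can absorb the negative one of order a only if both carry the same
  random weight. As \<open>has_ito_integral\<close> offers just approximating simple integrals, this
  identity is built up from Gaussian moments.

  The convexity bound exp x >= 1 + x + x^2 / 4 fails for very negative x, and the increments of D
  are small only with high probability, by uniform continuity of paths. The weights are therefore
  switched off after the first long step. This rule looks only at the past, so the weights stay
  adapted; its price is a multiple of the probability of a long step, which tends to 0 with the
  mesh. The squared drift of each step is a further error, and it carries an extra factor of the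
  mesh.\<close>

lemma integral_lborel_prod_vec:
  fixes g :: "'n::finite \<Rightarrow> real \<Rightarrow> real"
  assumes int: "\<And>i. integrable lborel (g i)"
  shows "integrable lborel (\<lambda>x::real^'n. \<Prod>i\<in>UNIV. g i (x $ i))"
    and "(LINT x|lborel. (\<Prod>i\<in>UNIV. g i ((x::real^'n) $ i))) = (\<Prod>i\<in>UNIV. LINT t|lborel. g i t)"
proof -
  let ?h = "\<lambda>b. g (axis_index b)" and ?B = "Basis :: (real^'n) set"
  let ?L = "\<lambda>b::real^'n. lborel :: real measure"
  interpret P: product_sigma_finite ?L ..
  have [measurable]: "g i \<in> borel_measurable borel" for i
    using borel_measurable_integrable[OF int] by simp
  \<comment> \<open>\<open>lborel\<close> on vectors is the image of a product measure indexed by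
    basis vectors, not by \<open>'n\<close>. The bijection from i to \<open>axis i 1\<close> turns a
    product over coordinates into one over \<open>Basis\<close>, where Fubini for finite products
    applies.\<close>
  have bij: "bij_betw (\<lambda>i::'n. axis i (1::real)) UNIV ?B"
    by (auto simp: bij_betw_def inj_on_def Basis_vec_def axis_eq_axis)
  have reindex: "(\<Prod>i\<in>UNIV. F i) = (\<Prod>b\<in>?B. F (axis_index b))" for F :: "'n \<Rightarrow> real"
    using prod.reindex_bij_betw[OF bij, of "\<lambda>b. F (axis_index b)"] by (simp add: axis_index_axis)
  have comp: "(\<Sum>b\<in>?B. f b *\<^sub>R b) $ axis_index c = f c" if cB: "c \<in> ?B" for f c
  proof -
    obtain i where c: "c = axis i 1" using cB by (auto simp: Basis_vec_def)
    have "(\<Sum>b\<in>?B. f b *\<^sub>R b) $ i = (\<Sum>b\<in>?B. f b *\<^sub>R b) \<bullet> c"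
      by (simp add: c inner_axis)
    also have "\<dots> = f c"
      using cB by (simp add: inner_sum_left_Basis)
    finally show ?thesis by (simp add: c axis_index_axis)
  qed
  let ?S = "\<lambda>f. \<Sum>b\<in>?B. f b *\<^sub>R b"
  have *: "(\<lambda>f. \<Prod>i\<in>UNIV. g i (?S f $ i)) = (\<lambda>f. \<Prod>b\<in>?B. ?h b (f b))"
    by (auto simp: reindex comp simp del: sum_component intro!: prod.cong)
  have meas[measurable]: "?S \<in> Pi\<^sub>M ?B ?L \<rightarrow>\<^sub>M borel" by measurable
  have "integrable (Pi\<^sub>M ?B ?L) (\<lambda>f. \<Prod>b\<in>?B. ?h b (f b))"
    by (intro P.product_integrable_prod int) simp
  then show "integrable lborel (\<lambda>x::real^'n. \<Prod>i\<in>UNIV. g i (x $ i))"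
    by (subst lborel_eq) (simp add: integrable_distr_eq * del: sum_component)
  have "(LINT x|lborel. (\<Prod>i\<in>UNIV. g i ((x::real^'n) $ i)))
      = (LINT f|Pi\<^sub>M ?B ?L. (\<Prod>b\<in>?B. ?h b (f b)))"
    by (subst lborel_eq) (simp add: integral_distr * del: sum_component)
  also have "\<dots> = (\<Prod>b\<in>?B. LINT t|lborel. ?h b t)"
    by (intro P.product_integral_prod int) simp
  also have "\<dots> = (\<Prod>i\<in>UNIV. LINT t|lborel. g i t)"
    by (simp add: reindex)
  finally show "(LINT x|lborel. (\<Prod>i\<in>UNIV. g i ((x::real^'n) $ i))) = (\<Prod>i\<in>UNIV. LINT t|lborel. g i t)" .
qed

lemma (in prob_space) indep_set_mono:
  "indep_set A B \<Longrightarrow> A' \<subseteq> A \<Longrightarrow> B' \<subseteq> B \<Longrightarrow> indep_set A' B'"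
  unfolding indep_sets2_eq by blast

text \<open>A monomial in the coordinates is absorbed into the product density as an extra factor at
  coordinates \<open>j\<close> and \<open>k\<close>, so each moment is a product of one-dimensional
  Gaussian moments. For distinct \<open>j\<close> and \<open>k\<close> the factor at
  \<open>j\<close> is a centred first moment, hence 0.\<close>

lemma normal_vec_moments:
  fixes s :: real
  assumes s: "0 < s"
  defines "d \<equiv> \<lambda>x::real^'n::finite. \<Prod>i\<in>UNIV. normal_density 0 s (x $ i)"
  shows "integrable lborel (\<lambda>x. d x * x $ j)" "(LINT x|lborel. d x * x $ j) = 0"
    and "integrable lborel (\<lambda>x. d x * (x $ j * x $ k))"
    and "(LINT x|lborel. d x * (x $ j * x $ k)) = (if j = k then s\<^sup>2 else 0)"
proof -
  let ?n = "normal_density 0 s"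
  have p: "(\<Prod>i\<in>UNIV. if i = j then F i else 1) = F j" for F :: "'n \<Rightarrow> real" and j
    by (subst prod.delta) auto
  let ?g = "\<lambda>i t. ?n t * (if i = j then t else 1)"
  have i0: "integrable lborel (?n)" "(LINT t|lborel. ?n t) = 1"
    using s by (auto simp: integrable_normal_density integral_normal_density)
  have i1: "integrable lborel (\<lambda>t. ?n t * t)" "(LINT t|lborel. ?n t * t) = 0"
    using integrable_normal_moment_nz_1[OF s] integral_normal_moment_nz_1[OF s] by auto
  have i2: "integrable lborel (\<lambda>t. ?n t * (t * t))" "(LINT t|lborel. ?n t * (t * t)) = s\<^sup>2"
    using integrable_normal_moment[OF s, of 0 2] integral_normal_moment_even[OF s, of 0 1] s
    by (auto simp: power2_eq_square divide_simps)
  have g1: "integrable lborel (?g i)" for i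
    using i0 i1 by (cases "i = j") auto
  have e1: "(\<lambda>x. d x * x $ j) = (\<lambda>x. \<Prod>i\<in>UNIV. ?g i (x $ i))"
    by (simp add: d_def prod.distrib p)
  show "integrable lborel (\<lambda>x. d x * x $ j)"
    unfolding e1 by (rule integral_lborel_prod_vec[OF g1])
  have "(LINT t|lborel. ?g j t) = 0" using i1 by simp
  then show "(LINT x|lborel. d x * x $ j) = 0"
    unfolding e1 by (subst integral_lborel_prod_vec(2)[OF g1]) (rule prod_zero, simp, blast)
  let ?f = "\<lambda>i t. ?n t * ((if i = j then t else 1) * (if i = k then t else 1))"
  have g2: "integrable lborel (?f i)" for i
    using i0 i1 i2 by (cases "i = j"; cases "i = k") auto
  have e2: "(\<lambda>x. d x * (x $ j * x $ k)) = (\<lambda>x. \<Prod>i\<in>UNIV. ?f i (x $ i))"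
    by (simp add: d_def prod.distrib p)
  show "integrable lborel (\<lambda>x. d x * (x $ j * x $ k))"
    unfolding e2 by (rule integral_lborel_prod_vec[OF g2])
  have v: "(LINT t|lborel. ?f i t) = (if i = j then if j = k then s\<^sup>2 else 0 else if i = k then 0 else 1)" for i
    using i0 i1 i2 by auto
  show "(LINT x|lborel. d x * (x $ j * x $ k)) = (if j = k then s\<^sup>2 else 0)"
    unfolding e2 integral_lborel_prod_vec(2)[OF g2] v
  proof (cases "j = k")
    case True
    then have "(\<Prod>i\<in>UNIV. if i = j then if j = k then s\<^sup>2 else 0 else if i = k then 0 else 1)
      = (\<Prod>i\<in>UNIV. if i = j then s\<^sup>2 else 1)" by (intro prod.cong) auto
    with True show "(\<Prod>i\<in>UNIV. if i = j then if j = k then s\<^sup>2 else 0 else if i = k then 0 else 1)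
      = (if j = k then s\<^sup>2 else 0)" by (simp add: p)
  next
    case False
    have "(\<Prod>i\<in>UNIV. if i = j then if j = k then s\<^sup>2 else 0 else if i = k then 0 else 1) = 0"
      by (rule prod_zero) (use False in \<open>auto intro!: exI[of _ j]\<close>)
    with False show "(\<Prod>i\<in>UNIV. if i = j then if j = k then s\<^sup>2 else 0 else if i = k then 0 else 1)
      = (if j = k then s\<^sup>2 else 0)" by simp
  qed
qed

lemma borel_measurable_vec_nth[measurable (raw)]:
  fixes f :: "'a \<Rightarrow> real^'n::finite"
  assumes "f \<in> borel_measurable N"
  shows "(\<lambda>x. f x $ i) \<in> borel_measurable N"
proof -
  have "(\<lambda>x. f x $ i) = (\<lambda>x. f x \<bullet> axis i 1)" by (simp add: inner_axis)
  then show ?thesis using assms by simp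
qed

section \<open>The augmented filtration and its independence of later increments\<close>

locale brownian =
  fixes M :: "'a measure" and W :: "real \<Rightarrow> 'a \<Rightarrow> real^('n::finite)"
  assumes bm: "brownian_motion M W"
begin

abbreviation "P \<equiv> completion M"
abbreviation "F \<equiv> augmented_filtration M W"

lemma prob_M: "prob_space M" using bm by (simp add: brownian_motion_def)

sublocale P: prob_space P
  by (rule prob_space.prob_space_completion[OF prob_M])

lemma W_measurable_M: "0 \<le> t \<Longrightarrow> W t \<in> borel_measurable M"
  using bm by (simp add: brownian_motion_def)

lemma space_natural[simp]: "space (natural_filtration M W t) = space M"
  unfolding natural_filtration_def by (rule space_measure_of) auto

lemma space_F[simp]: "space (F t) = space M"
  unfolding augmented_filtration_def
  by (rule space_measure_of)
     (use sets.sets_into_space[of _ "natural_filtration M W t"] null_sets.sets_into_space[of _ P] in auto)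

lemma sets_natural: "sets (natural_filtration M W t)
    = sigma_sets (space M) {W s -` A \<inter> space M | s A. 0 \<le> s \<and> s \<le> t \<and> A \<in> sets borel}"
  unfolding natural_filtration_def by (rule sets_measure_of) auto

lemma sets_F: "sets (F t) = sigma_sets (space M) (sets (natural_filtration M W t) \<union> null_sets P)"
  unfolding augmented_filtration_def
  by (rule sets_measure_of)
     (use sets.sets_into_space[of _ "natural_filtration M W t"] null_sets.sets_into_space[of _ P] in auto)

lemma sets_natural_subset: "sets (natural_filtration M W t) \<subseteq> sets M"
  unfolding sets_natural
  by (rule sets.sigma_sets_subset) (auto intro!: measurable_sets W_measurable_M)

lemma sets_F_subset: "sets (F t) \<subseteq> sets P"
proof -
  have "sets (natural_filtration M W t) \<union> null_sets P \<subseteq> sets P"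
    using sets_natural_subset by auto
  then show ?thesis
    using sets.sigma_sets_subset[of _ P] unfolding sets_F by simp
qed

lemma subalg_F: "subalgebra P (F t)"
  using sets_F_subset by (auto simp: subalgebra_def)

lemma F_mono:
  assumes "s \<le> t" shows "subalgebra (F t) (F s)"
proof -
  have "sets (natural_filtration M W s) \<subseteq> sets (natural_filtration M W t)"
    unfolding sets_natural by (rule sigma_sets_mono') (use assms order_trans in blast)
  then have "sets (F s) \<subseteq> sets (F t)"
    unfolding sets_F by (intro sigma_sets_mono') auto
  then show ?thesis by (auto simp: subalgebra_def)
qed

lemma measurable_F_mono: "s \<le> t \<Longrightarrow> f \<in> F s \<rightarrow>\<^sub>M N \<Longrightarrow> f \<in> F t \<rightarrow>\<^sub>M N"
  using F_mono measurable_from_subalg by blast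

lemma measurable_F_P: "f \<in> F s \<rightarrow>\<^sub>M N \<Longrightarrow> f \<in> P \<rightarrow>\<^sub>M N"
  using subalg_F measurable_from_subalg by blast

lemma W_measurable_F: 
  assumes "0 \<le> s" "s \<le> t" shows "W s \<in> borel_measurable (F t)"
proof (rule measurableI)
  fix A :: "(real^'n) set" assume "A \<in> sets borel"
  then have "W s -` A \<inter> space M \<in> sets (natural_filtration M W t)"
    unfolding sets_natural using assms by (intro sigma_sets.Basic) auto
  then show "W s -` A \<inter> space (F t) \<in> sets (F t)"
    unfolding sets_F by (auto intro!: sigma_sets.Basic)
qed auto

text \<open>Sets of the augmented filtration inherit independence from almost surely equal sets of the
  natural one.\<close>

lemma F_AE_natural:
  assumes "A \<in> sets (F t)"
  shows "\<exists>B\<in>sets (natural_filtration M W t). AE \<omega> in P. \<omega> \<in> A \<longleftrightarrow> \<omega> \<in> B"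
  using assms[unfolded sets_F]
proof (induction rule: sigma_sets.induct)
  case (Basic a)
  then show ?case
  proof
    assume "a \<in> null_sets P"
    then have "AE \<omega> in P. \<omega> \<in> a \<longleftrightarrow> \<omega> \<in> {}"
      using AE_not_in by fastforce
    then show ?thesis by blast
  qed auto
next
  case Empty
  then show ?case by auto
next
  case (Compl a)
  then obtain B where B: "B\<in>sets (natural_filtration M W t)" "AE \<omega> in P. \<omega> \<in> a \<longleftrightarrow> \<omega> \<in> B" by auto
  then have "AE \<omega> in P. \<omega> \<in> space M - a \<longleftrightarrow> \<omega> \<in> space M - B" by auto
  moreover have "space M - B \<in> sets (natural_filtration M W t)"
    using sets.compl_sets[OF B(1)] by simp
  ultimately show ?case by blast
next
  case (Union a)
  then obtain B where B: "\<And>i. B i\<in>sets (natural_filtration M W t)" 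
      "\<And>i. AE \<omega> in P. \<omega> \<in> a i \<longleftrightarrow> \<omega> \<in> B i" by metis
  then have "AE \<omega> in P. \<forall>i::nat. \<omega> \<in> a i \<longleftrightarrow> \<omega> \<in> B i" 
    by (simp add: AE_all_countable)
  then have "AE \<omega> in P. \<omega> \<in> (\<Union>i. a i) \<longleftrightarrow> \<omega> \<in> (\<Union>i. B i)" by auto
  moreover have "(\<Union>i. B i) \<in> sets (natural_filtration M W t)"
    using B(1) by auto
  ultimately show ?case by blast
qed

text \<open>Inner products with \<open>W\<close> are computed through scalar coordinates, because
  distinct coordinates of an increment are uncorrelated and only diagonal terms survive.\<close>

definition incr :: "'n \<Rightarrow> real \<Rightarrow> real \<Rightarrow> 'a \<Rightarrow> real" where
  "incr j s t \<omega> = (W t \<omega> - W s \<omega>) $ j"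

lemma incr_measurable:
  assumes "0 \<le> s" "s \<le> u" "0 \<le> t" "t \<le> u"
  shows "incr j s t \<in> borel_measurable (F u)"
proof -
  have [measurable]: "W s \<in> borel_measurable (F u)" "W t \<in> borel_measurable (F u)"
    using assms W_measurable_F by auto
  show ?thesis unfolding incr_def[abs_def] by measurable
qed

lemma incr_split: "incr j s t \<omega> = incr j s u \<omega> + incr j u t \<omega>"
  by (simp add: incr_def)

lemma incr_same[simp]: "incr j s s \<omega> = 0"
  by (simp add: incr_def)

lemma incr_moments:
  assumes "0 \<le> s" "s < t"
  shows "integrable P (incr j s t)" "P.expectation (incr j s t) = 0"
    and "integrable P (\<lambda>\<omega>. incr j s t \<omega> * incr k s t \<omega>)"
    and "P.expectation (\<lambda>\<omega>. incr j s t \<omega> * incr k s t \<omega>) = (if j = k then t - s else 0)"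
proof -
  let ?d = "\<lambda>x::real^'n. \<Prod>i\<in>UNIV. normal_density 0 (sqrt (t - s)) (x $ i)"
  have D: "distributed M lborel (\<lambda>\<omega>. W t \<omega> - W s \<omega>) (\<lambda>x. ennreal (?d x))"
    using bm assms unfolding brownian_motion_def by blast
  have pos: "0 < sqrt (t - s)" using assms by simp
  have nn: "0 \<le> ?d x" for x by (intro prod_nonneg) auto
  note m = normal_vec_moments[OF pos]
  have [measurable]: "W s \<in> borel_measurable M" "W t \<in> borel_measurable M"
    using assms W_measurable_M by auto
  have [measurable]: "incr j s t \<in> borel_measurable M" for j
    unfolding incr_def[abs_def] by measurable
  show "integrable P (incr j s t)"
    using distributed_integrable[OF D, of "\<lambda>x. x $ j"] m(1)[of j] nn
    by (simp add: integrable_completion incr_def[abs_def])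
  show "P.expectation (incr j s t) = 0"
    using distributed_integral[OF D, of "\<lambda>x. x $ j"] m(2)[of j] nn
    by (simp add: integral_completion incr_def[abs_def])
  show "integrable P (\<lambda>\<omega>. incr j s t \<omega> * incr k s t \<omega>)"
    using distributed_integrable[OF D, of "\<lambda>x. x $ j * x $ k"] m(3)[of j k] nn
    by (simp add: integrable_completion incr_def[abs_def])
  show "P.expectation (\<lambda>\<omega>. incr j s t \<omega> * incr k s t \<omega>) = (if j = k then t - s else 0)"
    using distributed_integral[OF D, of "\<lambda>x. x $ j * x $ k"] m(4)[of j k] nn assms
    by (cases "j = k") (simp_all add: integral_completion incr_def[abs_def])
qed

text \<open>\<open>brownian_motion\<close> grants independence only of the natural filtration and
  only over \<open>M\<close>. Replacing a set of \<open>F s\<close> by an almost surely equal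
  natural one changes neither its probability nor that of its intersections, so independence
  survives both augmentation and completion.\<close>

lemma indep_increment:
  assumes "0 \<le> s" "s < t" and \<eta>: "\<eta> \<in> borel_measurable (F s)"
    and h: "h \<in> borel_measurable borel"
  shows "P.indep_var borel (\<eta> :: 'a \<Rightarrow> real) borel (\<lambda>\<omega>. h (W t \<omega> - W s \<omega>) :: real)"
proof -
  interpret M: prob_space M by (rule prob_M)
  let ?V = "\<lambda>\<omega>. W t \<omega> - W s \<omega>"
  have [measurable]: "W s \<in> borel_measurable M" "W t \<in> borel_measurable M"
    using assms W_measurable_M by auto
  have V[measurable]: "?V \<in> borel_measurable M" by measurable
  have V'[measurable]: "?V \<in> borel_measurable P" by (intro measurable_completion V)
  let ?S = "{?V -` A \<inter> space M | A. A \<in> sets borel}"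
  have ind: "M.indep_set (sets (natural_filtration M W s)) ?S"
    using bm assms unfolding brownian_motion_def by blast
  have Ssub: "?S \<subseteq> sets P"
    using V' by (auto dest: measurable_sets)
  have ind': "P.indep_set (sets (F s)) ?S"
  proof (rule P.indep_setI[OF sets_F_subset Ssub])
    fix a c assume a: "a \<in> sets (F s)" and c: "c \<in> ?S"
    obtain B where B: "B \<in> sets (natural_filtration M W s)" "AE \<omega> in P. \<omega> \<in> a \<longleftrightarrow> \<omega> \<in> B"
      using F_AE_natural[OF a] by auto
    have BM: "B \<in> sets M" and cM: "c \<in> sets M"
      using B sets_natural_subset c V by (auto dest: measurable_sets)
    have "P.prob (a \<inter> c) = P.prob (B \<inter> c)"
      by (rule P.finite_measure_eq_AE) (use B a BM cM sets_F_subset in auto)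
    also have "\<dots> = M.prob B * M.prob c"
      using M.indep_setD[OF ind B(1) c] BM cM by (simp add: sets.Int)
    also have "\<dots> = P.prob a * P.prob c"
      using P.finite_measure_eq_AE[OF B(2)] subsetD[OF sets_F_subset a] BM cM by auto
    finally show "P.prob (a \<inter> c) = P.prob a * P.prob c" .
  qed
  show ?thesis
    unfolding P.indep_var_eq
  proof (intro conjI)
    show "\<eta> \<in> borel_measurable P" by (rule measurable_F_P[OF \<eta>])
    show "(\<lambda>\<omega>. h (?V \<omega>)) \<in> borel_measurable P" using h V' by measurable
    have "sigma_sets (space P) {\<eta> -` A \<inter> space P |A. A \<in> sets borel} \<subseteq> sets (F s)"
      using sets.sigma_sets_subset[of "{\<eta> -` A \<inter> space P |A. A \<in> sets borel}" "F s"]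
        measurable_sets[OF \<eta>] by auto
    \<comment> \<open>\<open>?S\<close> is itself the sigma-algebra generated by \<open>?V\<close>,
      so it contains the one generated by the Borel function \<open>h\<close> of
      \<open>?V\<close>.\<close>
    moreover have "sigma_sets (space P) {(\<lambda>\<omega>. h (?V \<omega>)) -` A \<inter> space P |A. A \<in> sets borel} \<subseteq> ?S"
    proof -
      have "{(\<lambda>\<omega>. h (?V \<omega>)) -` A \<inter> space P |A. A \<in> sets borel} \<subseteq> sets (vimage_algebra (space M) ?V borel)"
      proof safe
        fix A :: "real set" assume "A \<in> sets borel"
        then have "h -` A \<inter> space borel \<in> sets borel" using h by (rule measurable_sets[rotated])
        then show "(\<lambda>\<omega>. h (?V \<omega>)) -` A \<inter> space P \<in> sets (vimage_algebra (space M) ?V borel)"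
          by (auto simp: sets_vimage_algebra2 intro!: exI[of _ "h -` A"])
      qed
      then have "sigma_sets (space M) {(\<lambda>\<omega>. h (?V \<omega>)) -` A \<inter> space P |A. A \<in> sets borel}
          \<subseteq> sets (vimage_algebra (space M) ?V borel)"
        using sets.sigma_sets_subset[of _ "vimage_algebra (space M) ?V borel"] by simp
      then show ?thesis by (simp add: sets_vimage_algebra2)
    qed
    ultimately show "P.indep_set (sigma_sets (space P) {\<eta> -` A \<inter> space P |A. A \<in> sets borel})
         (sigma_sets (space P) {(\<lambda>\<omega>. h (?V \<omega>)) -` A \<inter> space P |A. A \<in> sets borel})"
      by (rule P.indep_set_mono[OF ind'])
  qed
qed

lemma expectation_indep_increment:
  assumes "0 \<le> s" "s < t" "\<eta> \<in> borel_measurable (F s)" "integrable P \<eta>"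
    and "h \<in> borel_measurable borel" "integrable P (\<lambda>\<omega>. h (W t \<omega> - W s \<omega>) :: real)"
  shows "integrable P (\<lambda>\<omega>. \<eta> \<omega> * h (W t \<omega> - W s \<omega>))"
    and "P.expectation (\<lambda>\<omega>. \<eta> \<omega> * h (W t \<omega> - W s \<omega>))
       = P.expectation \<eta> * P.expectation (\<lambda>\<omega>. h (W t \<omega> - W s \<omega>))"
  using P.indep_var_integrable[OF indep_increment[OF assms(1-3,5)] assms(4,6)]
    P.indep_var_lebesgue_integral[OF indep_increment[OF assms(1-3,5)] assms(4,6)] by auto

lemma expectation_incr:
  assumes "0 \<le> s" "s \<le> t" "\<eta> \<in> borel_measurable (F s)" "integrable P \<eta>"
  shows "integrable P (\<lambda>\<omega>. \<eta> \<omega> * incr j s t \<omega>)" "P.expectation (\<lambda>\<omega>. \<eta> \<omega> * incr j s t \<omega>) = 0"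
    and "integrable P (\<lambda>\<omega>. \<eta> \<omega> * (incr j s t \<omega> * incr k s t \<omega>))"
    and "P.expectation (\<lambda>\<omega>. \<eta> \<omega> * (incr j s t \<omega> * incr k s t \<omega>)) = (if j = k then t - s else 0) * P.expectation \<eta>"
proof -
  have "integrable P (\<lambda>\<omega>. \<eta> \<omega> * incr j s t \<omega>) \<and> P.expectation (\<lambda>\<omega>. \<eta> \<omega> * incr j s t \<omega>) = 0
    \<and> integrable P (\<lambda>\<omega>. \<eta> \<omega> * (incr j s t \<omega> * incr k s t \<omega>)) 
    \<and> P.expectation (\<lambda>\<omega>. \<eta> \<omega> * (incr j s t \<omega> * incr k s t \<omega>)) = (if j = k then t - s else 0) * P.expectation \<eta>"
  \<comment> \<open>\<open>brownian_motion\<close> describes the law of an increment only for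
    \<open>s < t\<close>; for \<open>s = t\<close> every claim is about the zero function.\<close>
  proof (cases "s = t")
    case False
    then have "s < t" using assms by simp
    note e = expectation_indep_increment[OF assms(1) this assms(3,4)]
    note m = incr_moments[OF assms(1) \<open>s < t\<close>]
    show ?thesis
      using e[of "\<lambda>x. x $ j"] e[of "\<lambda>x. x $ j * x $ k"] m(1,2)[of j] m(3,4)[of j k]
      by (simp add: incr_def[abs_def])
  qed auto
  then show "integrable P (\<lambda>\<omega>. \<eta> \<omega> * incr j s t \<omega>)" "P.expectation (\<lambda>\<omega>. \<eta> \<omega> * incr j s t \<omega>) = 0"
    and "integrable P (\<lambda>\<omega>. \<eta> \<omega> * (incr j s t \<omega> * incr k s t \<omega>))"
    and "P.expectation (\<lambda>\<omega>. \<eta> \<omega> * (incr j s t \<omega> * incr k s t \<omega>)) = (if j = k then t - s else 0) * P.expectation \<eta>"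
    by auto
qed

text \<open>The earlier increment is already known at time \<open>c\<close>, so it can be moved into
  the weight; the later increment is centred and independent of it. The enlarged weight is unbounded
  but integrable, which is all that \<open>expectation_incr\<close> requires.\<close>

lemma expectation_incr_disjoint:
  assumes "0 \<le> a" "a \<le> b" "b \<le> c" "c \<le> d" "\<eta> \<in> borel_measurable (F c)" 
    and B: "\<And>\<omega>. \<omega> \<in> space M \<Longrightarrow> \<bar>\<eta> \<omega>\<bar> \<le> B"
  shows "integrable P (\<lambda>\<omega>. \<eta> \<omega> * (incr j a b \<omega> * incr k c d \<omega>))" 
    and "P.expectation (\<lambda>\<omega>. \<eta> \<omega> * (incr j a b \<omega> * incr k c d \<omega>)) = 0"
proof -
  have [measurable]: "incr j a b \<in> borel_measurable (F c)" by (rule incr_measurable) (use assms in auto)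
  note [measurable] = assms(5)
  have m: "(\<lambda>\<omega>. \<eta> \<omega> * incr j a b \<omega>) \<in> borel_measurable (F c)" by measurable
  have "integrable P (\<lambda>\<omega>. 1 * incr j a b \<omega>)"
    by (rule expectation_incr(1)) (use assms(1,2) in simp_all)
  then have i1: "integrable P (incr j a b)"
    by (simp only: mult_1)
  have i: "integrable P (\<lambda>\<omega>. \<eta> \<omega> * incr j a b \<omega>)"
  proof (rule Bochner_Integration.integrable_bound[OF integrable_mult_right[OF i1, of B]])
    show "AE \<omega> in P. norm (\<eta> \<omega> * incr j a b \<omega>) \<le> norm (B * incr j a b \<omega>)"
    proof (rule AE_I2)
      fix \<omega> assume "\<omega> \<in> space P"
      then have "\<bar>\<eta> \<omega>\<bar> \<le> \<bar>B\<bar>" using B[of \<omega>] by simp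
      then show "norm (\<eta> \<omega> * incr j a b \<omega>) \<le> norm (B * incr j a b \<omega>)"
        by (simp add: abs_mult mult_right_mono)
    qed
  qed (rule measurable_F_P[OF m])
  have c: "0 \<le> c" using assms by simp
  show "integrable P (\<lambda>\<omega>. \<eta> \<omega> * (incr j a b \<omega> * incr k c d \<omega>))" 
    and "P.expectation (\<lambda>\<omega>. \<eta> \<omega> * (incr j a b \<omega> * incr k c d \<omega>)) = 0"
    using expectation_incr(1,2)[OF c assms(4) m i, of k] by (simp_all add: mult.assoc)
qed

end

subsection \<open>Elementary stochastic integrals\<close>

lemma (in pair_sigma_finite) integrable_pair_mult:
  fixes f :: "'a \<Rightarrow> real" and g :: "'b \<Rightarrow> real"
  assumes f: "integrable M1 f" and g: "integrable M2 g"
  shows "integrable (M1 \<Otimes>\<^sub>M M2) (\<lambda>(x, y). f x * g y)"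
proof (rule Fubini_integrable)
  have [measurable]: "f \<in> borel_measurable M1" "g \<in> borel_measurable M2"
    using f g by auto
  show "(\<lambda>(x, y). f x * g y) \<in> borel_measurable (M1 \<Otimes>\<^sub>M M2)" by measurable
  show "integrable M1 (\<lambda>x. \<integral> y. norm (case (x, y) of (x, y) \<Rightarrow> f x * g y) \<partial>M2)"
    using f by (simp add: abs_mult)
  show "AE x in M1. integrable M2 (\<lambda>y. case (x, y) of (x, y) \<Rightarrow> f x * g y)"
    using g by simp
qed

context brownian begin

text \<open>Both intervals are cut at each other's endpoints. Disjoint pieces contribute nothing,
  and the common piece contributes its length, which is \<open>max 0 (min b d - c)\<close>. The
  weight is known only at \<open>c\<close>, so in every product of disjoint pieces the later piece
  must start at \<open>c\<close> or after it; the assumption \<open>a \<le> c\<close> arranges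
  this.\<close>

lemma expectation_incr_overlap:
  assumes ab: "0 \<le> a" "a \<le> b" and cd: "a \<le> c" "c \<le> d" 
    and \<eta>: "\<eta> \<in> borel_measurable (F c)" 
    and B: "\<And>\<omega>. \<omega> \<in> space M \<Longrightarrow> \<bar>\<eta> \<omega>\<bar> \<le> B"
  shows "has_bochner_integral P (\<lambda>\<omega>. \<eta> \<omega> * (incr j a b \<omega> * incr k c d \<omega>)) 
      ((if j = k then max 0 (min b d - c) else 0) * P.expectation \<eta>)"
proof -
  have dis: "has_bochner_integral P (\<lambda>\<omega>. \<eta> \<omega> * (incr j p q \<omega> * incr k u v \<omega>)) 0"
    if "a \<le> p" "p \<le> q" "q \<le> u" "u \<le> v" "c \<le> u" for p q u v j k
    using expectation_incr_disjoint[of p q u v \<eta> B j k] that ab B measurable_F_mono[OF \<open>c \<le> u\<close> \<eta>]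
    by (auto simp: has_bochner_integral_iff)
  have i\<eta>: "integrable P \<eta>"
    by (rule P.integrable_const_bound[of _ B]) (use B measurable_F_P[OF \<eta>] in auto)
  have eq: "has_bochner_integral P (\<lambda>\<omega>. \<eta> \<omega> * (incr j c v \<omega> * incr k c v \<omega>)) 
      ((if j = k then v - c else 0) * P.expectation \<eta>)" if "c \<le> v" for v
    using expectation_incr(3,4)[of c v \<eta> j k] that ab cd \<eta> i\<eta>
    by (auto simp: has_bochner_integral_iff)
  consider "b \<le> c" | "c \<le> b" "b \<le> d" | "c \<le> b" "d \<le> b" by linarith
  then show ?thesis
  proof cases
    case 1
    then have e: "(if j = k then max 0 (min b d - c) else 0) * P.expectation \<eta> = 0"
      by (simp add: max_def min_def)
    show ?thesis unfolding e using 1 dis[of a b c d j k] ab cd by auto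
  next
    case 2
    have "has_bochner_integral P (\<lambda>\<omega>. \<eta> \<omega> * (incr j a c \<omega> * incr k c d \<omega>) 
       + \<eta> \<omega> * (incr j c b \<omega> * incr k c b \<omega>) + \<eta> \<omega> * (incr j c b \<omega> * incr k b d \<omega>))
       (0 + (if j = k then b - c else 0) * P.expectation \<eta> + 0)"
      by (intro has_bochner_integral_add dis eq) (use 2 ab cd in auto)
    moreover have "(\<lambda>\<omega>. \<eta> \<omega> * (incr j a c \<omega> * incr k c d \<omega>) 
       + \<eta> \<omega> * (incr j c b \<omega> * incr k c b \<omega>) + \<eta> \<omega> * (incr j c b \<omega> * incr k b d \<omega>))
       = (\<lambda>\<omega>. \<eta> \<omega> * (incr j a b \<omega> * incr k c d \<omega>))"
      by (auto simp: incr_split[of j a b _ c] incr_split[of k c d _ b] algebra_simps)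
    moreover have e: "max 0 (min b d - c) = b - c" using 2 by simp
    ultimately show ?thesis unfolding e by simp
  next
    case 3
    \<comment> \<open>The factors of the last summand are exchanged, because \<open>dis\<close>
      expects the increment that comes first in time on the left.\<close>
    have "has_bochner_integral P (\<lambda>\<omega>. \<eta> \<omega> * (incr j a c \<omega> * incr k c d \<omega>) 
       + \<eta> \<omega> * (incr j c d \<omega> * incr k c d \<omega>) + \<eta> \<omega> * (incr k c d \<omega> * incr j d b \<omega>))
       (0 + (if j = k then d - c else 0) * P.expectation \<eta> + 0)"
      by (intro has_bochner_integral_add dis eq) (use 3 ab cd in auto)
    moreover have "(\<lambda>\<omega>. \<eta> \<omega> * (incr j a c \<omega> * incr k c d \<omega>) 
       + \<eta> \<omega> * (incr j c d \<omega> * incr k c d \<omega>) + \<eta> \<omega> * (incr k c d \<omega> * incr j d b \<omega>))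
       = (\<lambda>\<omega>. \<eta> \<omega> * (incr j a b \<omega> * incr k c d \<omega>))"
      by (auto simp: incr_split[of j a b _ c] incr_split[of j c b _ d] algebra_simps)
    moreover have e: "max 0 (min b d - c) = d - c" using 3 cd by simp
    ultimately show ?thesis unfolding e by simp
  qed
qed

lemma inner_incr: "v \<bullet> (W q \<omega> - W p \<omega>) = (\<Sum>j\<in>UNIV. v $ j * incr j p q \<omega>)"
  by (simp add: inner_vec_def incr_def)

text \<open>In coordinates each product of increments is weighted by a bounded factor known at the
  later of the two left endpoints, so the overlap formula applies to every pair \<open>j\<close>,
  \<open>k\<close>. The diagonal terms reassemble to the inner product of the integrands times the
  length of the overlap.\<close>

lemma elementary_covariance:
  assumes "0 \<le> s" "s \<le> a" "a \<le> b" "s \<le> c" "c \<le> d"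
    and w: "w \<in> borel_measurable (F s)" and C: "\<And>\<omega>. \<omega> \<in> space M \<Longrightarrow> \<bar>w \<omega>\<bar> \<le> C"
    and \<xi>: "\<xi> \<in> borel_measurable (F a)" and B: "\<And>\<omega>. \<omega> \<in> space M \<Longrightarrow> norm (\<xi> \<omega> :: real^'n) \<le> B"
    and \<zeta>: "\<zeta> \<in> borel_measurable (F c)" and D: "\<And>\<omega>. \<omega> \<in> space M \<Longrightarrow> norm (\<zeta> \<omega> :: real^'n) \<le> D"
  shows "has_bochner_integral P 
    (\<lambda>\<omega>. w \<omega> * ((\<xi> \<omega> \<bullet> (W b \<omega> - W a \<omega>)) * (\<zeta> \<omega> \<bullet> (W d \<omega> - W c \<omega>))))
    (P.expectation (\<lambda>\<omega>. w \<omega> * (measure lborel ({a<..b} \<inter> {c<..d}) * (\<xi> \<omega> \<bullet> \<zeta> \<omega>))))"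
proof -
  define \<eta> where "\<eta> = (\<lambda>j k \<omega>. w \<omega> * (\<xi> \<omega> $ j * \<zeta> \<omega> $ k))"
  define L where "L = measure lborel ({a<..b} \<inter> {c<..d})"
  have L: "L = max 0 (min b d - max a c)"
  proof -
    have "{a<..b} \<inter> {c<..d} = {max a c<..min b d}" by auto
    then show ?thesis
      unfolding L_def by (cases "max a c \<le> min b d") auto
  qed
  have \<eta>m: "\<eta> j k \<in> borel_measurable (F (max a c))" for j k
  proof -
    have [measurable]: "w \<in> borel_measurable (F (max a c))" "\<xi> \<in> borel_measurable (F (max a c))" 
        "\<zeta> \<in> borel_measurable (F (max a c))"
      using measurable_F_mono[OF _ w, of "max a c"] measurable_F_mono[OF _ \<xi>, of "max a c"] 
        measurable_F_mono[OF _ \<zeta>, of "max a c"] assms by auto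
    show ?thesis unfolding \<eta>_def by measurable
  qed
  have \<eta>b: "\<bar>\<eta> j k \<omega>\<bar> \<le> C * (B * D)" if "\<omega> \<in> space M" for \<omega> j k
  proof -
    have "\<bar>\<xi> \<omega> $ j\<bar> \<le> B" "\<bar>\<zeta> \<omega> $ k\<bar> \<le> D"
      using B[OF that] D[OF that] component_le_norm_cart[of "\<xi> \<omega>" j] component_le_norm_cart[of "\<zeta> \<omega>" k] by auto
    then show ?thesis
      using mult_mono[OF C[OF that] mult_mono[of "\<bar>\<xi> \<omega> $ j\<bar>" B "\<bar>\<zeta> \<omega> $ k\<bar>" D]] C[OF that]
      by (simp add: \<eta>_def abs_mult)
  qed
  have i\<eta>: "integrable P (\<eta> j k)" for j k
    by (rule P.integrable_const_bound[of _ "C * (B * D)"]) (use \<eta>b measurable_F_P[OF \<eta>m] in auto)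
  have term_: "has_bochner_integral P (\<lambda>\<omega>. \<eta> j k \<omega> * (incr j a b \<omega> * incr k c d \<omega>)) 
      ((if j = k then L else 0) * P.expectation (\<eta> j k))" for j k
  proof (cases "a \<le> c")
    case True
    then show ?thesis 
      using expectation_incr_overlap[of a b c d "\<eta> j k" "C * (B * D)" j k] \<eta>m[of j k] \<eta>b assms(1-5)
      by (simp only: L max_absorb2)
  next
    case False
    \<comment> \<open>\<open>expectation_incr_overlap\<close> wants the interval that starts first
      as its first one, so the two integrals exchange roles here.\<close>
    then have Lr: "L = max 0 (min d b - a)"
      by (simp add: L max_absorb1 min.commute)
    have "has_bochner_integral P (\<lambda>\<omega>. \<eta> j k \<omega> * (incr k c d \<omega> * incr j a b \<omega>))
        ((if k = j then max 0 (min d b - a) else 0) * P.expectation (\<eta> j k))"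
      by (rule expectation_incr_overlap[of c d a b "\<eta> j k" "C * (B * D)"])
         (use False \<eta>m[of j k] \<eta>b assms(1-5) in \<open>auto simp: max_absorb1\<close>)
    then show ?thesis
      unfolding Lr[symmetric] by (simp add: mult.commute eq_commute[of j k] split del: if_split)
  qed
  have "has_bochner_integral P (\<lambda>\<omega>. \<Sum>j\<in>UNIV. \<Sum>k\<in>UNIV. \<eta> j k \<omega> * (incr j a b \<omega> * incr k c d \<omega>))
     (\<Sum>j\<in>UNIV. \<Sum>k\<in>UNIV. (if j = k then L else 0) * P.expectation (\<eta> j k))"
    by (intro has_bochner_integral_sum term_)
  moreover have "(\<lambda>\<omega>. \<Sum>j\<in>UNIV. \<Sum>k\<in>UNIV. \<eta> j k \<omega> * (incr j a b \<omega> * incr k c d \<omega>))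
     = (\<lambda>\<omega>. w \<omega> * ((\<xi> \<omega> \<bullet> (W b \<omega> - W a \<omega>)) * (\<zeta> \<omega> \<bullet> (W d \<omega> - W c \<omega>))))"
    unfolding inner_incr sum_product unfolding sum_distrib_left \<eta>_def by (intro ext sum.cong refl) (simp add: ac_simps)
  moreover have "(\<Sum>j\<in>UNIV. \<Sum>k\<in>UNIV. (if j = k then L else 0) * P.expectation (\<eta> j k))
     = P.expectation (\<lambda>\<omega>. \<Sum>j\<in>UNIV. L * \<eta> j j \<omega>)"
    by (subst Bochner_Integration.integral_sum) (auto intro!: i\<eta> sum.cong simp: if_distrib[of "\<lambda>x. x * _"] sum.delta cong: if_cong)
  moreover have "(\<lambda>\<omega>. \<Sum>j\<in>UNIV. L * \<eta> j j \<omega>) = (\<lambda>\<omega>. w \<omega> * (L * (\<xi> \<omega> \<bullet> \<zeta> \<omega>)))"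
    by (simp add: \<eta>_def inner_vec_def sum_distrib_left ac_simps)
  ultimately show ?thesis by (simp add: L_def)
qed

text \<open>The weight \<open>w\<close> encodes conditioning on \<open>F s\<close>. Overlapping
  intervals are allowed because two unrelated grids are merged later. Their cross terms do not
  vanish, but each is weighted by the length of an overlap, and so they are exactly the cross terms
  in the integral of \<open>(norm (Z \<omega> r))\<^sup>2\<close>. The version on the product space
  serves the passage to the limit, since integrands converge in L2 of that space.\<close>

lemma elementary_sum_moments:
  fixes a b :: "'i \<Rightarrow> real" and \<xi> :: "'i \<Rightarrow> 'a \<Rightarrow> real^'n"
  assumes s: "0 \<le> s" and A: "finite A" and ab: "\<And>i. i \<in> A \<Longrightarrow> s \<le> a i \<and> a i \<le> b i"
    and w: "w \<in> borel_measurable (F s)" and C: "\<And>\<omega>. \<omega> \<in> space M \<Longrightarrow> \<bar>w \<omega>\<bar> \<le> C"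
    and \<xi>: "\<And>i. i \<in> A \<Longrightarrow> \<xi> i \<in> borel_measurable (F (a i))" 
    and B: "\<And>i. i \<in> A \<Longrightarrow> bounded (\<xi> i ` space M)"
  defines "S \<equiv> \<lambda>\<omega>. \<Sum>i\<in>A. \<xi> i \<omega> \<bullet> (W (b i) \<omega> - W (a i) \<omega>)"
    and "Z \<equiv> \<lambda>\<omega> r. \<Sum>i\<in>A. indicator {a i<..b i} r *\<^sub>R \<xi> i \<omega>"
  shows "S \<in> borel_measurable P"
    and "has_bochner_integral P (\<lambda>\<omega>. w \<omega> * S \<omega>) 0"
    and "has_bochner_integral P (\<lambda>\<omega>. w \<omega> * (S \<omega>)\<^sup>2)
           (P.expectation (\<lambda>\<omega>. w \<omega> * (LINT r|lborel. (norm (Z \<omega> r))\<^sup>2)))"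
    and "has_bochner_integral (P \<Otimes>\<^sub>M lborel) (\<lambda>(\<omega>, r). w \<omega> * (norm (Z \<omega> r))\<^sup>2) 
           (P.expectation (\<lambda>\<omega>. w \<omega> * (LINT r|lborel. (norm (Z \<omega> r))\<^sup>2)))"
proof -
  obtain D where D: "\<And>i \<omega>. i \<in> A \<Longrightarrow> \<omega> \<in> space M \<Longrightarrow> norm (\<xi> i \<omega>) \<le> D i"
    using B unfolding bounded_iff by (metis imageI)
  have [measurable]: "\<xi> i \<in> borel_measurable P" if "i \<in> A" for i
    by (rule measurable_F_P[OF \<xi>[OF that]])
  have [measurable]: "w \<in> borel_measurable P" by (rule measurable_F_P[OF w])
  have inc[measurable]: "incr j (a i) (b i) \<in> borel_measurable P" if "i \<in> A" for i j
    by (rule measurable_F_P[OF incr_measurable[where u = "b i"]]) (use s ab[OF that] in auto)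
  show "S \<in> borel_measurable P"
    unfolding S_def inner_incr by measurable
  have one: "has_bochner_integral P (\<lambda>\<omega>. w \<omega> * (\<xi> i \<omega> \<bullet> (W (b i) \<omega> - W (a i) \<omega>))) 0" if i: "i \<in> A" for i
  proof -
    have *: "has_bochner_integral P (\<lambda>\<omega>. (w \<omega> * \<xi> i \<omega> $ j) * incr j (a i) (b i) \<omega>) 0" for j
    proof -
      have [measurable]: "w \<in> borel_measurable (F (a i))" "\<xi> i \<in> borel_measurable (F (a i))"
        using measurable_F_mono[OF _ w, of "a i"] \<xi>[OF i] ab[OF i] by auto
      have m: "(\<lambda>\<omega>. w \<omega> * \<xi> i \<omega> $ j) \<in> borel_measurable (F (a i))" by measurable
      have "integrable P (\<lambda>\<omega>. w \<omega> * \<xi> i \<omega> $ j)"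
      proof (rule P.integrable_const_bound[of _ "C * D i"])
        show "AE \<omega> in P. norm (w \<omega> * \<xi> i \<omega> $ j) \<le> C * D i"
        proof (rule AE_I2)
          fix \<omega> assume \<omega>: "\<omega> \<in> space P"
          then have "\<bar>\<xi> i \<omega> $ j\<bar> \<le> D i"
            using order_trans[OF component_le_norm_cart[of "\<xi> i \<omega>" j] D[OF i]] by auto
          then show "norm (w \<omega> * \<xi> i \<omega> $ j) \<le> C * D i"
            using C[of \<omega>] \<omega> by (auto simp: abs_mult intro!: mult_mono)
        qed
      qed (rule measurable_F_P[OF m])
      then show ?thesis
        using expectation_incr(1,2)[OF _ _ m, of "b i" j] s ab[OF i] by (simp add: has_bochner_integral_iff)
    qed
    have "has_bochner_integral P (\<lambda>\<omega>. \<Sum>j\<in>UNIV. (w \<omega> * \<xi> i \<omega> $ j) * incr j (a i) (b i) \<omega>) (\<Sum>j::'n\<in>UNIV. 0)"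
      by (intro has_bochner_integral_sum *)
    then show ?thesis
      by (simp add: inner_incr sum_distrib_left mult.assoc)
  qed
  have "has_bochner_integral P (\<lambda>\<omega>. \<Sum>i\<in>A. w \<omega> * (\<xi> i \<omega> \<bullet> (W (b i) \<omega> - W (a i) \<omega>))) (\<Sum>i\<in>A. 0)"
    by (intro has_bochner_integral_sum one)
  then show "has_bochner_integral P (\<lambda>\<omega>. w \<omega> * S \<omega>) 0"
    by (simp add: S_def sum_distrib_left)
  let ?L = "\<lambda>i i'. measure lborel ({a i<..b i} \<inter> {a i'<..b i'})"
  have Zsq: "(norm (Z \<omega> r))\<^sup>2 = (\<Sum>i\<in>A. \<Sum>i'\<in>A. indicator ({a i<..b i} \<inter> {a i'<..b i'}) r * (\<xi> i \<omega> \<bullet> \<xi> i' \<omega>))" for \<omega> r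
    unfolding power2_norm_eq_inner Z_def inner_sum_left inner_sum_right
    by (subst sum.swap) (intro sum.cong refl, auto simp: indicator_def ac_simps)
  have ie: "{a i<..b i} \<inter> {a i'<..b i'} = {max (a i) (a i')<..min (b i) (b i')}" for i i' by auto
  have fin: "emeasure lborel {l<..u} < \<infinity>" for l u :: real
    by (cases "l \<le> u") auto
  have Zint: "has_bochner_integral lborel (\<lambda>r. (norm (Z \<omega> r))\<^sup>2) (\<Sum>i\<in>A. \<Sum>i'\<in>A. ?L i i' * (\<xi> i \<omega> \<bullet> \<xi> i' \<omega>))" for \<omega>
    unfolding Zsq
    by (intro has_bochner_integral_sum has_bochner_integral_mult_left has_bochner_integral_real_indicator)
       (use fin in \<open>auto simp: ie less_top\<close>)
  have bb: "\<bar>\<xi> i \<omega> \<bullet> \<xi> i' \<omega>\<bar> \<le> D i * D i'" if "i \<in> A" "i' \<in> A" "\<omega> \<in> space M" for i i' \<omega>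
    using Cauchy_Schwarz_ineq2[of "\<xi> i \<omega>" "\<xi> i' \<omega>"] mult_mono[OF D[OF that(1,3)] D[OF that(2,3)]]
      order_trans[OF norm_ge_zero D[OF that(1,3)]] by fastforce
  have wb: "integrable P (\<lambda>\<omega>. w \<omega> * (l * (\<xi> i \<omega> \<bullet> \<xi> i' \<omega>)))" if "i \<in> A" "i' \<in> A" for i i' l
  proof (rule P.integrable_const_bound[of _ "C * (\<bar>l\<bar> * (D i * D i'))"])
    show "AE \<omega> in P. norm (w \<omega> * (l * (\<xi> i \<omega> \<bullet> \<xi> i' \<omega>))) \<le> C * (\<bar>l\<bar> * (D i * D i'))"
      using C bb[OF that] by (intro AE_I2) (auto simp: abs_mult intro!: mult_mono order_trans[OF abs_ge_zero C])
  qed (use that in measurable)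
  have "has_bochner_integral P (\<lambda>\<omega>. \<Sum>i\<in>A. \<Sum>i'\<in>A. w \<omega> * ((\<xi> i \<omega> \<bullet> (W (b i) \<omega> - W (a i) \<omega>)) * (\<xi> i' \<omega> \<bullet> (W (b i') \<omega> - W (a i') \<omega>))))
    (\<Sum>i\<in>A. \<Sum>i'\<in>A. P.expectation (\<lambda>\<omega>. w \<omega> * (?L i i' * (\<xi> i \<omega> \<bullet> \<xi> i' \<omega>))))"
    using ab by (intro has_bochner_integral_sum elementary_covariance[OF s _ _ _ _ w C \<xi> D \<xi> D]) auto
  also have "(\<Sum>i\<in>A. \<Sum>i'\<in>A. P.expectation (\<lambda>\<omega>. w \<omega> * (?L i i' * (\<xi> i \<omega> \<bullet> \<xi> i' \<omega>))))
     = P.expectation (\<lambda>\<omega>. \<Sum>i\<in>A. \<Sum>i'\<in>A. w \<omega> * (?L i i' * (\<xi> i \<omega> \<bullet> \<xi> i' \<omega>)))"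
    by (subst Bochner_Integration.integral_sum)
       (auto intro!: sum.cong Bochner_Integration.integral_sum[symmetric] Bochner_Integration.integrable_sum wb)
  also have "\<dots> = P.expectation (\<lambda>\<omega>. w \<omega> * (LINT r|lborel. (norm (Z \<omega> r))\<^sup>2))"
    by (simp add: has_bochner_integral_integral_eq[OF Zint] sum_distrib_left)
  finally show "has_bochner_integral P (\<lambda>\<omega>. w \<omega> * (S \<omega>)\<^sup>2)
           (P.expectation (\<lambda>\<omega>. w \<omega> * (LINT r|lborel. (norm (Z \<omega> r))\<^sup>2)))"
    unfolding S_def power2_eq_square[of "\<Sum>i\<in>A. \<xi> i _ \<bullet> (W (b i) _ - W (a i) _)"] sum_product unfolding sum_distrib_left .
  interpret PL: pair_sigma_finite P lborel ..
  have ZI: "integrable (P \<Otimes>\<^sub>M lborel) (\<lambda>(\<omega>, r). w \<omega> * (norm (Z \<omega> r))\<^sup>2)"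
  proof -
    have "integrable (P \<Otimes>\<^sub>M lborel) (\<lambda>(\<omega>, r). (w \<omega> * (1 * (\<xi> i \<omega> \<bullet> \<xi> i' \<omega>))) * indicator ({a i<..b i} \<inter> {a i'<..b i'}) r)"
      if "i \<in> A" "i' \<in> A" for i i'
      by (rule PL.integrable_pair_mult) (use fin in \<open>auto simp: ie less_top\<close>, auto intro!: wb[of i i' 1, simplified] that)
    then have "integrable (P \<Otimes>\<^sub>M lborel) (\<lambda>x. \<Sum>i\<in>A. \<Sum>i'\<in>A. case x of (\<omega>, r) \<Rightarrow> (w \<omega> * (1 * (\<xi> i \<omega> \<bullet> \<xi> i' \<omega>))) * indicator ({a i<..b i} \<inter> {a i'<..b i'}) r)"
      by (intro Bochner_Integration.integrable_sum)
    then show ?thesis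
      by (simp add: Zsq sum_distrib_left split_beta' ac_simps)
  qed
  moreover have "integral\<^sup>L (P \<Otimes>\<^sub>M lborel) (\<lambda>(\<omega>, r). w \<omega> * (norm (Z \<omega> r))\<^sup>2)
     = P.expectation (\<lambda>\<omega>. w \<omega> * (LINT r|lborel. (norm (Z \<omega> r))\<^sup>2))"
    by (subst PL.integral_fst'[symmetric, OF ZI]) simp
  ultimately show "has_bochner_integral (P \<Otimes>\<^sub>M lborel) (\<lambda>(\<omega>, r). w \<omega> * (norm (Z \<omega> r))\<^sup>2) 
           (P.expectation (\<lambda>\<omega>. w \<omega> * (LINT r|lborel. (norm (Z \<omega> r))\<^sup>2)))"
    by (simp add: has_bochner_integral_iff)
qed
end

subsection \<open>The Ito integral\<close>

text \<open>Young's inequality for the cross term. The parameter \<open>h\<close> stays free: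
  \<open>h = 1\<close> yields integrability, while \<open>h\<close> tending to 0 more slowly than
  the squared distance yields convergence.\<close>

lemma abs_diff_power2_le:
  fixes x y :: "'b::real_normed_vector"
  assumes "0 < h"
  shows "\<bar>(norm y)\<^sup>2 - (norm x)\<^sup>2\<bar> \<le> h * (norm x)\<^sup>2 + (1 + 1 / h) * (norm (x - y))\<^sup>2"
proof -
  let ?p = "norm y" and ?q = "norm x" and ?d = "norm (x - y)"
  have d: "\<bar>?p - ?q\<bar> \<le> ?d"
    by (metis norm_minus_commute norm_triangle_ineq3)
  have "\<bar>?p\<^sup>2 - ?q\<^sup>2\<bar> = \<bar>?p - ?q\<bar> * (?p + ?q)"
    by (simp add: power2_eq_square square_diff_square_factored abs_mult mult.commute)
  also have "\<dots> \<le> ?d * (2 * ?q + ?d)"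
    using d by (intro mult_mono) auto
  also have "\<dots> \<le> h * ?q\<^sup>2 + (1 + 1 / h) * ?d\<^sup>2"
  proof -
    have "0 \<le> (h * ?q - ?d)\<^sup>2 / h" using assms by simp
    also have "\<dots> = h * ?q\<^sup>2 + ?d\<^sup>2 / h - 2 * ?q * ?d"
      using assms by (simp add: power2_eq_square field_simps)
    finally show ?thesis by (simp add: algebra_simps power2_eq_square)
  qed
  finally show ?thesis .
qed

lemma norm_lebesgue_integral_le:
  fixes f :: "'a \<Rightarrow> 'b::{banach, second_countable_topology}"
  assumes "integrable N g" "\<And>x. x \<in> space N \<Longrightarrow> norm (f x) \<le> g x"
  shows "norm (integral\<^sup>L N f) \<le> integral\<^sup>L N g"
proof -
  have "norm (integral\<^sup>L N f) \<le> (LINT x|N. norm (f x))" by (rule integral_norm_bound)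
  also have "\<dots> \<le> integral\<^sup>L N g"
    by (rule integral_mono') (use assms order_trans[OF norm_ge_zero] in blast)+
  finally show ?thesis .
qed

text \<open>Convergence of the extended integrals to 0 permits infinite values for finitely many
  indices, hence integrability only eventually. After that they can be read as real integrals, where
  differences make sense.\<close>

lemma L2_limit_real:
  fixes f :: "'a \<Rightarrow> 'b::{real_normed_vector, second_countable_topology}" and fk :: "nat \<Rightarrow> 'a \<Rightarrow> 'b"
  assumes [measurable]: "f \<in> borel_measurable N" "\<And>k. fk k \<in> borel_measurable N"
    and lim: "(\<lambda>k. \<integral>\<^sup>+x. ennreal ((norm (f x - fk k x))\<^sup>2) \<partial>N) \<longlonglongrightarrow> 0"
  shows "\<forall>\<^sub>F k in sequentially. integrable N (\<lambda>x. (norm (f x - fk k x))\<^sup>2)"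
    and "(\<lambda>k. LINT x|N. (norm (f x - fk k x))\<^sup>2) \<longlonglongrightarrow> 0"
proof -
  have ev: "\<forall>\<^sub>F k in sequentially. (\<integral>\<^sup>+x. ennreal ((norm (f x - fk k x))\<^sup>2) \<partial>N) < 1"
    using order_tendstoD(2)[OF lim, of 1] by simp
  then show int: "\<forall>\<^sub>F k in sequentially. integrable N (\<lambda>x. (norm (f x - fk k x))\<^sup>2)"
    by eventually_elim (auto simp: integrable_iff_bounded intro: less_trans)
  have "\<forall>\<^sub>F k in sequentially. (\<integral>\<^sup>+x. ennreal ((norm (f x - fk k x))\<^sup>2) \<partial>N)
      = ennreal (LINT x|N. (norm (f x - fk k x))\<^sup>2)"
    using int by eventually_elim (simp add: nn_integral_eq_integral)
  then have "(\<lambda>k. ennreal (LINT x|N. (norm (f x - fk k x))\<^sup>2)) \<longlonglongrightarrow> ennreal 0"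
    using lim by (simp add: tendsto_cong)
  then show "(\<lambda>k. LINT x|N. (norm (f x - fk k x))\<^sup>2) \<longlonglongrightarrow> 0"
    by (rule tendsto_ennrealD) auto
qed

text \<open>With \<open>A\<close> the squared norm of the limit and \<open>e k\<close> the squared
  distance to it, the error is at most a constant times h A + e + e / h for any positive h. A
  suitable h, depending on k, sends all three terms to 0.\<close>

lemma L2_limit_square:
  fixes f :: "'a \<Rightarrow> 'b::{real_normed_vector, second_countable_topology}" and fk :: "nat \<Rightarrow> 'a \<Rightarrow> 'b"
  assumes [measurable]: "f \<in> borel_measurable N" "\<And>k. fk k \<in> borel_measurable N"
    and lim: "(\<lambda>k. \<integral>\<^sup>+x. ennreal ((norm (f x - fk k x))\<^sup>2) \<partial>N) \<longlonglongrightarrow> 0"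
    and fk: "\<And>k. integrable N (\<lambda>x. (norm (fk k x))\<^sup>2)"
    and w[measurable]: "w \<in> borel_measurable N" and C: "\<And>x. x \<in> space N \<Longrightarrow> \<bar>w x\<bar> \<le> C"
  shows "integrable N (\<lambda>x. (norm (f x))\<^sup>2)"
    and "integrable N (\<lambda>x. w x * (norm (f x))\<^sup>2)"
    and "(\<lambda>k. LINT x|N. w x * (norm (fk k x))\<^sup>2) \<longlonglongrightarrow> (LINT x|N. w x * (norm (f x))\<^sup>2)"
proof -
  note L = L2_limit_real[OF assms(1-3)]
  define e where "e k = (LINT x|N. (norm (f x - fk k x))\<^sup>2)" for k
  have e0: "0 \<le> e k" for k unfolding e_def by simp
  have elim: "e \<longlonglongrightarrow> 0" using L(2) by (simp add: e_def[abs_def])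
  obtain k0 where k0: "integrable N (\<lambda>x. (norm (f x - fk k0 x))\<^sup>2)"
    using L(1) by (auto simp: eventually_sequentially)
  show fi: "integrable N (\<lambda>x. (norm (f x))\<^sup>2)"
  proof (rule Bochner_Integration.integrable_bound)
    show "integrable N (\<lambda>x. (1 + 1) * (norm (fk k0 x))\<^sup>2 + (1 + 1 / 1) * (norm (f x - fk k0 x))\<^sup>2)"
      using fk k0 by simp
    show "AE x in N. norm ((norm (f x))\<^sup>2) \<le> norm ((1 + 1) * (norm (fk k0 x))\<^sup>2 + (1 + 1 / 1) * (norm (f x - fk k0 x))\<^sup>2)"
      proof (rule AE_I2)
      fix x
      show "norm ((norm (f x))\<^sup>2) \<le> norm ((1 + 1) * (norm (fk k0 x))\<^sup>2 + (1 + 1 / 1) * (norm (f x - fk k0 x))\<^sup>2)"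
        using abs_diff_power2_le[of 1 "f x" "fk k0 x"] by (simp add: norm_minus_commute[of "fk k0 x"])
    qed
  qed simp
  have wbound: "integrable N (\<lambda>x. w x * g x)" if "integrable N g" for g
  proof (rule Bochner_Integration.integrable_bound[OF integrable_mult_right[OF that, of C]])
    show "AE x in N. norm (w x * g x) \<le> norm (C * g x)"
    proof (rule AE_I2)
      fix x assume "x \<in> space N"
      then have "\<bar>w x\<bar> \<le> \<bar>C\<bar>" using C[of x] by simp
      then show "norm (w x * g x) \<le> norm (C * g x)"
        by (simp add: abs_mult mult_right_mono)
    qed
  qed (use that in measurable)
  show "integrable N (\<lambda>x. w x * (norm (f x))\<^sup>2)"
    by (rule wbound[OF fi])
  define A where "A = (LINT x|N. (norm (f x))\<^sup>2)"
  \<comment> \<open>The root makes \<open>e k / h k\<close> at most \<open>sqrt (e k)\<close>; the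
    second summand keeps \<open>h k\<close> positive when \<open>e k\<close> is 0.\<close>
  define h where "h k = sqrt (e k) + 1 / real (Suc k)" for k
  have h0: "0 < h k" for k using e0[of k] by (simp add: h_def add_nonneg_pos)
  have hlim: "h \<longlonglongrightarrow> 0"
    using tendsto_add[OF tendsto_real_sqrt[OF elim] LIMSEQ_Suc[OF lim_inverse_n']]
    by (simp add: h_def[abs_def])
  have eh: "e k / h k \<le> sqrt (e k)" for k
  proof -
    have "sqrt (e k) * sqrt (e k) \<le> sqrt (e k) * h k"
      using e0[of k] by (intro mult_left_mono) (auto simp: h_def)
    then show ?thesis using h0[of k] e0[of k] by (simp add: divide_le_eq)
  qed
  have "(\<lambda>k. (LINT x|N. w x * (norm (fk k x))\<^sup>2) - (LINT x|N. w x * (norm (f x))\<^sup>2)) \<longlonglongrightarrow> 0"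
  proof (rule Lim_null_comparison)
    show "(\<lambda>k. \<bar>C\<bar> * (h k * A + (e k + sqrt (e k)))) \<longlonglongrightarrow> 0"
      using tendsto_mult_left[OF tendsto_add[OF tendsto_mult_right[OF hlim, of A]
         tendsto_add[OF elim tendsto_real_sqrt[OF elim]]], of "\<bar>C\<bar>"] by simp
    show "\<forall>\<^sub>F k in sequentially. norm ((LINT x|N. w x * (norm (fk k x))\<^sup>2) - (LINT x|N. w x * (norm (f x))\<^sup>2))
       \<le> \<bar>C\<bar> * (h k * A + (e k + sqrt (e k)))"
      using L(1)
    proof eventually_elim
      case (elim k)
      have "norm ((LINT x|N. w x * (norm (fk k x))\<^sup>2) - (LINT x|N. w x * (norm (f x))\<^sup>2))
        = norm (LINT x|N. w x * ((norm (fk k x))\<^sup>2 - (norm (f x))\<^sup>2))"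
        by (subst Bochner_Integration.integral_diff[symmetric]) (auto intro!: wbound fk fi simp: right_diff_distrib)
      also have "\<dots> \<le> (LINT x|N. \<bar>C\<bar> * (h k * (norm (f x))\<^sup>2 + (1 + 1 / h k) * (norm (f x - fk k x))\<^sup>2))"
      proof (rule norm_lebesgue_integral_le)
        fix x assume x: "x \<in> space N"
        show "norm (w x * ((norm (fk k x))\<^sup>2 - (norm (f x))\<^sup>2))
          \<le> \<bar>C\<bar> * (h k * (norm (f x))\<^sup>2 + (1 + 1 / h k) * (norm (f x - fk k x))\<^sup>2)"
          unfolding real_norm_def abs_mult
          using C[OF x] abs_diff_power2_le[OF h0, of "fk k x" "f x" k] by (intro mult_mono) auto
      qed (auto intro!: wbound fk fi elim)
      also have "\<dots> = \<bar>C\<bar> * (h k * A + (e k + e k / h k))"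
        using elim fi by (simp add: A_def e_def algebra_simps)
      also have "\<dots> \<le> \<bar>C\<bar> * (h k * A + (e k + sqrt (e k)))"
        using eh[of k] by (intro mult_left_mono) auto
      finally show ?case .
    qed
  qed
  then show "(\<lambda>k. LINT x|N. w x * (norm (fk k x))\<^sup>2) \<longlonglongrightarrow> (LINT x|N. w x * (norm (f x))\<^sup>2)"
    by (rule LIM_zero_cancel)
qed

lemma (in finite_measure) integrable_of_square:
  fixes f :: "'a \<Rightarrow> real"
  assumes [measurable]: "f \<in> borel_measurable M" and "integrable M (\<lambda>x. (f x)\<^sup>2)"
  shows "integrable M f"
proof (rule Bochner_Integration.integrable_bound)
  show "integrable M (\<lambda>x. 1 + (f x)\<^sup>2)" using assms by simp
  have "\<bar>y\<bar> \<le> 1 + y\<^sup>2" for y :: real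
    using sum_squares_bound[of 1 "\<bar>y\<bar>"] by (simp add: power2_eq_square) 
  then show "AE x in M. norm (f x) \<le> norm (1 + (f x)\<^sup>2)"
    by (intro AE_I2) (simp add: order_trans[OF _ abs_ge_self])
qed simp

text \<open>The bound |y| <= h + y^2 / h takes the place of the Cauchy-Schwarz inequality: on a
  finite measure the constant h integrates to h times the total mass, and the choice of h made for
  squares works again.\<close>

lemma (in finite_measure) L2_limit_linear:
  fixes f :: "'a \<Rightarrow> real" and fk :: "nat \<Rightarrow> 'a \<Rightarrow> real"
  assumes [measurable]: "f \<in> borel_measurable M" "\<And>k. fk k \<in> borel_measurable M"
    and lim: "(\<lambda>k. \<integral>\<^sup>+x. ennreal ((norm (f x - fk k x))\<^sup>2) \<partial>M) \<longlonglongrightarrow> 0"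
    and fk: "\<And>k. integrable M (\<lambda>x. (fk k x)\<^sup>2)"
    and w[measurable]: "w \<in> borel_measurable M" and C: "\<And>x. x \<in> space M \<Longrightarrow> \<bar>w x\<bar> \<le> C"
  shows "integrable M (\<lambda>x. w x * f x)"
    and "(\<lambda>k. LINT x|M. w x * fk k x) \<longlonglongrightarrow> (LINT x|M. w x * f x)"
proof -
  have fi: "integrable M f"
    using integrable_of_square[of f] L2_limit_square(1)[OF assms(1-3) _ w C] fk by simp
  have fki: "integrable M (fk k)" for k
    using integrable_of_square[of "fk k"] fk by simp
  note L = L2_limit_real[OF assms(1-3)]
  define e where "e k = (LINT x|M. (norm (f x - fk k x))\<^sup>2)" for k
  have e0: "0 \<le> e k" for k unfolding e_def by simp
  have elim: "e \<longlonglongrightarrow> 0" using L(2) by (simp add: e_def[abs_def])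
  have wbound: "integrable M (\<lambda>x. w x * g x)" if "integrable M g" for g
  proof (rule Bochner_Integration.integrable_bound[OF integrable_mult_right[OF that, of C]])
    show "AE x in M. norm (w x * g x) \<le> norm (C * g x)"
    proof (rule AE_I2)
      fix x assume "x \<in> space M"
      then have "\<bar>w x\<bar> \<le> \<bar>C\<bar>" using C[of x] by simp
      then show "norm (w x * g x) \<le> norm (C * g x)"
        by (simp add: abs_mult mult_right_mono)
    qed
  qed (use that in measurable)
  show "integrable M (\<lambda>x. w x * f x)"
    by (rule wbound[OF fi])
  define h where "h k = sqrt (e k) + 1 / real (Suc k)" for k
  have h0: "0 < h k" for k using e0[of k] by (simp add: h_def add_nonneg_pos)
  have hlim: "h \<longlonglongrightarrow> 0"
    using tendsto_add[OF tendsto_real_sqrt[OF elim] LIMSEQ_Suc[OF lim_inverse_n']]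
    by (simp add: h_def[abs_def])
  have eh: "e k / h k \<le> sqrt (e k)" for k
  proof -
    have "sqrt (e k) * sqrt (e k) \<le> sqrt (e k) * h k"
      using e0[of k] by (intro mult_left_mono) (auto simp: h_def)
    then show ?thesis using h0[of k] e0[of k] by (simp add: divide_le_eq)
  qed
  have abs_le: "\<bar>y\<bar> \<le> h k + y\<^sup>2 / h k" for y k
  proof -
    have "0 \<le> (h k - \<bar>y\<bar>)\<^sup>2 / h k" using h0[of k] by simp
    also have "\<dots> = h k + y\<^sup>2 / h k - 2 * \<bar>y\<bar>"
      using h0[of k] by (simp add: power2_eq_square field_simps)
    finally show ?thesis by simp
  qed
  have "(\<lambda>k. (LINT x|M. w x * fk k x) - (LINT x|M. w x * f x)) \<longlonglongrightarrow> 0"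
  proof (rule Lim_null_comparison)
    show "(\<lambda>k. \<bar>C\<bar> * (h k * measure M (space M) + sqrt (e k))) \<longlonglongrightarrow> 0"
      using tendsto_mult_left[OF tendsto_add[OF tendsto_mult_right[OF hlim, of "measure M (space M)"]
         tendsto_real_sqrt[OF elim]], of "\<bar>C\<bar>"] by simp
    show "\<forall>\<^sub>F k in sequentially. norm ((LINT x|M. w x * fk k x) - (LINT x|M. w x * f x))
       \<le> \<bar>C\<bar> * (h k * measure M (space M) + sqrt (e k))"
      using L(1)
    proof eventually_elim
      case (elim k)
      have "norm ((LINT x|M. w x * fk k x) - (LINT x|M. w x * f x))
        = norm (LINT x|M. w x * (fk k x - f x))"
        by (subst Bochner_Integration.integral_diff[symmetric]) (auto intro!: wbound fki fi simp: right_diff_distrib)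
      also have "\<dots> \<le> (LINT x|M. \<bar>C\<bar> * (h k + (norm (f x - fk k x))\<^sup>2 / h k))"
      proof (rule norm_lebesgue_integral_le)
        fix x assume x: "x \<in> space M"
        show "norm (w x * (fk k x - f x)) \<le> \<bar>C\<bar> * (h k + (norm (f x - fk k x))\<^sup>2 / h k)"
          unfolding real_norm_def abs_mult
          using C[OF x] abs_le[of "f x - fk k x" k] h0[of k]
          by (intro mult_mono) (auto simp: abs_minus_commute)
      qed (use elim in \<open>auto intro!: wbound fki fi\<close>)
      also have "\<dots> = \<bar>C\<bar> * (h k * measure M (space M) + e k / h k)"
        using elim by (simp add: e_def algebra_simps)
      also have "\<dots> \<le> \<bar>C\<bar> * (h k * measure M (space M) + sqrt (e k))"
        using eh[of k] by (intro mult_left_mono) auto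
      finally show ?case .
    qed
  qed
  then show "(\<lambda>k. LINT x|M. w x * fk k x) \<longlonglongrightarrow> (LINT x|M. w x * f x)"
    by (rule LIM_zero_cancel)
qed

section \<open>Martingale property and conditional isometry by passage to the limit\<close>

context brownian begin

text \<open>Clipping the grid points to the interval from \<open>s\<close> to \<open>t\<close> turns
  an increment of the simple integral into a sum of elementary integrals after time
  \<open>s\<close>. Indices with \<open>\<tau> i \<ge> t\<close> are dropped: their
  \<open>\<xi> i\<close> is known only at \<open>\<tau> i\<close>, possibly later than the clipped
  point \<open>a i\<close>, whereas their clipped interval is empty. For the remaining ones
  \<open>\<tau> i \<le> a i\<close>.\<close>

lemma simple_clip:
  assumes d: "simple_data M W N \<tau> \<xi>" and st: "0 \<le> s" "s \<le> t"
  defines "A \<equiv> {i. i < N \<and> \<tau> i < t}" and "a \<equiv> \<lambda>i. max s (min (\<tau> i) t)" 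
    and "b \<equiv> \<lambda>i. max s (min (\<tau> (Suc i)) t)"
  shows "simple_integral W N \<tau> \<xi> t \<omega> - simple_integral W N \<tau> \<xi> s \<omega>
          = (\<Sum>i\<in>A. \<xi> i \<omega> \<bullet> (W (b i) \<omega> - W (a i) \<omega>))"
    and "indicator {s<..t} r *\<^sub>R simple_process N \<tau> \<xi> r \<omega> = (\<Sum>i\<in>A. indicator {a i<..b i} r *\<^sub>R \<xi> i \<omega>)"
    and "i \<in> A \<Longrightarrow> s \<le> a i \<and> a i \<le> b i" 
    and "i \<in> A \<Longrightarrow> \<xi> i \<in> borel_measurable (F (a i))"
    and "i \<in> A \<Longrightarrow> bounded (\<xi> i ` space M)"
    and "finite A"
    and "\<And>i. i < N \<Longrightarrow> 0 \<le> \<tau> i"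
proof -
  have mono: "\<tau> i \<le> \<tau> (Suc i)" if "i < N" for i 
    using d that by (simp add: simple_data_def)
  show "finite A" by (simp add: A_def)
  show "0 \<le> \<tau> i" if "i < N" for i
    using that
  proof (induction i)
    case 0
    then show ?case using d by (simp add: simple_data_def)
  next
    case (Suc i)
    then show ?case using mono[of i] by simp
  qed
  show "i \<in> A \<Longrightarrow> s \<le> a i \<and> a i \<le> b i"
    using mono[of i] by (auto simp: A_def a_def b_def)
  show "i \<in> A \<Longrightarrow> bounded (\<xi> i ` space M)"
    using d by (auto simp: A_def simple_data_def)
  assume i: "i \<in> A"
  show "\<xi> i \<in> borel_measurable (F (a i))"
    by (rule measurable_F_mono[of "\<tau> i"]) (use i d in \<open>auto simp: A_def a_def simple_data_def\<close>)
next
  have mono: "\<tau> i \<le> \<tau> (Suc i)" if "i < N" for i 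
    using d that by (simp add: simple_data_def)
  have eq: "b i = a i" if "i < N" "i \<notin> A" for i
    using that mono[of i] st by (simp add: A_def a_def b_def min_def max_def)
  have W: "W (min q t) \<omega> - W (min p t) \<omega> - (W (min q s) \<omega> - W (min p s) \<omega>)
     = W (max s (min q t)) \<omega> - W (max s (min p t)) \<omega>" if "p \<le> q" for p q
    using that st by (auto simp: min_def max_def)
  have "simple_integral W N \<tau> \<xi> t \<omega> - simple_integral W N \<tau> \<xi> s \<omega>
     = (\<Sum>i<N. \<xi> i \<omega> \<bullet> (W (b i) \<omega> - W (a i) \<omega>))"
    unfolding simple_integral_def sum_subtractf[symmetric] inner_diff_right[symmetric]
    by (intro sum.cong refl) (simp add: W mono a_def b_def)
  also have "\<dots> = (\<Sum>i\<in>A. \<xi> i \<omega> \<bullet> (W (b i) \<omega> - W (a i) \<omega>))"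
    by (intro sum.mono_neutral_right) (auto simp: eq, auto simp: A_def)
  finally show "simple_integral W N \<tau> \<xi> t \<omega> - simple_integral W N \<tau> \<xi> s \<omega>
          = (\<Sum>i\<in>A. \<xi> i \<omega> \<bullet> (W (b i) \<omega> - W (a i) \<omega>))" .
  have "indicator {s<..t} r *\<^sub>R simple_process N \<tau> \<xi> r \<omega> = (\<Sum>i<N. indicator {a i<..b i} r *\<^sub>R \<xi> i \<omega>)"
    unfolding simple_process_def scaleR_sum_right
    using st mono by (intro sum.cong refl) (auto simp: indicator_def a_def b_def)
  also have "\<dots> = (\<Sum>i\<in>A. indicator {a i<..b i} r *\<^sub>R \<xi> i \<omega>)"
    by (intro sum.mono_neutral_right) (auto simp: eq, auto simp: A_def)
  finally show "indicator {s<..t} r *\<^sub>R simple_process N \<tau> \<xi> r \<omega> = (\<Sum>i\<in>A. indicator {a i<..b i} r *\<^sub>R \<xi> i \<omega>)" .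
qed

lemma measurable_F_id: "(\<lambda>x. x) \<in> P \<rightarrow>\<^sub>M F t"
  using sets_F_subset sets.sets_into_space by (intro measurableI) (auto simp: Int_absorb2)

text \<open>Progressive measurability speaks only about times in \<open>{0..t}\<close>. Clamping the
  time variable into that interval gives a jointly measurable function on the whole line, and the
  indicator of \<open>B\<close> erases the part where clamping changed something.\<close>

lemma prog_measurable_joint:
  fixes Z :: "real \<Rightarrow> 'a \<Rightarrow> 'b::{real_normed_vector, second_countable_topology}"
  assumes "prog_measurable F Z" and B: "B \<in> sets borel" "B \<subseteq> {0..t}"
  shows "(\<lambda>(\<omega>, r). indicator B r *\<^sub>R Z r \<omega>) \<in> borel_measurable (P \<Otimes>\<^sub>M lborel)"
proof (cases "0 \<le> t")
  case True
  let ?c = "\<lambda>r. min t (max 0 r)"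
  have Z: "(\<lambda>(s, \<omega>). Z s \<omega>) \<in> borel_measurable (restrict_space borel {0..t} \<Otimes>\<^sub>M F t)"
    using assms True by (simp add: prog_measurable_def)
  have "?c \<in> lborel \<rightarrow>\<^sub>M restrict_space borel {0..t}"
    by (rule measurable_restrict_space2) (use True in auto)
  then have c: "(\<lambda>x. (?c (snd x), fst x)) \<in> P \<Otimes>\<^sub>M lborel \<rightarrow>\<^sub>M restrict_space borel {0..t} \<Otimes>\<^sub>M F t"
    by (intro measurable_Pair measurable_compose[OF measurable_snd] measurable_compose[OF measurable_fst] measurable_F_id)
  have "(\<lambda>x. Z (?c (snd x)) (fst x)) \<in> borel_measurable (P \<Otimes>\<^sub>M lborel)"
    using measurable_compose[OF c Z] by simp
  moreover have "(\<lambda>x. indicator B (snd x) :: real) \<in> borel_measurable (P \<Otimes>\<^sub>M lborel)"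
    using B by measurable
  ultimately have "(\<lambda>x. indicator B (snd x) *\<^sub>R Z (?c (snd x)) (fst x)) \<in> borel_measurable (P \<Otimes>\<^sub>M lborel)"
    by (intro borel_measurable_scaleR)
  moreover have "(\<lambda>x. indicator B (snd x) *\<^sub>R Z (?c (snd x)) (fst x)) = (\<lambda>(\<omega>, r). indicator B r *\<^sub>R Z r \<omega>)"
    using B by (auto simp: indicator_def fun_eq_iff min_def max_def)
  ultimately show ?thesis by simp
qed (use B in auto)

lemma simple_process_joint:
  assumes "simple_data M W N \<tau> \<xi>"
  shows "(\<lambda>(\<omega>, r). simple_process N \<tau> \<xi> r \<omega>) \<in> borel_measurable (P \<Otimes>\<^sub>M lborel)"
proof -
  have [measurable]: "\<xi> i \<in> borel_measurable P" if "i \<in> {..<N}" for i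
    using assms that by (auto simp: simple_data_def intro: measurable_F_P)
  show ?thesis unfolding simple_process_def split_beta' by measurable
qed

lemma simple_integral_measurable:
  assumes d: "simple_data M W N \<tau> \<xi>" and "0 \<le> t"
  shows "simple_integral W N \<tau> \<xi> t \<in> borel_measurable P"
proof -
  have [measurable]: "\<xi> i \<in> borel_measurable P" if "i \<in> {..<N}" for i
    using d that by (auto simp: simple_data_def intro: measurable_F_P)
  have 0: "0 \<le> \<tau> i" if "i < N" for i
    using simple_clip(7)[OF d order_refl order_refl that] .
  have "W (min (\<tau> i) t) \<in> borel_measurable P" "W (min (\<tau> (Suc i)) t) \<in> borel_measurable P" if "i \<in> {..<N}" for i
  proof -
    have "0 \<le> \<tau> i" "0 \<le> \<tau> (Suc i)"
      using 0[of i] d that order_trans[of 0 "\<tau> i" "\<tau> (Suc i)"] by (simp_all add: simple_data_def)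
    then show "W (min (\<tau> i) t) \<in> borel_measurable P" "W (min (\<tau> (Suc i)) t) \<in> borel_measurable P"
      using assms(2) by (auto intro!: measurable_completion W_measurable_M)
  qed
  note [measurable] = this
  show ?thesis unfolding simple_integral_def[abs_def] by measurable
qed

lemma has_ito_integralE:
  assumes "has_ito_integral M W Z I"
  obtains N \<tau> \<xi> where "\<And>k. simple_data M W (N k) (\<tau> k) (\<xi> k)"
    and "\<And>T. 0 \<le> T \<Longrightarrow> (\<lambda>k::nat. \<integral>\<^sup>+\<omega>. (\<integral>\<^sup>+s\<in>{0..T}.
              ennreal ((norm (Z s \<omega> - simple_process (N k) (\<tau> k) (\<xi> k) s \<omega>))\<^sup>2) \<partial>lborel) \<partial>P) \<longlonglongrightarrow> 0"
    and "\<And>T. 0 \<le> T \<Longrightarrow> (\<lambda>k::nat. \<integral>\<^sup>+\<omega>.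
              ennreal ((I T \<omega> - simple_integral W (N k) (\<tau> k) (\<xi> k) T \<omega>)\<^sup>2) \<partial>P) \<longlonglongrightarrow> 0"
proof -
  from assms obtain N \<tau> \<xi> where a: "\<forall>k. simple_data M W (N k) (\<tau> k) (\<xi> k)"
    and b: "\<forall>T\<ge>0. (\<lambda>k::nat. \<integral>\<^sup>+\<omega>. (\<integral>\<^sup>+s\<in>{0..T}.
              ennreal ((norm (Z s \<omega> - simple_process (N k) (\<tau> k) (\<xi> k) s \<omega>))\<^sup>2) \<partial>lborel) \<partial>P) \<longlonglongrightarrow> 0 \<and>
          (\<lambda>k::nat. \<integral>\<^sup>+\<omega>.
              ennreal ((I T \<omega> - simple_integral W (N k) (\<tau> k) (\<xi> k) T \<omega>)\<^sup>2) \<partial>P) \<longlonglongrightarrow> 0"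
    unfolding has_ito_integral_def by (elim conjE exE)
  show ?thesis
    by (rule that[of N \<tau> \<xi>, OF a[rule_format] b[rule_format, THEN conjunct1] b[rule_format, THEN conjunct2]])
qed

text \<open>Vanishing of E[w V] for all bounded \<open>w\<close> known at \<open>s\<close> is the
  martingale property, and the last claim is the conditional Ito isometry. Both hold exactly for
  simple integrals and persist in the limit. Stating them for a difference avoids proving linearity
  of the Ito integral separately.\<close>

lemma ito_difference_moments:
  assumes I: "has_ito_integral M W Z I" and I': "has_ito_integral M W Z' I'"
    and st: "0 \<le> s" "s \<le> t" 
    and w: "w \<in> borel_measurable (F s)" and C: "\<And>\<omega>. \<omega> \<in> space M \<Longrightarrow> \<bar>w \<omega>\<bar> \<le> C"
  defines "V \<equiv> \<lambda>\<omega>. (I t \<omega> - I s \<omega>) - (I' t \<omega> - I' s \<omega>)"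
    and "U \<equiv> \<lambda>\<omega> r. indicator {s<..t} r *\<^sub>R (Z r \<omega> - Z' r \<omega>)"
  shows "V \<in> borel_measurable P" "integrable P (\<lambda>\<omega>. (V \<omega>)\<^sup>2)"
    and "has_bochner_integral P (\<lambda>\<omega>. w \<omega> * V \<omega>) 0"
    and "integrable P (\<lambda>\<omega>. w \<omega> * (V \<omega>)\<^sup>2)"
    and "has_bochner_integral (P \<Otimes>\<^sub>M lborel) (\<lambda>(\<omega>, r). w \<omega> * (norm (U \<omega> r))\<^sup>2) 
           (P.expectation (\<lambda>\<omega>. w \<omega> * (V \<omega>)\<^sup>2))"
proof -
  interpret PL: pair_sigma_finite P lborel ..
  have t0: "0 \<le> t" using st by simp
  obtain N \<tau> \<xi> where sd: "\<And>k. simple_data M W (N k) (\<tau> k) (\<xi> k)"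
    and limZ: "\<And>T. 0 \<le> T \<Longrightarrow> (\<lambda>k::nat. \<integral>\<^sup>+\<omega>. (\<integral>\<^sup>+s\<in>{0..T}.
              ennreal ((norm (Z s \<omega> - simple_process (N k) (\<tau> k) (\<xi> k) s \<omega>))\<^sup>2) \<partial>lborel) \<partial>P) \<longlonglongrightarrow> 0"
    and limI: "\<And>T. 0 \<le> T \<Longrightarrow> (\<lambda>k::nat. \<integral>\<^sup>+\<omega>.
              ennreal ((I T \<omega> - simple_integral W (N k) (\<tau> k) (\<xi> k) T \<omega>)\<^sup>2) \<partial>P) \<longlonglongrightarrow> 0"
    by (rule has_ito_integralE[OF I]) (rule that)
  obtain N' \<tau>' \<xi>' where sd': "\<And>k. simple_data M W (N' k) (\<tau>' k) (\<xi>' k)"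
    and limZ': "\<And>T. 0 \<le> T \<Longrightarrow> (\<lambda>k::nat. \<integral>\<^sup>+\<omega>. (\<integral>\<^sup>+s\<in>{0..T}.
              ennreal ((norm (Z' s \<omega> - simple_process (N' k) (\<tau>' k) (\<xi>' k) s \<omega>))\<^sup>2) \<partial>lborel) \<partial>P) \<longlonglongrightarrow> 0"
    and limI': "\<And>T. 0 \<le> T \<Longrightarrow> (\<lambda>k::nat. \<integral>\<^sup>+\<omega>.
              ennreal ((I' T \<omega> - simple_integral W (N' k) (\<tau>' k) (\<xi>' k) T \<omega>)\<^sup>2) \<partial>P) \<longlonglongrightarrow> 0"
    by (rule has_ito_integralE[OF I']) (rule that)
  define S where "S k = simple_integral W (N k) (\<tau> k) (\<xi> k)" for k
  define S' where "S' k = simple_integral W (N' k) (\<tau>' k) (\<xi>' k)" for k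
  define E where "E k = simple_process (N k) (\<tau> k) (\<xi> k)" for k
  define E' where "E' k = simple_process (N' k) (\<tau>' k) (\<xi>' k)" for k
  define Vk where "Vk k \<omega> = (S k t \<omega> - S k s \<omega>) - (S' k t \<omega> - S' k s \<omega>)" for k \<omega>
  define Uk where "Uk k \<omega> r = indicator {s<..t} r *\<^sub>R (E k r \<omega> - E' k r \<omega>)" for k \<omega> r
  \<comment> \<open>The two approximating sequences live on different grids, so their difference is treated as
    one finite sum of elementary integrals indexed by a disjoint union.\<close>
  define A where "A k = {i. i < N k \<and> \<tau> k i < t} <+> {i. i < N' k \<and> \<tau>' k i < t}" for k
  define a where "a k = case_sum (\<lambda>i. max s (min (\<tau> k i) t)) (\<lambda>i. max s (min (\<tau>' k i) t))" for k
  define b where "b k = case_sum (\<lambda>i. max s (min (\<tau> k (Suc i)) t)) (\<lambda>i. max s (min (\<tau>' k (Suc i)) t))" for k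
  define \<zeta> where "\<zeta> k = case_sum (\<xi> k) (\<lambda>i \<omega>. - \<xi>' k i \<omega>)" for k
  note c = simple_clip[OF sd st] and c' = simple_clip[OF sd' st]
  have finA: "finite (A k)" for k using c(6)[of k] c'(6)[of k] by (simp add: A_def)
  have Vk: "Vk k \<omega> = (\<Sum>i\<in>A k. \<zeta> k i \<omega> \<bullet> (W (b k i) \<omega> - W (a k i) \<omega>))" for k \<omega>
    using c(6)[of k] c'(6)[of k]
    by (simp add: Vk_def S_def S'_def A_def sum.Plus c(1) c'(1) a_def b_def \<zeta>_def sum_negf)
  have Uk: "Uk k \<omega> r = (\<Sum>i\<in>A k. indicator {a k i<..b k i} r *\<^sub>R \<zeta> k i \<omega>)" for k \<omega> r
    using c(6)[of k] c'(6)[of k]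
    by (simp only: Uk_def E_def E'_def A_def sum.Plus scaleR_add_right c(2) c'(2) a_def b_def \<zeta>_def
        sum.case o_def scaleR_minus_right sum_negf diff_conv_add_uminus)
  have ab: "s \<le> a k i \<and> a k i \<le> b k i" if "i \<in> A k" for k i
    using that simple_clip(3)[OF sd[of k] st] simple_clip(3)[OF sd'[of k] st] by (auto simp: A_def a_def b_def)
  have \<zeta>m: "\<zeta> k i \<in> borel_measurable (F (a k i))" if "i \<in> A k" for k i
    using that simple_clip(4)[OF sd[of k] st] simple_clip(4)[OF sd'[of k] st] by (auto simp: A_def a_def \<zeta>_def)
  have \<zeta>b: "bounded (\<zeta> k i ` space M)" if "i \<in> A k" for k i
    using that simple_clip(5)[OF sd[of k] st] simple_clip(5)[OF sd'[of k] st]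
    by (auto simp: A_def \<zeta>_def bounded_iff)
  have el: "Vk k \<in> borel_measurable P"
    "has_bochner_integral P (\<lambda>\<omega>. v \<omega> * Vk k \<omega>) 0"
    "has_bochner_integral P (\<lambda>\<omega>. v \<omega> * (Vk k \<omega>)\<^sup>2)
           (P.expectation (\<lambda>\<omega>. v \<omega> * (LINT r|lborel. (norm (Uk k \<omega> r))\<^sup>2)))"
    "has_bochner_integral (P \<Otimes>\<^sub>M lborel) (\<lambda>(\<omega>, r). v \<omega> * (norm (Uk k \<omega> r))\<^sup>2) 
           (P.expectation (\<lambda>\<omega>. v \<omega> * (LINT r|lborel. (norm (Uk k \<omega> r))\<^sup>2)))"
    if v: "v \<in> borel_measurable (F s)" and D: "\<And>\<omega>. \<omega> \<in> space M \<Longrightarrow> \<bar>v \<omega>\<bar> \<le> D" for v D k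
    unfolding Vk Uk
    by (rule elementary_sum_moments[OF st(1) finA _ v D]; use ab \<zeta>m \<zeta>b in blast)+
  \<comment> \<open>The weight 1 supplies the unweighted square integrability that the limit lemmas
    require.\<close>
  have one: "(\<lambda>_. 1) \<in> borel_measurable (F s)" "\<And>\<omega>. \<omega> \<in> space M \<Longrightarrow> \<bar>1\<bar> \<le> (1::real)" by auto
  have el1: "integrable P (\<lambda>\<omega>. (Vk k \<omega>)\<^sup>2)" "integrable (P \<Otimes>\<^sub>M lborel) (\<lambda>x. (norm (case_prod (Uk k) x))\<^sup>2)" for k
    using el(3)[of _ _ k, OF one] el(4)[of _ _ k, OF one] by (simp_all add: has_bochner_integral_iff split_beta')
  have [measurable]: "w \<in> borel_measurable P" by (rule measurable_F_P[OF w])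
  have Vkm[measurable]: "Vk k \<in> borel_measurable P" for k
    using el(1)[OF one] .
  have Em[measurable]: "(\<lambda>(\<omega>, r). E k r \<omega>) \<in> borel_measurable (P \<Otimes>\<^sub>M lborel)"
    "(\<lambda>(\<omega>, r). E' k r \<omega>) \<in> borel_measurable (P \<Otimes>\<^sub>M lborel)" for k
    using simple_process_joint[OF sd] simple_process_joint[OF sd'] by (simp_all add: E_def E'_def)
  have Im: "I u \<in> borel_measurable P" "I' u \<in> borel_measurable P" if "0 \<le> u" for u
    using I I' that by (auto simp: has_ito_integral_def adapted_def intro: measurable_F_P)
  note [measurable] = Im[OF st(1)] Im[OF t0]
  show Vm[measurable]: "V \<in> borel_measurable P" unfolding V_def by measurable
  have Sm: "S k u \<in> borel_measurable P" "S' k u \<in> borel_measurable P" if "0 \<le> u" for k u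
    using simple_integral_measurable[OF sd that] simple_integral_measurable[OF sd' that] by (simp_all add: S_def S'_def)
  note [measurable] = Sm[OF st(1)] Sm[OF t0]
  have pm: "prog_measurable F Z" "prog_measurable F Z'"
    using I I' by (auto simp: has_ito_integral_def M2_def)
  have Z1: "(\<lambda>(\<omega>, r). indicator {s<..t} r *\<^sub>R Z r \<omega>) \<in> borel_measurable (P \<Otimes>\<^sub>M lborel)"
    "(\<lambda>(\<omega>, r). indicator {s<..t} r *\<^sub>R Z' r \<omega>) \<in> borel_measurable (P \<Otimes>\<^sub>M lborel)"
    "(\<lambda>(\<omega>, r). indicator {0..t} r *\<^sub>R Z r \<omega>) \<in> borel_measurable (P \<Otimes>\<^sub>M lborel)"
    "(\<lambda>(\<omega>, r). indicator {0..t} r *\<^sub>R Z' r \<omega>) \<in> borel_measurable (P \<Otimes>\<^sub>M lborel)"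
    by (intro prog_measurable_joint pm; use st in auto)+
  have Um[measurable]: "case_prod U \<in> borel_measurable (P \<Otimes>\<^sub>M lborel)"
    using borel_measurable_diff[OF Z1(1,2)] by (simp add: U_def split_beta' scaleR_diff_right)
  have Ukm[measurable]: "case_prod (Uk k) \<in> borel_measurable (P \<Otimes>\<^sub>M lborel)" for k
    unfolding Uk_def split_beta' using Em by (simp add: split_beta')

  \<comment> \<open>Lagrange's identity for four terms: the defect in the Cauchy-Schwarz inequality
    is a sum of six squares, one for each pair.\<close>
  have sq4: "(p - q - (p' - q') :: real)\<^sup>2 \<le> 4 * (p\<^sup>2 + q\<^sup>2 + p'\<^sup>2 + q'\<^sup>2)" for p q p' q'
  proof -
    have "4 * (p\<^sup>2 + q\<^sup>2 + p'\<^sup>2 + q'\<^sup>2) - (p - q - (p' - q'))\<^sup>2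
       = (p + q)\<^sup>2 + (p + p')\<^sup>2 + (p - q')\<^sup>2 + (q - p')\<^sup>2 + (q + q')\<^sup>2 + (p' + q')\<^sup>2"
      by (simp add: power2_eq_square algebra_simps)
    moreover have "0 \<le> \<dots>" by simp
    ultimately show ?thesis by linarith
  qed
  have limV: "(\<lambda>k. \<integral>\<^sup>+\<omega>. ennreal ((norm (V \<omega> - Vk k \<omega>))\<^sup>2) \<partial>P) \<longlonglongrightarrow> 0"
  proof (rule tendsto_sandwich[OF _ _ tendsto_const])
    let ?J = "\<lambda>I S u k. \<integral>\<^sup>+\<omega>. ennreal ((I u \<omega> - S k u \<omega>)\<^sup>2) \<partial>P"
    show "(\<lambda>k. 4 * (?J I S t k + ?J I S s k + ?J I' S' t k + ?J I' S' s k)) \<longlonglongrightarrow> 0"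
      using ennreal_tendsto_cmult[OF _ tendsto_add[OF tendsto_add[OF tendsto_add[OF limI[OF t0] limI[OF st(1)]] limI'[OF t0]] limI'[OF st(1)]], of 4]
      by (simp add: S_def S'_def)
    show "\<forall>\<^sub>F k in sequentially. (\<integral>\<^sup>+\<omega>. ennreal ((norm (V \<omega> - Vk k \<omega>))\<^sup>2) \<partial>P)
       \<le> 4 * (?J I S t k + ?J I S s k + ?J I' S' t k + ?J I' S' s k)"
    proof (intro always_eventually allI)
      fix k
      have "(\<integral>\<^sup>+\<omega>. ennreal ((norm (V \<omega> - Vk k \<omega>))\<^sup>2) \<partial>P)
        \<le> (\<integral>\<^sup>+\<omega>. 4 * (ennreal ((I t \<omega> - S k t \<omega>)\<^sup>2) + ennreal ((I s \<omega> - S k s \<omega>)\<^sup>2)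
             + ennreal ((I' t \<omega> - S' k t \<omega>)\<^sup>2) + ennreal ((I' s \<omega> - S' k s \<omega>)\<^sup>2)) \<partial>P)"
      proof (rule nn_integral_mono)
        fix \<omega>
        have "V \<omega> - Vk k \<omega> = (I t \<omega> - S k t \<omega>) - (I s \<omega> - S k s \<omega>) - ((I' t \<omega> - S' k t \<omega>) - (I' s \<omega> - S' k s \<omega>))"
          by (simp add: V_def Vk_def)
        then have "(norm (V \<omega> - Vk k \<omega>))\<^sup>2 \<le> 4 * ((I t \<omega> - S k t \<omega>)\<^sup>2 + (I s \<omega> - S k s \<omega>)\<^sup>2 
             + (I' t \<omega> - S' k t \<omega>)\<^sup>2 + (I' s \<omega> - S' k s \<omega>)\<^sup>2)"
          using sq4 by simp
        then have "ennreal ((norm (V \<omega> - Vk k \<omega>))\<^sup>2) \<le> ennreal (4 * ((I t \<omega> - S k t \<omega>)\<^sup>2 + (I s \<omega> - S k s \<omega>)\<^sup>2 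
             + (I' t \<omega> - S' k t \<omega>)\<^sup>2 + (I' s \<omega> - S' k s \<omega>)\<^sup>2))"
          by (rule ennreal_leI)
        also have "\<dots> = 4 * (ennreal ((I t \<omega> - S k t \<omega>)\<^sup>2) + ennreal ((I s \<omega> - S k s \<omega>)\<^sup>2)
             + ennreal ((I' t \<omega> - S' k t \<omega>)\<^sup>2) + ennreal ((I' s \<omega> - S' k s \<omega>)\<^sup>2))"
          by (simp add: ennreal_mult ennreal_plus)
        finally show "ennreal ((norm (V \<omega> - Vk k \<omega>))\<^sup>2) \<le> \<dots>" .
      qed
      also have "\<dots> = 4 * (?J I S t k + ?J I S s k + ?J I' S' t k + ?J I' S' s k)"
        by (simp add: nn_integral_cmult nn_integral_add)
      finally show "(\<integral>\<^sup>+\<omega>. ennreal ((norm (V \<omega> - Vk k \<omega>))\<^sup>2) \<partial>P)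
         \<le> 4 * (?J I S t k + ?J I S s k + ?J I' S' t k + ?J I' S' s k)" .
    qed
  qed simp

  have limU: "(\<lambda>k. \<integral>\<^sup>+x. ennreal ((norm (case_prod U x - case_prod (Uk k) x))\<^sup>2) \<partial>(P \<Otimes>\<^sub>M lborel)) \<longlonglongrightarrow> 0"
  proof (rule tendsto_sandwich[OF _ _ tendsto_const])
    let ?H = "\<lambda>Z E k \<omega> r. ennreal ((norm (Z r \<omega> - E k r \<omega>))\<^sup>2) * indicator {0..t} r"
    let ?J = "\<lambda>Z E k. \<integral>\<^sup>+\<omega>. (\<integral>\<^sup>+r. ?H Z E k \<omega> r \<partial>lborel) \<partial>P"
    show "(\<lambda>k. 2 * (?J Z E k + ?J Z' E' k)) \<longlonglongrightarrow> 0"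
      using ennreal_tendsto_cmult[OF _ tendsto_add[OF limZ[OF t0] limZ'[OF t0]], of 2]
      by (simp add: E_def E'_def)
    \<comment> \<open>\<open>Z\<close> is jointly measurable only after it is cut to
      \<open>{0..t}\<close>. Measurability of the integrand is needed to replace the iterated
      integral of \<open>has_ito_integral\<close> by one over the product space.\<close>
    have Hm: "case_prod (?H Z E k) \<in> borel_measurable (P \<Otimes>\<^sub>M lborel)" 
      if "(\<lambda>(\<omega>, r). indicator {0..t} r *\<^sub>R Z r \<omega>) \<in> borel_measurable (P \<Otimes>\<^sub>M lborel)"
         "(\<lambda>(\<omega>, r). E k r \<omega>) \<in> borel_measurable (P \<Otimes>\<^sub>M lborel)"
      for Z :: "real \<Rightarrow> 'a \<Rightarrow> real^'n" and E :: "nat \<Rightarrow> real \<Rightarrow> 'a \<Rightarrow> real^'n" and k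
    proof -
      note [measurable] = that
      have "(\<lambda>x. ennreal ((norm ((\<lambda>(\<omega>, r). indicator {0..t} r *\<^sub>R Z r \<omega>) x - indicator {0..t} (snd x) *\<^sub>R (\<lambda>(\<omega>, r). E k r \<omega>) x))\<^sup>2))
         \<in> borel_measurable (P \<Otimes>\<^sub>M lborel)" by measurable
      also have "(\<lambda>x. ennreal ((norm ((\<lambda>(\<omega>, r). indicator {0..t} r *\<^sub>R Z r \<omega>) x - indicator {0..t} (snd x) *\<^sub>R (\<lambda>(\<omega>, r). E k r \<omega>) x))\<^sup>2))
         = case_prod (?H Z E k)"
        by (auto simp: fun_eq_iff indicator_def)
      finally show ?thesis .
    qed
    show "\<forall>\<^sub>F k in sequentially. (\<integral>\<^sup>+x. ennreal ((norm (case_prod U x - case_prod (Uk k) x))\<^sup>2) \<partial>(P \<Otimes>\<^sub>M lborel))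
       \<le> 2 * (?J Z E k + ?J Z' E' k)"
    proof (intro always_eventually allI)
      fix k
      note HM = Hm[of Z E k, OF Z1(3) Em(1)] Hm[of Z' E' k, OF Z1(4) Em(2)]
      have "(\<integral>\<^sup>+x. ennreal ((norm (case_prod U x - case_prod (Uk k) x))\<^sup>2) \<partial>(P \<Otimes>\<^sub>M lborel))
        \<le> (\<integral>\<^sup>+x. 2 * (case_prod (?H Z E k) x + case_prod (?H Z' E' k) x) \<partial>(P \<Otimes>\<^sub>M lborel))"
      proof (rule nn_integral_mono)
        fix x :: "'a \<times> real"
        obtain \<omega> r where x: "x = (\<omega>, r)" by (cases x)
        have "norm (U \<omega> r - Uk k \<omega> r) \<le> indicator {s<..t} r * (norm (Z r \<omega> - E k r \<omega>) + norm (Z' r \<omega> - E' k r \<omega>))"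
          using norm_triangle_ineq4[of "Z r \<omega> - E k r \<omega>" "Z' r \<omega> - E' k r \<omega>"]
          by (auto simp: U_def Uk_def indicator_def algebra_simps)
        then have "(norm (U \<omega> r - Uk k \<omega> r))\<^sup>2 \<le> (indicator {s<..t} r * (norm (Z r \<omega> - E k r \<omega>) + norm (Z' r \<omega> - E' k r \<omega>)))\<^sup>2"
          by (rule power_mono) simp
        also have "\<dots> \<le> 2 * ((norm (Z r \<omega> - E k r \<omega>))\<^sup>2 * indicator {0..t} r + (norm (Z' r \<omega> - E' k r \<omega>))\<^sup>2 * indicator {0..t} r)"
          using st sum_squares_bound[of "norm (Z r \<omega> - E k r \<omega>)" "norm (Z' r \<omega> - E' k r \<omega>)"]
          by (auto simp: indicator_def power2_sum)
        finally have "ennreal ((norm (U \<omega> r - Uk k \<omega> r))\<^sup>2) \<le> ennreal \<dots>"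
          by (rule ennreal_leI)
        also have "\<dots> = 2 * (?H Z E k \<omega> r + ?H Z' E' k \<omega> r)"
          by (simp add: ennreal_mult ennreal_plus ennreal_indicator)
        finally show "ennreal ((norm (case_prod U x - case_prod (Uk k) x))\<^sup>2) 
            \<le> 2 * (case_prod (?H Z E k) x + case_prod (?H Z' E' k) x)"
          by (simp add: x)
      qed
      also have "\<dots> = 2 * ((\<integral>\<^sup>+x. case_prod (?H Z E k) x \<partial>(P \<Otimes>\<^sub>M lborel)) + (\<integral>\<^sup>+x. case_prod (?H Z' E' k) x \<partial>(P \<Otimes>\<^sub>M lborel)))"
        using HM by (subst nn_integral_cmult) (auto simp: nn_integral_add)
      also have "\<dots> = 2 * (?J Z E k + ?J Z' E' k)"
        using lborel.nn_integral_fst[OF HM(1)] lborel.nn_integral_fst[OF HM(2)] by simp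
      finally show "(\<integral>\<^sup>+x. ennreal ((norm (case_prod U x - case_prod (Uk k) x))\<^sup>2) \<partial>(P \<Otimes>\<^sub>M lborel)) \<le> 2 * (?J Z E k + ?J Z' E' k)" .
    qed
  qed simp

  have C': "\<bar>w \<omega>\<bar> \<le> C" if "\<omega> \<in> space P" for \<omega> using C that by simp
  have LV: "integrable P (\<lambda>\<omega>. (norm (V \<omega>))\<^sup>2)" "integrable P (\<lambda>\<omega>. w \<omega> * (norm (V \<omega>))\<^sup>2)"
    "(\<lambda>k. P.expectation (\<lambda>\<omega>. w \<omega> * (norm (Vk k \<omega>))\<^sup>2)) \<longlonglongrightarrow> P.expectation (\<lambda>\<omega>. w \<omega> * (norm (V \<omega>))\<^sup>2)"
    by (rule L2_limit_square[OF Vm Vkm limV _ _ C']; simp add: el1)+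
  show "integrable P (\<lambda>\<omega>. (V \<omega>)\<^sup>2)" "integrable P (\<lambda>\<omega>. w \<omega> * (V \<omega>)\<^sup>2)"
    using LV(1,2) by simp_all
  have lin: "integrable P (\<lambda>\<omega>. w \<omega> * V \<omega>)" 
    "(\<lambda>k. P.expectation (\<lambda>\<omega>. w \<omega> * Vk k \<omega>)) \<longlonglongrightarrow> P.expectation (\<lambda>\<omega>. w \<omega> * V \<omega>)"
    by (rule P.L2_limit_linear[OF Vm Vkm limV _ _ C']; simp add: el1)+
  have "P.expectation (\<lambda>\<omega>. w \<omega> * Vk k \<omega>) = 0" for k
    using el(2)[of _ _ k, OF w C] by (simp add: has_bochner_integral_iff)
  then have "P.expectation (\<lambda>\<omega>. w \<omega> * V \<omega>) = 0"
    using LIMSEQ_unique[OF lin(2)] by simp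
  then show "has_bochner_integral P (\<lambda>\<omega>. w \<omega> * V \<omega>) 0"
    using lin(1) by (simp add: has_bochner_integral_iff)
  have wm: "(\<lambda>x. w (fst x)) \<in> borel_measurable (P \<Otimes>\<^sub>M lborel)" by measurable
  have Cx: "\<bar>w (fst x)\<bar> \<le> C" if "x \<in> space (P \<Otimes>\<^sub>M lborel)" for x
    using C that by (auto simp: space_pair_measure)
  note LU = L2_limit_square(2,3)[OF Um Ukm limU el1(2) wm Cx]
  \<comment> \<open>The isometry is exact for simple integrals, so two convergent sequences coincide
    term by term and their limits must agree.\<close>
  have "integral\<^sup>L (P \<Otimes>\<^sub>M lborel) (\<lambda>x. w (fst x) * (norm (case_prod (Uk k) x))\<^sup>2) 
      = P.expectation (\<lambda>\<omega>. w \<omega> * (norm (Vk k \<omega>))\<^sup>2)" for k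
    using el(3,4)[of _ _ k, OF w C] by (simp add: has_bochner_integral_iff split_beta')
  then have "integral\<^sup>L (P \<Otimes>\<^sub>M lborel) (\<lambda>x. w (fst x) * (norm (case_prod U x))\<^sup>2) 
      = P.expectation (\<lambda>\<omega>. w \<omega> * (norm (V \<omega>))\<^sup>2)"
    using LIMSEQ_unique[OF LU(2)] LV(3) by simp
  then show "has_bochner_integral (P \<Otimes>\<^sub>M lborel) (\<lambda>(\<omega>, r). w \<omega> * (norm (U \<omega> r))\<^sup>2) 
           (P.expectation (\<lambda>\<omega>. w \<omega> * (V \<omega>)\<^sup>2))"
    using LU(1) by (simp add: has_bochner_integral_iff split_beta')
qed

end

subsection \<open>Bounded processes with a drift\<close>

text \<open>The integral of \<open>(z r - c)\<^sup>2\<close> is nonnegative when \<open>c\<close> is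
  the mean of \<open>z\<close> over the interval; expanding it gives this case of the Cauchy-Schwarz
  inequality.\<close>

lemma set_integral_square_le:
  fixes z :: "real \<Rightarrow> real"
  assumes st: "s \<le> t" and z: "set_integrable lborel {s<..t} z" and z2: "set_integrable lborel {s<..t} (\<lambda>r. (z r)\<^sup>2)"
  shows "(LINT r:{s<..t}|lborel. z r)\<^sup>2 \<le> (t - s) * (LINT r:{s<..t}|lborel. (z r)\<^sup>2)"
proof (cases "s = t")
  case False
  then have d: "0 < t - s" using st by simp
  let ?J = "LINT r:{s<..t}|lborel. z r" and ?q = "LINT r:{s<..t}|lborel. (z r)\<^sup>2"
  define c where "c = ?J / (t - s)"
  have const: "set_integrable lborel {s<..t} (\<lambda>r. x)" for x :: real
    using st by (simp add: set_integrable_def less_top[symmetric])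
  have "0 \<le> (LINT r:{s<..t}|lborel. (z r - c)\<^sup>2)"
    unfolding set_lebesgue_integral_def by (intro integral_nonneg_AE AE_I2) simp
  also have "(LINT r:{s<..t}|lborel. (z r - c)\<^sup>2) = (LINT r:{s<..t}|lborel. ((z r)\<^sup>2 - (2 * c) * z r) + c\<^sup>2)"
    by (intro set_lebesgue_integral_cong) (auto simp: power2_diff)
  also have "\<dots> = ?q - 2 * c * ?J + c\<^sup>2 * (t - s)"
    using z z2 const st by (simp add: set_integral_add set_integral_diff set_integral_const mult.commute)
  also have "\<dots> = ?q - ?J\<^sup>2 / (t - s)"
  proof -
    have "c * (t - s) = ?J" using d by (simp add: c_def)
    then have "c\<^sup>2 * (t - s) = c * ?J" by (simp add: power2_eq_square mult.assoc)
    moreover have "?J\<^sup>2 / (t - s) = c * ?J" by (simp add: c_def power2_eq_square)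
    ultimately show ?thesis by simp
  qed
  finally show ?thesis using d by (simp add: field_simps)
qed (simp add: set_lebesgue_integral_def)

text \<open>Square the tangent bound \<open>1 + x / 2 \<le> exp (x / 2)\<close>; the hypothesis
  makes its left side nonnegative. The coefficient 1/4 is weaker than the Taylor coefficient 1/2, a
  loss that a larger \<open>a\<close> compensates.\<close>

lemma exp_ge_quadratic:
  fixes x :: real
  assumes "- 2 \<le> x"
  shows "1 + x + x\<^sup>2 / 4 \<le> exp x"
proof -
  have "(1 + x / 2)\<^sup>2 \<le> (exp (x / 2))\<^sup>2"
    using assms by (intro power_mono) auto
  then show ?thesis
    by (simp add: power2_eq_square field_simps exp_add[symmetric])
qed

text \<open>Summation stops after the first step longer than \<open>1 / a\<close>. That step may violate the
  quadratic lower bound for \<open>exp\<close>, but it occurs only once, which costs the term with \<open>(a * C)\<^sup>2\<close>.\<close>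

lemma stopped_exp_sum_le:
  fixes d :: "nat \<Rightarrow> real"
  assumes a: "0 < a" and C: "\<And>i. \<bar>d i\<bar> \<le> C"
  defines "G \<equiv> \<lambda>i. \<forall>j<i. \<bar>d (Suc j) - d j\<bar> \<le> 1 / a"
  shows "(\<Sum>i<n. (if G i then exp (a * d i) else 0)
            * (a * (d (Suc i) - d i) + (a * (d (Suc i) - d i))\<^sup>2 / 4))
         \<le> exp (a * C) + (if G n then 0 else (a * C)\<^sup>2 * exp (a * C))"
proof -
  let ?R = "\<lambda>n. \<Sum>i<n. (if G i then exp (a * d i) else 0) * (a * (d (Suc i) - d i) + (a * (d (Suc i) - d i))\<^sup>2 / 4)"
  have exp_le: "exp (a * d i) \<le> exp (a * C)" for i
    using a C[of i] by simp
  \<comment> \<open>The claim is strengthened for the induction: as long as all steps are short the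
    sum stays below \<open>exp (a * d n)\<close>, so each step telescopes. After a long step all
    further weights are 0 and the bound is frozen.\<close>
  have "?R n \<le> (if G n then exp (a * d n) else exp (a * C) + (a * C)\<^sup>2 * exp (a * C))"
  proof (induction n)
    case (Suc n)
    define x where "x = a * (d (Suc n) - d n)"
    have ex: "exp (a * d n) * exp x = exp (a * d (Suc n))"
      by (simp add: x_def exp_add[symmetric] algebra_simps)
    show ?case
    proof (cases "G n")
      case False
      then have "\<not> G (Suc n)" unfolding G_def using less_SucI by blast
      with False Suc show ?thesis by simp
    next
      case True
      have R: "?R (Suc n) \<le> exp (a * d n) + exp (a * d n) * (x + x\<^sup>2 / 4)"
        using Suc True by (simp add: x_def)
      show ?thesis
      proof (cases "G (Suc n)")
        case G: True
        then have "\<bar>d (Suc n) - d n\<bar> \<le> 1 / a" by (simp add: G_def)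
        then have "- 2 \<le> x"
          using a by (simp add: x_def abs_le_iff field_simps)
        then have "exp (a * d n) * (1 + x + x\<^sup>2 / 4) \<le> exp (a * d n) * exp x"
          by (intro mult_left_mono exp_ge_quadratic) auto
        then have "exp (a * d n) + exp (a * d n) * (x + x\<^sup>2 / 4) \<le> exp (a * d (Suc n))"
          unfolding ex by (simp add: algebra_simps)
        from order_trans[OF R this] show ?thesis by (simp only: G if_True)
      next
        case False
        \<comment> \<open>This is the first long step. The linear bound
          \<open>1 + x \<le> exp x\<close> still holds there, and the square is controlled by the
          bound \<open>C\<close> on \<open>d\<close> alone.\<close>
        have "\<bar>x\<bar> \<le> 2 * (a * C)"
          using a C[of n] C[of "Suc n"] by (simp add: x_def abs_mult)
        then have "x\<^sup>2 \<le> (2 * (a * C))\<^sup>2"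
          by (metis abs_ge_zero power2_abs power_mono)
        then have "x\<^sup>2 / 4 \<le> (a * C)\<^sup>2" by (simp add: power_mult_distrib)
        then have "exp (a * d n) * (1 + x) + exp (a * d n) * (x\<^sup>2 / 4)
           \<le> exp (a * d n) * exp x + exp (a * C) * (a * C)\<^sup>2"
          using exp_le[of n] by (intro add_mono mult_left_mono mult_mono) (auto simp: exp_ge_add_one_self)
        also have "\<dots> \<le> exp (a * C) + (a * C)\<^sup>2 * exp (a * C)"
          using exp_le[of "Suc n"] by (simp add: ex)
        finally have "exp (a * d n) + exp (a * d n) * (x + x\<^sup>2 / 4) \<le> exp (a * C) + (a * C)\<^sup>2 * exp (a * C)"
          by (simp add: algebra_simps)
        from order_trans[OF R this] show ?thesis by (simp only: False if_False)
      qed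
    qed
  qed simp
  also have "\<dots> \<le> exp (a * C) + (if G n then 0 else (a * C)\<^sup>2 * exp (a * C))"
    using exp_le[of n] by simp
  finally show ?thesis .
qed

section \<open>One-step lower bound for the exponential, and its sum over a fine partition\<close>

context brownian begin

text \<open>Fubini converts the identity on the product space into one for the pathwise energy
  \<open>q\<close>. The weight 1 gives integrability of \<open>q\<close>, hence square integrability
  of almost every path and, the interval being bounded, also integrability.\<close>

lemma ito_difference_isometry:
  assumes I: "has_ito_integral M W Z I" and I': "has_ito_integral M W Z' I'"
    and st: "0 \<le> s" "s \<le> t" 
    and w: "w \<in> borel_measurable (F s)" and C: "\<And>\<omega>. \<omega> \<in> space M \<Longrightarrow> \<bar>w \<omega>\<bar> \<le> C"
  defines "q \<equiv> \<lambda>\<omega>. LINT r:{s<..t}|lborel. (norm (Z r \<omega> - Z' r \<omega>))\<^sup>2"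
  shows "has_bochner_integral P (\<lambda>\<omega>. w \<omega> * q \<omega>)
           (P.expectation (\<lambda>\<omega>. w \<omega> * ((I t \<omega> - I s \<omega>) - (I' t \<omega> - I' s \<omega>))\<^sup>2))"
    and "integrable P q"
    and "AE \<omega> in P. set_integrable lborel {s<..t} (\<lambda>r. norm (Z r \<omega> - Z' r \<omega>)) \<and>
           set_integrable lborel {s<..t} (\<lambda>r. (norm (Z r \<omega> - Z' r \<omega>))\<^sup>2)"
proof -
  interpret PL: pair_sigma_finite P lborel ..
  have sq: "(norm (indicator {s<..t} r *\<^sub>R (Z r \<omega> - Z' r \<omega>)))\<^sup>2 = indicator {s<..t} r *\<^sub>R (norm (Z r \<omega> - Z' r \<omega>))\<^sup>2" for r \<omega>
    by (simp add: indicator_def)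
  note m = ito_difference_moments(5)[OF I I' st, unfolded sq]
  have fst: "integrable P (\<lambda>\<omega>. v \<omega> * q \<omega>) \<and> P.expectation (\<lambda>\<omega>. v \<omega> * q \<omega>)
       = P.expectation (\<lambda>\<omega>. v \<omega> * ((I t \<omega> - I s \<omega>) - (I' t \<omega> - I' s \<omega>))\<^sup>2)"
    if v: "v \<in> borel_measurable (F s)" and D: "\<And>\<omega>. \<omega> \<in> space M \<Longrightarrow> \<bar>v \<omega>\<bar> \<le> D" for v D
    using PL.integrable_fst'[OF m[OF v D, THEN integrable.intros]] PL.integral_fst'[OF m[OF v D, THEN integrable.intros]]
      has_bochner_integral_integral_eq[OF m[OF v D]]
    by (simp add: q_def set_lebesgue_integral_def)
  show "has_bochner_integral P (\<lambda>\<omega>. w \<omega> * q \<omega>)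
           (P.expectation (\<lambda>\<omega>. w \<omega> * ((I t \<omega> - I s \<omega>) - (I' t \<omega> - I' s \<omega>))\<^sup>2))"
    using fst[OF w C] by (simp add: has_bochner_integral_iff)
  have one: "(\<lambda>_. 1) \<in> borel_measurable (F s)" "\<And>\<omega>. \<omega> \<in> space M \<Longrightarrow> \<bar>1\<bar> \<le> (1::real)" by auto
  show "integrable P q"
    using fst[OF one] by simp
  have "AE \<omega> in P. integrable lborel (\<lambda>r. indicator {s<..t} r *\<^sub>R (norm (Z r \<omega> - Z' r \<omega>))\<^sup>2)"
    using PL.AE_integrable_fst'[OF m[OF one, THEN integrable.intros]] by simp
  then show "AE \<omega> in P. set_integrable lborel {s<..t} (\<lambda>r. norm (Z r \<omega> - Z' r \<omega>)) \<and>
           set_integrable lborel {s<..t} (\<lambda>r. (norm (Z r \<omega> - Z' r \<omega>))\<^sup>2)"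
  proof (rule AE_mp, intro AE_I2 impI conjI)
    fix \<omega> assume i: "integrable lborel (\<lambda>r. indicator {s<..t} r *\<^sub>R (norm (Z r \<omega> - Z' r \<omega>))\<^sup>2)"
    then show "set_integrable lborel {s<..t} (\<lambda>r. (norm (Z r \<omega> - Z' r \<omega>))\<^sup>2)"
      by (simp add: set_integrable_def)
    show "set_integrable lborel {s<..t} (\<lambda>r. norm (Z r \<omega> - Z' r \<omega>))"
      unfolding set_integrable_def
    proof (rule Bochner_Integration.integrable_bound)
      show "integrable lborel (\<lambda>r. indicator {s<..t} r + indicator {s<..t} r *\<^sub>R (norm (Z r \<omega> - Z' r \<omega>))\<^sup>2)"
        using i st by (intro Bochner_Integration.integrable_add) (auto simp: less_top[symmetric])
      \<comment> \<open>Measurability of the norm along a fixed path is recovered as the root of the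
        square, whose integrability is at hand.\<close>
      have "(\<lambda>r. sqrt (indicator {s<..t} r *\<^sub>R (norm (Z r \<omega> - Z' r \<omega>))\<^sup>2)) \<in> borel_measurable lborel"
        using borel_measurable_integrable[OF i] by measurable
      also have "(\<lambda>r. sqrt (indicator {s<..t} r *\<^sub>R (norm (Z r \<omega> - Z' r \<omega>))\<^sup>2)) 
          = (\<lambda>r. indicator {s<..t} r *\<^sub>R norm (Z r \<omega> - Z' r \<omega>))"
        by (auto simp: indicator_def)
      finally show "(\<lambda>r. indicator {s<..t} r *\<^sub>R norm (Z r \<omega> - Z' r \<omega>)) \<in> borel_measurable lborel" .
      have le: "y \<le> 1 + y\<^sup>2" for y :: real
        using sum_squares_bound[of 1 y, simplified] zero_le_power2[of y] by linarith
      show "AE r in lborel. norm (indicator {s<..t} r *\<^sub>R norm (Z r \<omega> - Z' r \<omega>))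
         \<le> norm (indicator {s<..t} r + indicator {s<..t} r *\<^sub>R (norm (Z r \<omega> - Z' r \<omega>))\<^sup>2)"
        using le by (intro AE_I2) (auto simp: indicator_def abs_of_nonneg)
    qed
  qed
qed


text \<open>Split the increment u of \<open>D\<close> into V and a drift part m with |m - l
  \<delta>| <= k J, where J is the integral of the norm and J^2 <= \<delta> q. Young's inequality
  bounds k J by l \<delta> / 2 + k^2 q / (2 l), which leaves half of the drift; the square keeps
  half of V^2 up to m^2. Since m^2 is at most 2 (l^2 \<delta>^2 + k^2 \<delta> q), it has a factor
  \<delta> to spare and becomes the error term.\<close>

lemma drift_step:
  assumes I: "has_ito_integral M W Z I" and I': "has_ito_integral M W Z' I'"
    and Dm: "\<And>t. 0 \<le> t \<Longrightarrow> D t \<in> borel_measurable (F t)"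
    and C: "\<And>t \<omega>. \<bar>D t \<omega>\<bar> \<le> C"
    and st: "0 \<le> s" "s \<le> t"
    and k: "0 \<le> k" and l: "0 < l" and a: "0 < a" "4 * k\<^sup>2 / l \<le> a"
    and dyn: "AE \<omega> in P. \<bar>D t \<omega> - D s \<omega> - ((I t \<omega> - I s \<omega>) - (I' t \<omega> - I' s \<omega>)) - l * (t - s)\<bar>
        \<le> k * (LINT r:{s<..t}|lborel. norm (Z r \<omega> - Z' r \<omega>))"
    and w: "w \<in> borel_measurable (F s)" and w0: "\<And>\<omega>. 0 \<le> w \<omega>" and B: "\<And>\<omega>. w \<omega> \<le> B"
  defines "q \<equiv> \<lambda>\<omega>. LINT r:{s<..t}|lborel. (norm (Z r \<omega> - Z' r \<omega>))\<^sup>2"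
    and "R \<equiv> \<lambda>\<omega>. w \<omega> * (a * (D t \<omega> - D s \<omega>) + (a * (D t \<omega> - D s \<omega>))\<^sup>2 / 4)"
  shows "integrable P R"
    and "a * l * (t - s) / 2 * P.expectation w 
        - a\<^sup>2 / 2 * B * (l\<^sup>2 * (t - s)\<^sup>2 + k\<^sup>2 * (t - s) * P.expectation q) \<le> P.expectation R"
proof -
  define \<delta> where "\<delta> = t - s"
  define V where "V \<omega> = (I t \<omega> - I s \<omega>) - (I' t \<omega> - I' s \<omega>)" for \<omega>
  have \<delta>: "0 \<le> \<delta>" using st by (simp add: \<delta>_def)
  have wB: "\<bar>w \<omega>\<bar> \<le> B" for \<omega> using w0[of \<omega>] B[of \<omega>] by simp
  have B0: "0 \<le> B" using w0 B order_trans by blast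
  have [measurable]: "D s \<in> borel_measurable P" "D t \<in> borel_measurable P" "w \<in> borel_measurable P"
    using Dm[OF st(1)] Dm[OF order_trans[OF st]] w by (auto intro: measurable_F_P)
  have Db: "\<bar>D t \<omega> - D s \<omega>\<bar> \<le> 2 * C" for \<omega> using C[of t \<omega>] C[of s \<omega>] by simp
  show iR: "integrable P R"
  proof (rule P.integrable_const_bound[of _ "B * (a * (2 * C) + (a * (2 * C))\<^sup>2 / 4)"])
    show "AE \<omega> in P. norm (R \<omega>) \<le> B * (a * (2 * C) + (a * (2 * C))\<^sup>2 / 4)"
    proof (rule AE_I2)
      fix \<omega>
      have aD: "\<bar>a * (D t \<omega> - D s \<omega>)\<bar> \<le> a * (2 * C)"
        using a Db[of \<omega>] by (simp add: abs_mult)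
      have "(a * (D t \<omega> - D s \<omega>))\<^sup>2 \<le> (a * (2 * C))\<^sup>2"
        by (metis abs_ge_zero aD power2_abs power_mono)
      then have "\<bar>a * (D t \<omega> - D s \<omega>) + (a * (D t \<omega> - D s \<omega>))\<^sup>2 / 4\<bar> \<le> a * (2 * C) + (a * (2 * C))\<^sup>2 / 4"
        using aD zero_le_power2[of "a * (D t \<omega> - D s \<omega>)"] unfolding abs_le_iff by linarith
      then show "norm (R \<omega>) \<le> B * (a * (2 * C) + (a * (2 * C))\<^sup>2 / 4)"
        unfolding R_def real_norm_def abs_mult using wB[of \<omega>] B0 by (intro mult_mono) auto
    qed
  qed (unfold R_def, measurable)
  note md = ito_difference_moments[OF I I' st w wB, folded V_def]
  note mi = ito_difference_isometry[OF I I' st w wB, folded V_def q_def]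
  have iw: "integrable P w" by (rule P.integrable_const_bound[of _ B]) (use wB in auto)
  have iq: "integrable P q" by (rule mi(2))
  have iwq: "integrable P (\<lambda>\<omega>. w \<omega> * q \<omega>)" and Ewq: "P.expectation (\<lambda>\<omega>. w \<omega> * q \<omega>) = P.expectation (\<lambda>\<omega>. w \<omega> * (V \<omega>)\<^sup>2)"
    using mi(1) by (simp_all add: has_bochner_integral_iff q_def)
  have iwV: "integrable P (\<lambda>\<omega>. w \<omega> * V \<omega>)" and EwV: "P.expectation (\<lambda>\<omega>. w \<omega> * V \<omega>) = 0"
    using md(3) by (simp_all add: has_bochner_integral_iff)
  have iwV2: "integrable P (\<lambda>\<omega>. w \<omega> * (V \<omega>)\<^sup>2)" by (rule md(4))
  \<comment> \<open>After taking expectations the negative \<open>w q\<close> term is absorbed by the \<open>w V\<^sup>2\<close> term, by the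
    isometry and the choice of \<open>a\<close>.\<close>
  define L where "L \<omega> = (a * l * \<delta> / 2) * w \<omega> - (a * k\<^sup>2 / (2 * l)) * (w \<omega> * q \<omega>) + a * (w \<omega> * V \<omega>) + (a\<^sup>2 / 8) * (w \<omega> * (V \<omega>)\<^sup>2)
     - a\<^sup>2 / 2 * B * (l\<^sup>2 * \<delta>\<^sup>2 + k\<^sup>2 * \<delta> * q \<omega>)" for \<omega>
  have iL: "integrable P L"
    unfolding L_def using iw iwq iwV iwV2 iq by simp
  have EL: "P.expectation L = (a * l * \<delta> / 2) * P.expectation w - (a * k\<^sup>2 / (2 * l)) * P.expectation (\<lambda>\<omega>. w \<omega> * q \<omega>) 
     + (a\<^sup>2 / 8) * P.expectation (\<lambda>\<omega>. w \<omega> * q \<omega>)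
     - a\<^sup>2 / 2 * B * (l\<^sup>2 * \<delta>\<^sup>2 + k\<^sup>2 * \<delta> * P.expectation q)"
    unfolding L_def using iw iwq iwV iwV2 iq by (simp add: EwV Ewq prob_space.prob_space[OF prob_M])
  have "AE \<omega> in P. L \<omega> \<le> R \<omega>"
    using dyn mi(3)
  proof eventually_elim
    case (elim \<omega>)
    let ?J = "LINT r:{s<..t}|lborel. norm (Z r \<omega> - Z' r \<omega>)"
    define u where "u = D t \<omega> - D s \<omega>"
    define m where "m = u - V \<omega>"
    have q0: "0 \<le> q \<omega>"
      unfolding q_def set_lebesgue_integral_def by (intro integral_nonneg_AE AE_I2) simp
    have J: "?J\<^sup>2 \<le> \<delta> * q \<omega>"
      using set_integral_square_le[OF st(2)] elim by (simp add: q_def \<delta>_def)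
    have mJ: "\<bar>m - l * \<delta>\<bar> \<le> k * ?J"
      using elim(1) by (simp add: m_def u_def V_def \<delta>_def)
    have kJ: "(k * ?J)\<^sup>2 \<le> k\<^sup>2 * (\<delta> * q \<omega>)"
      using J by (simp add: power_mult_distrib mult_left_mono)
    have m1: "l * \<delta> / 2 - k\<^sup>2 / (2 * l) * q \<omega> \<le> m"
    proof -
      have "(k * ?J)\<^sup>2 \<le> (l * \<delta> / 2 + k\<^sup>2 / (2 * l) * q \<omega>)\<^sup>2"
      proof -
        have "(l * \<delta> / 2 + k\<^sup>2 / (2 * l) * q \<omega>)\<^sup>2 - k\<^sup>2 * (\<delta> * q \<omega>) = (l * \<delta> / 2 - k\<^sup>2 / (2 * l) * q \<omega>)\<^sup>2"
          using l by (simp add: power2_eq_square field_simps)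
        then show ?thesis using kJ zero_le_power2[of "l * \<delta> / 2 - k\<^sup>2 / (2 * l) * q \<omega>"] by linarith
      qed
      then have "k * ?J \<le> l * \<delta> / 2 + k\<^sup>2 / (2 * l) * q \<omega>"
        by (rule power2_le_imp_le) (use l \<delta> q0 in auto)
      then show ?thesis using mJ by (simp add: abs_le_iff)
    qed
    have m2: "m\<^sup>2 \<le> 2 * (l\<^sup>2 * \<delta>\<^sup>2 + k\<^sup>2 * \<delta> * q \<omega>)"
    proof -
      have "(m - l * \<delta>)\<^sup>2 \<le> (k * ?J)\<^sup>2"
        using mJ by (metis abs_ge_zero power2_abs power_mono)
      moreover have "m\<^sup>2 \<le> 2 * (l * \<delta>)\<^sup>2 + 2 * (m - l * \<delta>)\<^sup>2"
        using zero_le_power2[of "m - 2 * (l * \<delta>)"] by (simp add: power2_eq_square algebra_simps)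
      ultimately show ?thesis using kJ by (simp add: power_mult_distrib)
    qed
    \<comment> \<open>With u = V + m, the difference of the two sides is half the square of V + 2
      m.\<close>
    have "(V \<omega>)\<^sup>2 / 2 - m\<^sup>2 \<le> u\<^sup>2"
      using zero_le_power2[of "V \<omega> + 2 * m"] by (simp add: m_def power2_eq_square algebra_simps)
    then have u2: "(V \<omega>)\<^sup>2 / 2 - 2 * (l\<^sup>2 * \<delta>\<^sup>2 + k\<^sup>2 * \<delta> * q \<omega>) \<le> u\<^sup>2"
      using m2 by linarith
    have "a * (l * \<delta> / 2 - k\<^sup>2 / (2 * l) * q \<omega> + V \<omega>) + a\<^sup>2 * ((V \<omega>)\<^sup>2 / 2 - 2 * (l\<^sup>2 * \<delta>\<^sup>2 + k\<^sup>2 * \<delta> * q \<omega>)) / 4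
       \<le> a * u + a\<^sup>2 * u\<^sup>2 / 4"
      using m1 u2 a by (intro add_mono mult_left_mono divide_right_mono) (auto simp: m_def)
    then have "w \<omega> * (a * (l * \<delta> / 2 - k\<^sup>2 / (2 * l) * q \<omega> + V \<omega>) + a\<^sup>2 * ((V \<omega>)\<^sup>2 / 2 - 2 * (l\<^sup>2 * \<delta>\<^sup>2 + k\<^sup>2 * \<delta> * q \<omega>)) / 4) \<le> R \<omega>"
      unfolding R_def u_def[symmetric] power_mult_distrib by (rule mult_left_mono[OF _ w0])
    \<comment> \<open>Only in this error term may the weight be replaced by its bound
      \<open>B\<close>, since it is small through \<delta>. The other \<open>q\<close> term has no
      such factor and must keep \<open>w\<close> in order to cancel against the
      \<open>w V\<^sup>2\<close> term.\<close>
    moreover have "w \<omega> * (a\<^sup>2 / 2 * (l\<^sup>2 * \<delta>\<^sup>2 + k\<^sup>2 * \<delta> * q \<omega>)) \<le> B * (a\<^sup>2 / 2 * (l\<^sup>2 * \<delta>\<^sup>2 + k\<^sup>2 * \<delta> * q \<omega>))"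
      using B q0 \<delta> by (intro mult_right_mono) auto
    moreover have "w \<omega> * (a * (l * \<delta> / 2 - k\<^sup>2 / (2 * l) * q \<omega> + V \<omega>) + a\<^sup>2 * ((V \<omega>)\<^sup>2 / 2 - 2 * (l\<^sup>2 * \<delta>\<^sup>2 + k\<^sup>2 * \<delta> * q \<omega>)) / 4)
      = (a * l * \<delta> / 2) * w \<omega> - (a * k\<^sup>2 / (2 * l)) * (w \<omega> * q \<omega>) + a * (w \<omega> * V \<omega>) + (a\<^sup>2 / 8) * (w \<omega> * (V \<omega>)\<^sup>2)
        - w \<omega> * (a\<^sup>2 / 2 * (l\<^sup>2 * \<delta>\<^sup>2 + k\<^sup>2 * \<delta> * q \<omega>))"
      using l by (simp add: field_simps)
    ultimately show ?case unfolding L_def by (simp add: mult.commute mult.left_commute)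
  qed
  then have "P.expectation L \<le> P.expectation R"
    by (rule integral_mono_AE[OF iL iR])
  moreover have "(a * k\<^sup>2 / (2 * l)) * P.expectation (\<lambda>\<omega>. w \<omega> * q \<omega>) \<le> (a\<^sup>2 / 8) * P.expectation (\<lambda>\<omega>. w \<omega> * q \<omega>)"
  proof (rule mult_right_mono)
    \<comment> \<open>The lower bound on \<open>a\<close> enters here. The 1/8 is the 1/4 of the
      exponential bound times the 1/2 kept of V^2.\<close>
    have "a * (4 * k\<^sup>2 / l) \<le> a * a" using a by (intro mult_left_mono) auto
    then show "a * k\<^sup>2 / (2 * l) \<le> a\<^sup>2 / 8" using l by (simp add: power2_eq_square field_simps)
    show "0 \<le> P.expectation (\<lambda>\<omega>. w \<omega> * q \<omega>)"
      unfolding Ewq by (intro integral_nonneg_AE AE_I2) (simp add: w0)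
  qed
  ultimately show "a * l * (t - s) / 2 * P.expectation w 
        - a\<^sup>2 / 2 * B * (l\<^sup>2 * (t - s)\<^sup>2 + k\<^sup>2 * (t - s) * P.expectation q) \<le> P.expectation R"
    unfolding EL \<delta>_def[symmetric] by linarith
qed


text \<open>Almost every path is uniformly continuous on \<open>{0..T}\<close>, so eventually all of
  its steps are short. The threshold depends on the path, and dominated convergence turns this into
  a statement about probabilities.\<close>

lemma small_steps_prob_tendsto:
  fixes D :: "real \<Rightarrow> 'a \<Rightarrow> real"
  assumes Dm: "\<And>t. 0 \<le> t \<Longrightarrow> D t \<in> borel_measurable P"
    and cont: "AE \<omega> in P. continuous_on {0..} (\<lambda>t. D t \<omega>)" and T: "0 < T" and e: "0 < e"
  shows "(\<lambda>n. P.prob {\<omega> \<in> space P. \<forall>j<Suc n. \<bar>D (real (Suc j) * (T / real (Suc n))) \<omega> - D (real j * (T / real (Suc n))) \<omega>\<bar> \<le> e})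
     \<longlonglongrightarrow> 1"
proof -
  define G where "G n = {\<omega> \<in> space P. \<forall>j<Suc n. \<bar>D (real (Suc j) * (T / real (Suc n))) \<omega> - D (real j * (T / real (Suc n))) \<omega>\<bar> \<le> e}" for n
  have Gm[measurable]: "G n \<in> sets P" for n
  proof -
    have [measurable]: "D (real j * (T / real (Suc n))) \<in> borel_measurable P" for j
      using T by (intro Dm) simp
    show ?thesis unfolding G_def by measurable
  qed
  have "(\<lambda>n. P.expectation (indicator (G n) :: 'a \<Rightarrow> real)) \<longlonglongrightarrow> P.expectation (\<lambda>_. 1::real)"
  proof (rule integral_dominated_convergence[where w = "\<lambda>_. 1"])
    show "AE \<omega> in P. (\<lambda>n. indicator (G n) \<omega> :: real) \<longlonglongrightarrow> 1"
      using cont AE_space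
    proof eventually_elim
      case (elim \<omega>)
      have "uniformly_continuous_on {0..T} (\<lambda>t. D t \<omega>)"
        by (rule compact_uniformly_continuous) (auto intro: continuous_on_subset[OF elim(1)])
      then obtain d where d: "0 < d" and ud: "\<And>x y. x \<in> {0..T} \<Longrightarrow> y \<in> {0..T} \<Longrightarrow> dist y x < d \<Longrightarrow> dist (D y \<omega>) (D x \<omega>) < e"
        using e unfolding uniformly_continuous_on_def by meson
      have "(\<lambda>n. T / real (Suc n)) \<longlonglongrightarrow> 0"
        using tendsto_mult_right_zero[OF LIMSEQ_Suc[OF lim_inverse_n'], of T] by simp
      then have "\<forall>\<^sub>F n in sequentially. T / real (Suc n) < d"
        using d by (rule order_tendstoD)
      then have "\<forall>\<^sub>F n in sequentially. indicator (G n) \<omega> = (1::real)"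
      proof eventually_elim
        case (elim n)
        have "\<bar>D (real (Suc j) * (T / real (Suc n))) \<omega> - D (real j * (T / real (Suc n))) \<omega>\<bar> \<le> e" if "j < Suc n" for j
        proof -
          have le: "real i * (T / real (Suc n)) \<in> {0..T}" if "i \<le> Suc n" for i
          proof -
            have "real i * (T / real (Suc n)) \<le> real (Suc n) * (T / real (Suc n))"
              using that T by (intro mult_right_mono) auto
            then show ?thesis using T by simp
          qed
          have "real (Suc j) * (T / real (Suc n)) - real j * (T / real (Suc n)) = T / real (Suc n)"
            by (simp only: of_nat_Suc left_diff_distrib[symmetric]) simp
          then have "dist (real (Suc j) * (T / real (Suc n))) (real j * (T / real (Suc n))) < d"
            using elim T by (simp add: dist_real_def)
          from ud[OF le le this] show ?thesis
            using that by (simp add: dist_real_def)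
        qed
        then show ?case using \<open>\<omega> \<in> space P\<close> by (simp add: G_def)
      qed
      then show ?case by (rule tendsto_eventually)
    qed
    show "indicator (G n) \<in> borel_measurable P" for n
      by (rule borel_measurable_indicator[OF Gm])
    show "AE \<omega> in P. norm (indicator (G n) \<omega> :: real) \<le> 1" for n
      by (intro AE_I2) (simp add: indicator_abs_le_1)
  qed simp_all
  then have "(\<lambda>n. P.prob (G n)) \<longlonglongrightarrow> 1"
    using sets.sets_into_space[OF Gm] by (simp add: prob_space.prob_space[OF prob_M] Int_absorb2)
  then show ?thesis unfolding G_def .
qed

text \<open>Summing the one-step bounds over a uniform partition gives a lower bound that is linear
  in the horizon \<open>T\<close>, while the stopped sum is bounded uniformly in \<open>T\<close>,
  up to an error that vanishes with the mesh.\<close>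

lemma drift_nonpos:
  assumes I: "has_ito_integral M W Z I" and I': "has_ito_integral M W Z' I'"
    and Dm: "\<And>t. 0 \<le> t \<Longrightarrow> D t \<in> borel_measurable (F t)"
    and C: "\<And>t \<omega>. \<bar>D t \<omega>\<bar> \<le> C"
    and cont: "AE \<omega> in P. continuous_on {0..} (\<lambda>t. D t \<omega>)"
    and k: "0 \<le> k"
    and dyn: "\<And>s t. 0 \<le> s \<Longrightarrow> s \<le> t \<Longrightarrow>
       AE \<omega> in P. \<bar>D t \<omega> - D s \<omega> - ((I t \<omega> - I s \<omega>) - (I' t \<omega> - I' s \<omega>)) - l * (t - s)\<bar>
        \<le> k * (LINT r:{s<..t}|lborel. norm (Z r \<omega> - Z' r \<omega>))"
  shows "l \<le> 0"
proof (rule ccontr)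
  assume "\<not> l \<le> 0"
  then have l: "0 < l" by simp
  \<comment> \<open>The first summand is what \<open>drift_step\<close> demands; the 1 keeps
    \<open>a\<close> positive when \<open>k\<close> is 0.\<close>
  define a where "a = 4 * k\<^sup>2 / l + 1"
  have a: "0 < a" "4 * k\<^sup>2 / l \<le> a" using l by (auto simp: a_def intro!: add_nonneg_pos)
  \<comment> \<open>The horizon makes the limiting lower bound
    \<open>a * l * T / 2 * exp (- (a * C))\<close> equal to \<open>2 * exp (a * C)\<close>, twice
    the limiting upper bound.\<close>
  define T where "T = 4 * exp (a * C) * exp (a * C) / (a * l)"
  have T: "0 < T" using a l by (simp add: T_def)
  define q where "q s t \<omega> = (LINT r:{s<..t}|lborel. (norm (Z r \<omega> - Z' r \<omega>))\<^sup>2)" for s t \<omega>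
  define Q where "Q = P.expectation (q 0 T)"
  define h where "h n = T / real (Suc n)" for n
  define G where "G n i \<omega> \<longleftrightarrow> (\<forall>j<i. \<bar>D (real (Suc j) * h n) \<omega> - D (real j * h n) \<omega>\<bar> \<le> 1 / a)" for n i \<omega>
  define p where "p n = P.prob {\<omega> \<in> space P. G n (Suc n) \<omega>}" for n
  have plim: "p \<longlonglongrightarrow> 1"
    unfolding p_def[abs_def] G_def h_def
    by (rule small_steps_prob_tendsto[OF measurable_F_P[OF Dm] cont T]) (use a in auto)
  have h0: "0 < h n" and hT: "real (Suc n) * h n = T" for n using T by (simp_all add: h_def)
  have hlim: "h \<longlonglongrightarrow> 0"
    using tendsto_mult_right_zero[OF LIMSEQ_Suc[OF lim_inverse_n'], of T] by (simp add: h_def[abs_def])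
  have one: "(\<lambda>_. 1) \<in> borel_measurable (F s)" "\<And>\<omega>. \<omega> \<in> space M \<Longrightarrow> \<bar>1\<bar> \<le> (1::real)" for s by auto
  have step: "a * l * T / 2 * exp (- (a * C)) * p n
      - a\<^sup>2 / 2 * exp (a * C) * (l\<^sup>2 * T * h n + k\<^sup>2 * h n * Q)
      \<le> exp (a * C) + (a * C)\<^sup>2 * exp (a * C) * (1 - p n)" for n
  proof -
    define t where "t i = real i * h n" for i
    have t: "0 \<le> t i" "t i \<le> t (Suc i)" "t (Suc i) - t i = h n" for i
      using h0[of n] by (auto simp: t_def algebra_simps)
    have tmono: "t i \<le> t j" if "i \<le> j" for i j
      using that h0[of n] by (simp add: t_def)
    \<comment> \<open>\<open>G n i\<close> inspects only steps completed by time \<open>t i\<close>,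
      so \<open>w i\<close> is known at \<open>t i\<close>. Requiring the step that starts at
      \<open>t i\<close> to be short as well would destroy this, which is why the sum includes the
      first long step.\<close>
    define w where "w i \<omega> = (if G n i \<omega> then exp (a * D (t i) \<omega>) else 0)" for i \<omega>
    have G_eq: "G n i = (\<lambda>\<omega>. \<forall>j<i. \<bar>D (t (Suc j)) \<omega> - D (t j) \<omega>\<bar> \<le> 1 / a)" for i
      unfolding t_def by (rule ext) (rule G_def)
    have Gm: "Measurable.pred (F (t i)) (G n i)" for i
    proof -
      have [measurable]: "D (t j) \<in> borel_measurable (F (t i))" if "j \<le> i" for j
        using measurable_F_mono[OF tmono[OF that] Dm[OF t(1)]] .
      have "Measurable.pred (F (t i)) (\<lambda>\<omega>. \<forall>j\<in>{..<i}. \<bar>D (t (Suc j)) \<omega> - D (t j) \<omega>\<bar> \<le> 1 / a)"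
        by measurable
      then show ?thesis unfolding G_eq Ball_def lessThan_iff .
    qed
    have wm: "w i \<in> borel_measurable (F (t i))" for i
    proof -
      note [measurable] = Gm[of i] Dm[OF t(1)[of i]]
      show ?thesis unfolding w_def[abs_def] by measurable
    qed
    have w0: "0 \<le> w i \<omega>" for i \<omega> by (simp add: w_def)
    have wB: "w i \<omega> \<le> exp (a * C)" for i \<omega>
      using abs_le_D1[OF C[of "t i" \<omega>]] a by (simp add: w_def)
    define R where "R i \<omega> = w i \<omega> * (a * (D (t (Suc i)) \<omega> - D (t i) \<omega>) + (a * (D (t (Suc i)) \<omega> - D (t i) \<omega>))\<^sup>2 / 4)" for i \<omega>
    note ds = drift_step[OF I I' Dm C t(1,2) k l a dyn[OF t(1,2)] wm w0 wB, folded R_def q_def, unfolded t(3)]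
    have iR: "integrable P (R i)" for i using ds(1)[of i] unfolding R_def .
    have dR: "a * l * h n / 2 * P.expectation (w i)
        - a\<^sup>2 / 2 * exp (a * C) * (l\<^sup>2 * (h n)\<^sup>2 + k\<^sup>2 * h n * P.expectation (q (t i) (t (Suc i)))) \<le> P.expectation (R i)" for i
      using ds(2)[of i] unfolding R_def q_def .
    have GmP: "Measurable.pred P (G n i)" for i by (rule measurable_F_P[OF Gm])
    have iw: "integrable P (w i)" for i
      by (rule P.integrable_const_bound[of _ "exp (a * C)"]) (use w0 wB measurable_F_P[OF wm] in auto)
    define S where "S = {\<omega> \<in> space P. G n (Suc n) \<omega>}"
    have S: "S \<in> sets P" "S \<inter> space M = S" unfolding S_def using GmP[of "Suc n", unfolded pred_def] by auto
    have iS: "integrable P (indicator S :: 'a \<Rightarrow> real)"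
      using S(1) by (simp add: P.emeasure_eq_measure)
    have ES: "P.prob S = p n" by (simp only: p_def S_def)
    \<comment> \<open>Where no long step occurs at all, every weight is at least
      \<open>exp (- (a * C))\<close>. The set \<open>S\<close> does not depend on \<open>i\<close>,
      so one factor \<open>p n\<close> serves all steps.\<close>
    have Ew: "exp (- (a * C)) * p n \<le> P.expectation (w i)" if "i < Suc n" for i
    proof -
      have "exp (- (a * C)) * p n = P.expectation (\<lambda>\<omega>. exp (- (a * C)) * indicator S \<omega>)"
        using iS by (simp add: ES S(2))
      also have "\<dots> \<le> P.expectation (w i)"
      proof (rule integral_mono)
        show "integrable P (\<lambda>\<omega>. exp (- (a * C)) * indicator S \<omega>)"
          by (intro integrable_mult_right iS)
        fix \<omega>
        have "G n i \<omega>" if "G n (Suc n) \<omega>"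
          using that \<open>i < Suc n\<close> unfolding G_eq by (meson less_trans)
        moreover have "- (a * C) \<le> a * D (t i) \<omega>"
          using a C[of "t i" \<omega>] mult_left_mono[of "- C" "D (t i) \<omega>" a] by (simp add: abs_le_iff)
        ultimately show "exp (- (a * C)) * indicator S \<omega> \<le> w i \<omega>"
          using w0[of i \<omega>] by (auto simp: w_def S_def split: split_indicator)
      qed (rule iw)
      finally show ?thesis .
    qed
    \<comment> \<open>The energies of the subintervals add up to the fixed number \<open>Q\<close>,
      so the errors of all steps together still carry the factor \<open>h n\<close>.\<close>
    have sumq: "(\<Sum>i<Suc n. P.expectation (q (t i) (t (Suc i)))) = Q"
    proof -
      have iq: "integrable P (q (t i) (t j))" if "i \<le> j" for i j
        using ito_difference_isometry(2)[OF I I' t(1) tmono[OF that] one] by (simp add: q_def[abs_def])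
      \<comment> \<open>One almost sure set serves all partition points; intervals starting at
        \<open>t 0\<close> suffice because each subinterval lies in one of them.\<close>
      have "AE \<omega> in P. \<forall>m. set_integrable lborel {t 0<..t m} (\<lambda>r. (norm (Z r \<omega> - Z' r \<omega>))\<^sup>2)"
        unfolding AE_all_countable
      proof
        fix m
        show "AE \<omega> in P. set_integrable lborel {t 0<..t m} (\<lambda>r. (norm (Z r \<omega> - Z' r \<omega>))\<^sup>2)"
          using ito_difference_isometry(3)[OF I I' t(1) tmono one, of 0 m] by auto
      qed
      then have "AE \<omega> in P. (\<Sum>i<Suc n. q (t i) (t (Suc i)) \<omega>) = q (t 0) (t (Suc n)) \<omega>"
      proof eventually_elim
        case (elim \<omega>)
        have "(\<Sum>i<m. q (t i) (t (Suc i)) \<omega>) = q (t 0) (t m) \<omega>" for m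
        proof (induction m)
          case 0
          then show ?case by (simp add: q_def set_lebesgue_integral_def)
        next
          case (Suc m)
          have un: "{t 0<..t (Suc m)} = {t 0<..t m} \<union> {t m<..t (Suc m)}"
            using tmono[of 0 m] t(2)[of m] by auto
          have i: "set_integrable lborel {t m<..t (Suc m)} (\<lambda>r. (norm (Z r \<omega> - Z' r \<omega>))\<^sup>2)"
            by (rule set_integrable_subset[OF elim[rule_format, of "Suc m"]]) (use un in auto)
          have "q (t 0) (t (Suc m)) \<omega> = q (t 0) (t m) \<omega> + q (t m) (t (Suc m)) \<omega>"
            unfolding q_def un by (rule set_integral_Un) (use elim i in auto)
          then show ?case using Suc by simp
        qed
        then show ?case .
      qed
      then have "P.expectation (\<lambda>\<omega>. \<Sum>i<Suc n. q (t i) (t (Suc i)) \<omega>) = P.expectation (q (t 0) (t (Suc n)))"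
        by (rule integral_cong_AE[rotated 2])
           ((intro borel_measurable_integrable Bochner_Integration.integrable_sum iq; simp)+)
      moreover have "t 0 = 0" "t (Suc n) = T" using hT[of n] by (simp_all add: t_def)
      moreover have "(\<Sum>i<Suc n. P.expectation (q (t i) (t (Suc i)))) = P.expectation (\<lambda>\<omega>. \<Sum>i<Suc n. q (t i) (t (Suc i)) \<omega>)"
        by (rule Bochner_Integration.integral_sum[symmetric]) (rule iq, simp)
      ultimately show ?thesis by (simp only: Q_def)
    qed
    have "a * l * T / 2 * exp (- (a * C)) * p n
      - a\<^sup>2 / 2 * exp (a * C) * (l\<^sup>2 * T * h n + k\<^sup>2 * h n * Q)
      = (\<Sum>i<Suc n. a * l * h n / 2 * (exp (- (a * C)) * p n)
        - a\<^sup>2 / 2 * exp (a * C) * (l\<^sup>2 * (h n)\<^sup>2 + k\<^sup>2 * h n * P.expectation (q (t i) (t (Suc i)))))"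
    proof -
      have "(\<Sum>i<Suc n. a * l * h n / 2 * (exp (- (a * C)) * p n)
        - a\<^sup>2 / 2 * exp (a * C) * (l\<^sup>2 * (h n)\<^sup>2 + k\<^sup>2 * h n * P.expectation (q (t i) (t (Suc i)))))
        = real (Suc n) * (a * l * h n / 2 * (exp (- (a * C)) * p n))
        - a\<^sup>2 / 2 * exp (a * C) * (real (Suc n) * (l\<^sup>2 * (h n)\<^sup>2) + k\<^sup>2 * h n * Q)"
        unfolding sumq[symmetric] sum_subtractf sum_distrib_left[symmetric] sum.distrib
        by (simp only: sum_constant card_lessThan mult.left_commute[of "real (Suc n)"])
      also have "real (Suc n) * (a * l * h n / 2 * (exp (- (a * C)) * p n)) = a * l * (real (Suc n) * h n) / 2 * exp (- (a * C)) * p n"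
        by simp
      also have "real (Suc n) * (l\<^sup>2 * (h n)\<^sup>2) = l\<^sup>2 * (real (Suc n) * h n) * h n"
        by (simp add: power2_eq_square)
      finally show ?thesis unfolding hT by simp
    qed
    also have "\<dots> \<le> (\<Sum>i<Suc n. P.expectation (R i))"
    proof (rule sum_mono)
      fix i assume "i \<in> {..<Suc n}"
      then have "a * l * h n / 2 * (exp (- (a * C)) * p n) \<le> a * l * h n / 2 * P.expectation (w i)"
        using Ew[of i] a l h0[of n] by (intro mult_left_mono) auto
      then show "a * l * h n / 2 * (exp (- (a * C)) * p n)
        - a\<^sup>2 / 2 * exp (a * C) * (l\<^sup>2 * (h n)\<^sup>2 + k\<^sup>2 * h n * P.expectation (q (t i) (t (Suc i)))) \<le> P.expectation (R i)"
        using dR[of i] by linarith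
    qed
    also have "\<dots> = P.expectation (\<lambda>\<omega>. \<Sum>i<Suc n. R i \<omega>)"
      by (rule Bochner_Integration.integral_sum[symmetric]) (rule iR)
    also have "\<dots> \<le> P.expectation (\<lambda>\<omega>. exp (a * C) + (a * C)\<^sup>2 * exp (a * C) * (1 - indicator S \<omega>))"
    proof (rule integral_mono)
      show "integrable P (\<lambda>\<omega>. \<Sum>i<Suc n. R i \<omega>)" by (intro Bochner_Integration.integrable_sum iR)
      show "integrable P (\<lambda>\<omega>. exp (a * C) + (a * C)\<^sup>2 * exp (a * C) * (1 - indicator S \<omega>))"
        using iS by simp
      fix \<omega> assume "\<omega> \<in> space P"
      then have e: "(a * C)\<^sup>2 * exp (a * C) * (1 - indicator S \<omega>)
          = (if G n (Suc n) \<omega> then 0 else (a * C)\<^sup>2 * exp (a * C))"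
        by (simp add: S_def)
      show "(\<Sum>i<Suc n. R i \<omega>) \<le> exp (a * C) + (a * C)\<^sup>2 * exp (a * C) * (1 - indicator S \<omega>)"
        using stopped_exp_sum_le[OF a(1), of "\<lambda>i. D (t i) \<omega>" C "Suc n", OF C]
        unfolding e R_def w_def G_eq .
    qed
    also have "\<dots> = exp (a * C) + (a * C)\<^sup>2 * exp (a * C) * (1 - p n)"
      using iS by (simp add: ES S(2) prob_space.prob_space[OF prob_M])
    finally show ?thesis .
  qed
  have "(\<lambda>n. a * l * T / 2 * exp (- (a * C)) * p n - a\<^sup>2 / 2 * exp (a * C) * (l\<^sup>2 * T * h n + k\<^sup>2 * h n * Q))
     \<longlonglongrightarrow> a * l * T / 2 * exp (- (a * C)) * 1 - a\<^sup>2 / 2 * exp (a * C) * (l\<^sup>2 * T * 0 + k\<^sup>2 * 0 * Q)"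
    by (intro tendsto_intros plim hlim)
  moreover have "(\<lambda>n. exp (a * C) + (a * C)\<^sup>2 * exp (a * C) * (1 - p n)) \<longlonglongrightarrow> exp (a * C) + (a * C)\<^sup>2 * exp (a * C) * (1 - 1)"
    by (intro tendsto_intros plim)
  ultimately have "a * l * T / 2 * exp (- (a * C)) \<le> exp (a * C)"
    using LIMSEQ_le step by fastforce
  moreover have "a * l * T / 2 * exp (- (a * C)) = 2 * exp (a * C)"
    using a l by (simp add: T_def exp_minus)
  ultimately show False by simp
qed

end

subsection \<open>The ergodic backward equation\<close>

text \<open>The backward equation integrates in time over closed intervals, the isometry over
  half-open ones, as simple processes dictate.\<close>

lemma set_integral_Icc_eq_Ioc:
  fixes f :: "real \<Rightarrow> real"
  assumes f: "set_integrable lborel {s..t} f"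
  shows "(LINT r:{s..t}|lborel. f r) = (LINT r:{s<..t}|lborel. f r)"
  unfolding set_lebesgue_integral_def
proof (rule integral_cong_AE)
  show "(\<lambda>r. indicator {s..t} r *\<^sub>R f r) \<in> borel_measurable lborel"
    using f by (auto simp: set_integrable_def)
  have "set_integrable lborel {s<..t} f"
    by (rule set_integrable_subset[OF f]) auto
  then show "(\<lambda>r. indicator {s<..t} r *\<^sub>R f r) \<in> borel_measurable lborel"
    by (auto simp: set_integrable_def)
  show "AE r in lborel. indicator {s..t} r *\<^sub>R f r = indicator {s<..t} r *\<^sub>R f r"
    using AE_lborel_singleton[of s] by eventually_elim (auto simp: indicator_def)
qed

text \<open>Without integrability the Bochner integral of the driver would be the junk value \<open>0\<close>, and
  the two backward equations could not be subtracted.\<close>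

lemma driver_integrable:
  fixes f :: "real^'n::finite \<Rightarrow> real^'n \<Rightarrow> real" and \<xi> z :: "real \<Rightarrow> real^'n"
  assumes S: "closed S" "bounded S" and K: "0 \<le> K" "0 \<le> K'"
    and f: "\<forall>y\<in>S. \<forall>y'\<in>S. \<forall>z z'. \<bar>f y z - f y' z'\<bar> \<le> K * norm (y - y') + K' * norm (z - z')"
    and \<xi>: "continuous_on {0..} \<xi>" "\<And>r. 0 \<le> r \<Longrightarrow> \<xi> r \<in> S"
    and z: "(\<lambda>r. indicator {0..t} r *\<^sub>R z r) \<in> borel_measurable lborel"
    and iz: "set_integrable lborel {0..t} (\<lambda>r. norm (z r))"
    and s: "0 \<le> s" "s \<le> t"
  shows "set_integrable lborel {s..t} (\<lambda>r. f (\<xi> r) (z r))"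
proof -
  define h where "h = (\<lambda>x. f (fst x) (snd x))"
  have "(K + K')-lipschitz_on (S \<times> UNIV) h"
  proof (rule lipschitz_onI)
    fix x y :: "(real^'n) \<times> (real^'n)"
    assume x: "x \<in> S \<times> UNIV" and y: "y \<in> S \<times> UNIV"
    have "dist (h x) (h y) \<le> K * dist (fst x) (fst y) + K' * dist (snd x) (snd y)"
      using f x y by (auto simp: h_def dist_norm)
    also have "\<dots> \<le> K * dist x y + K' * dist x y"
      using K by (intro add_mono mult_left_mono dist_fst_le dist_snd_le)
    finally show "dist (h x) (h y) \<le> (K + K') * dist x y" by (simp add: algebra_simps)
  qed (use K in simp)
  then have hc: "continuous_on (S \<times> UNIV) h" by (rule lipschitz_on_continuous_on)
  \<comment> \<open>The driver is controlled only on \<open>S\<close>, so it is extended by 0 to a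
    Borel function before being composed with the paths. Likewise \<open>\<xi> (max 0 r)\<close>
    below extends the path continuously to negative times.\<close>
  define g where "g = (\<lambda>x. indicator (S \<times> UNIV) x *\<^sub>R h x)"
  have "S \<times> (UNIV :: (real^'n) set) \<in> sets borel"
    using S(1) by (intro borel_closed closed_Times) auto
  then have g[measurable]: "g \<in> borel_measurable borel"
    unfolding g_def by (rule borel_measurable_continuous_on_indicator[OF _ hc])
  have "continuous_on UNIV (\<lambda>r::real. max 0 r)"
    by (intro continuous_on_max continuous_on_const continuous_on_id)
  then have "continuous_on UNIV (\<lambda>r. \<xi> (max 0 r))"
    by (rule continuous_on_compose2[OF \<xi>(1)]) auto
  then have [measurable]: "(\<lambda>r. \<xi> (max 0 r)) \<in> borel_measurable borel"
    by (rule borel_measurable_continuous_onI)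
  have [measurable]: "(\<lambda>r. indicator {0..t} r *\<^sub>R z r) \<in> borel_measurable borel" using z by simp
  have eq: "indicator {s..t} r *\<^sub>R f (\<xi> r) (z r) 
     = indicator {s..t} r *\<^sub>R g (\<xi> (max 0 r), indicator {0..t} r *\<^sub>R z r)" for r
    using \<xi>(2)[of r] s by (auto simp: indicator_def g_def h_def max_absorb2)
  have meas: "(\<lambda>r. indicator {s..t} r *\<^sub>R f (\<xi> r) (z r)) \<in> borel_measurable lborel"
    unfolding eq by measurable
  obtain B where B: "\<And>y. y \<in> S \<Longrightarrow> norm y \<le> B" using S(2) by (auto simp: bounded_iff)
  \<comment> \<open>Comparison with the fixed value \<open>f (\<xi> 0) 0\<close>: boundedness of
    \<open>S\<close> limits the first argument, so growth comes only from the norm of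
    \<open>z r\<close>.\<close>
  define c where "c = \<bar>f (\<xi> 0) 0\<bar> + K * (B + B)"
  have c: "\<bar>f (\<xi> r) (z r)\<bar> \<le> c + K' * norm (z r)" if "0 \<le> r" for r
  proof -
    have "\<bar>f (\<xi> r) (z r) - f (\<xi> 0) 0\<bar> \<le> K * norm (\<xi> r - \<xi> 0) + K' * norm (z r - 0)"
      using f \<xi>(2)[OF that] \<xi>(2)[of 0] by blast
    moreover have "norm (\<xi> r - \<xi> 0) \<le> B + B"
      using norm_triangle_ineq4[of "\<xi> r" "\<xi> 0"] B[OF \<xi>(2)[OF that]] B[OF \<xi>(2)[of 0]] by simp
    then have "K * norm (\<xi> r - \<xi> 0) \<le> K * (B + B)" using K by (intro mult_left_mono)
    ultimately show ?thesis unfolding c_def by simp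
  qed
  have iz': "set_integrable lborel {s..t} (\<lambda>r. norm (z r))"
    by (rule set_integrable_subset[OF iz]) (use s in auto)
  have ic: "set_integrable lborel {s..t} (\<lambda>r. c)"
    using s by (simp add: set_integrable_def less_top[symmetric])
  have "set_integrable lborel {s..t} (\<lambda>r. c + K' * norm (z r))"
    using iz' ic by (intro set_integral_add) simp_all
  then show ?thesis
    unfolding set_integrable_def
  proof (rule Bochner_Integration.integrable_bound[OF _ meas])
    show "AE r in lborel. norm (indicator {s..t} r *\<^sub>R f (\<xi> r) (z r)) \<le> norm (indicator {s..t} r *\<^sub>R (c + K' * norm (z r)))"
    proof (rule AE_I2)
      fix r
      show "norm (indicator {s..t} r *\<^sub>R f (\<xi> r) (z r)) \<le> norm (indicator {s..t} r *\<^sub>R (c + K' * norm (z r)))"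
        using c[of r] s by (auto simp: indicator_def intro: order_trans[OF _ abs_ge_self])
    qed
  qed
qed

section \<open>Reducing two solutions to a bounded process with drift\<close>

context brownian begin

lemma M2_path:
  assumes Z: "M2 M W Z" and t: "0 \<le> t"
  shows "AE \<omega> in P. (\<lambda>r. indicator {0..t} r *\<^sub>R Z r \<omega>) \<in> borel_measurable lborel \<and>
           set_integrable lborel {0..t} (\<lambda>r. norm (Z r \<omega>))"
proof -
  \<comment> \<open>\<open>M2\<close> speaks only of positive horizons, while \<open>t\<close> may
    be 0.\<close>
  let ?T = "t + 1"
  have J: "(\<lambda>(\<omega>, r). indicator {0..t} r *\<^sub>R Z r \<omega>) \<in> borel_measurable (P \<Otimes>\<^sub>M lborel)" if "0 \<le> t" for t
    using Z by (intro prog_measurable_joint[of _ _ t]) (auto simp: M2_def)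
  have J': "(\<lambda>(\<omega>, r). ennreal ((norm (indicator {0..?T} r *\<^sub>R Z r \<omega>))\<^sup>2)) \<in> borel_measurable (P \<Otimes>\<^sub>M lborel)"
    using measurable_compose[OF J[of ?T], of "\<lambda>x. ennreal ((norm x)\<^sup>2)" borel] t by (simp add: split_beta')
  have e: "ennreal ((norm (indicator {0..?T} r *\<^sub>R Z r \<omega>))\<^sup>2) = ennreal ((norm (Z r \<omega>))\<^sup>2) * indicator {0..?T} r" for r \<omega>
    by (simp add: indicator_def)
  have "AE \<omega> in P. (\<integral>\<^sup>+r\<in>{0..?T}. ennreal ((norm (Z r \<omega>))\<^sup>2) \<partial>lborel) \<noteq> \<infinity>"
  proof (rule nn_integral_PInf_AE)
    show "(\<lambda>\<omega>. \<integral>\<^sup>+r\<in>{0..?T}. ennreal ((norm (Z r \<omega>))\<^sup>2) \<partial>lborel) \<in> borel_measurable P"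
      using lborel.borel_measurable_nn_integral_fst[OF J'] unfolding prod.case e .
    show "(\<integral>\<^sup>+\<omega>. (\<integral>\<^sup>+r\<in>{0..?T}. ennreal ((norm (Z r \<omega>))\<^sup>2) \<partial>lborel) \<partial>P) \<noteq> \<infinity>"
      using Z[unfolded M2_def, THEN conjunct2, rule_format, of ?T] t by (simp add: less_top)
  qed
  with AE_space show ?thesis
  proof eventually_elim
    case (elim \<omega>)
    have m: "(\<lambda>r. indicator {0..t} r *\<^sub>R Z r \<omega>) \<in> borel_measurable lborel"
      using measurable_compose[OF measurable_Pair1'[OF elim(1)] J[OF t]] by simp
    have "integrable lborel (\<lambda>r. (norm (indicator {0..t} r *\<^sub>R Z r \<omega>))\<^sup>2)"
    proof (rule integrableI_bounded)
      show "(\<lambda>r. (norm (indicator {0..t} r *\<^sub>R Z r \<omega>))\<^sup>2) \<in> borel_measurable lborel" using m by measurable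
      have "(\<integral>\<^sup>+r. ennreal (norm ((norm (indicator {0..t} r *\<^sub>R Z r \<omega>))\<^sup>2)) \<partial>lborel) 
         \<le> (\<integral>\<^sup>+r\<in>{0..?T}. ennreal ((norm (Z r \<omega>))\<^sup>2) \<partial>lborel)"
        by (intro nn_integral_mono) (auto simp: indicator_def)
      also have "\<dots> < \<infinity>" using elim(2) by (simp add: less_top)
      finally show "(\<integral>\<^sup>+r. ennreal (norm ((norm (indicator {0..t} r *\<^sub>R Z r \<omega>))\<^sup>2)) \<partial>lborel) < \<infinity>" .
    qed
    then have i: "integrable lborel (\<lambda>r. indicator {0..t} r + (norm (indicator {0..t} r *\<^sub>R Z r \<omega>))\<^sup>2)"
      using t by (intro Bochner_Integration.integrable_add) (auto simp: less_top[symmetric])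
    have "integrable lborel (\<lambda>r. norm (indicator {0..t} r *\<^sub>R Z r \<omega>))"
    proof (rule Bochner_Integration.integrable_bound[OF i])
      show "(\<lambda>r. norm (indicator {0..t} r *\<^sub>R Z r \<omega>)) \<in> borel_measurable lborel" using m by measurable
      have le: "y \<le> 1 + y\<^sup>2" for y :: real
        using sum_squares_bound[of 1 y, simplified] zero_le_power2[of y] by linarith
      show "AE r in lborel. norm (norm (indicator {0..t} r *\<^sub>R Z r \<omega>)) \<le> norm (indicator {0..t} r + (norm (indicator {0..t} r *\<^sub>R Z r \<omega>))\<^sup>2)"
        using le by (intro AE_I2) (auto simp: indicator_def)
    qed
    then have "set_integrable lborel {0..t} (\<lambda>r. norm (Z r \<omega>))"
      by (simp add: set_integrable_def)
    with m show ?case by simp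
  qed
qed

text \<open>One inequality is enough, because the two solutions may exchange roles.\<close>

lemma ergodic_constant_le:
  assumes G: "bounded G" and K: "0 \<le> Kx" "0 \<le> Kz"
    and \<psi>: "\<forall>y\<in>closure G. \<forall>y'\<in>closure G. \<forall>z z'. \<bar>\<psi> y z - \<psi> y' z'\<bar> \<le> Kx * norm (y - y') + Kz * norm (z - z')"
    and X: "continuous_process M X" "AE \<omega> in M. \<forall>t\<ge>0. X t \<omega> \<in> closure G"
    and Y: "admissible_solution M W X K \<psi> g \<mu> Y Z lam"
    and Y': "admissible_solution M W X K \<psi> g \<mu> Y' Z' lam'"
  shows "lam \<le> lam'"
proof -
  obtain I where I: "has_ito_integral M W Z I" and eq: "AE \<omega> in M. \<forall>t T. 0 \<le> t \<and> t \<le> T \<longrightarrow>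
           Y t \<omega> = Y T \<omega> + (LINT s:{t..T}|lborel. \<psi> (X s \<omega>) (Z s \<omega>) - lam)
             + (LINT s:{t<..T}|stieltjes (\<lambda>r. K r \<omega>). g (X s \<omega>) - \<mu>)
             - (I T \<omega> - I t \<omega>)"
    using Y by (auto simp: admissible_solution_def ergodic_bsde_def)
  obtain I' where I': "has_ito_integral M W Z' I'" and eq': "AE \<omega> in M. \<forall>t T. 0 \<le> t \<and> t \<le> T \<longrightarrow>
           Y' t \<omega> = Y' T \<omega> + (LINT s:{t..T}|lborel. \<psi> (X s \<omega>) (Z' s \<omega>) - lam')
             + (LINT s:{t<..T}|stieltjes (\<lambda>r. K r \<omega>). g (X s \<omega>) - \<mu>)
             - (I' T \<omega> - I' t \<omega>)"
    using Y' by (auto simp: admissible_solution_def ergodic_bsde_def)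
  obtain C1 where C1: "AE \<omega> in M. \<forall>t\<ge>0. \<bar>Y t \<omega>\<bar> \<le> C1"
    using Y by (auto simp: admissible_solution_def bounded_process_def)
  obtain C2 where C2: "AE \<omega> in M. \<forall>t\<ge>0. \<bar>Y' t \<omega>\<bar> \<le> C2"
    using Y' by (auto simp: admissible_solution_def bounded_process_def)
  define C where "C = max 0 (C1 + C2)"
  \<comment> \<open>The solutions are bounded only almost surely, whereas
    \<open>drift_nonpos\<close> wants a bound everywhere. Clipping at \<open>C\<close> provides it,
    preserves adaptedness and continuity, and changes the difference only on a null set;
    \<open>max 0\<close> in \<open>C\<close> ensures \<open>- C \<le> C\<close>.\<close>
  define D where "D t \<omega> = max (- C) (min C (Y t \<omega> - Y' t \<omega>))" for t \<omega>
  have D_eq: "AE \<omega> in M. \<forall>t\<ge>0. D t \<omega> = Y t \<omega> - Y' t \<omega>"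
    using C1 C2
  proof eventually_elim
    case (elim \<omega>)
    show ?case
    proof (intro allI impI)
      fix t :: real assume "0 \<le> t"
      with elim have "\<bar>Y t \<omega>\<bar> \<le> C1" "\<bar>Y' t \<omega>\<bar> \<le> C2" by auto
      then have "\<bar>Y t \<omega> - Y' t \<omega>\<bar> \<le> C" by (auto simp: C_def)
      then show "D t \<omega> = Y t \<omega> - Y' t \<omega>" by (simp add: D_def abs_le_iff max_def min_def)
    qed
  qed
  have "lam - lam' \<le> 0"
  proof (rule drift_nonpos[OF I I'])
    show "D t \<in> borel_measurable (F t)" if "0 \<le> t" for t
    proof -
      have [measurable]: "Y t \<in> borel_measurable (F t)" "Y' t \<in> borel_measurable (F t)"
        using Y Y' that by (auto simp: admissible_solution_def adapted_def)
      show ?thesis unfolding D_def[abs_def] by measurable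
    qed
    show "\<bar>D t \<omega>\<bar> \<le> C" for t \<omega>
      by (auto simp: D_def C_def abs_le_iff max_def min_def)
    have "AE \<omega> in M. continuous_on {0..} (\<lambda>t. Y t \<omega>)" "AE \<omega> in M. continuous_on {0..} (\<lambda>t. Y' t \<omega>)"
      using Y Y' by (auto simp: admissible_solution_def continuous_process_def)
    then have "AE \<omega> in M. continuous_on {0..} (\<lambda>t. D t \<omega>)"
    proof eventually_elim
      case (elim \<omega>)
      then show ?case
        unfolding D_def by (intro continuous_on_max continuous_on_min continuous_on_const continuous_on_diff)
    qed
    then show "AE \<omega> in P. continuous_on {0..} (\<lambda>t. D t \<omega>)" by (rule AE_completion)
    show "0 \<le> Kz" by (rule K)
    fix s t :: real assume st: "0 \<le> s" "s \<le> t"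
    have t0: "0 \<le> t" using st by simp
    have MZ: "M2 M W Z" "M2 M W Z'" using I I' by (auto simp: has_ito_integral_def)
    have "AE \<omega> in M. continuous_on {0..} (\<lambda>t. X t \<omega>)" using X by (simp add: continuous_process_def)
    note ae = this[THEN AE_completion] X(2)[THEN AE_completion] eq[THEN AE_completion] eq'[THEN AE_completion]
      D_eq[THEN AE_completion] M2_path[OF MZ(1) t0] M2_path[OF MZ(2) t0]
    from ae show "AE \<omega> in P. \<bar>D t \<omega> - D s \<omega> - ((I t \<omega> - I s \<omega>) - (I' t \<omega> - I' s \<omega>)) - (lam - lam') * (t - s)\<bar>
        \<le> Kz * (LINT r:{s<..t}|lborel. norm (Z r \<omega> - Z' r \<omega>))"
    proof eventually_elim
      case (elim \<omega>)
      let ?f = "\<lambda>r. \<psi> (X r \<omega>) (Z r \<omega>)" and ?f' = "\<lambda>r. \<psi> (X r \<omega>) (Z' r \<omega>)"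
      have bc: "closed (closure G)" "bounded (closure G)" using G by auto
      have Xc: "0 \<le> r \<Longrightarrow> X r \<omega> \<in> closure G" for r using elim(2) by simp
      have f: "set_integrable lborel {s..t} ?f" and f': "set_integrable lborel {s..t} ?f'"
        using elim by (auto intro!: driver_integrable[OF bc K \<psi> elim(1) Xc _ _ st])
      have const: "set_integrable lborel {s..t} (\<lambda>r. c)" for c :: real
        using st by (simp add: set_integrable_def less_top[symmetric])
      have mZ: "(\<lambda>r. indicator {0..t} r *\<^sub>R Z r \<omega>) \<in> borel_measurable lborel"
        "(\<lambda>r. indicator {0..t} r *\<^sub>R Z' r \<omega>) \<in> borel_measurable lborel"
        and iZ: "set_integrable lborel {0..t} (\<lambda>r. norm (Z r \<omega>))" "set_integrable lborel {0..t} (\<lambda>r. norm (Z' r \<omega>))"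
        using elim by auto
      have dZ: "set_integrable lborel {s..t} (\<lambda>r. norm (Z r \<omega> - Z' r \<omega>))"
      proof -
        have "set_integrable lborel {0..t} (\<lambda>r. norm (Z r \<omega> - Z' r \<omega>))"
          unfolding set_integrable_def
        proof (rule Bochner_Integration.integrable_bound)
          show "integrable lborel (\<lambda>r. indicator {0..t} r *\<^sub>R norm (Z r \<omega>) + indicator {0..t} r *\<^sub>R norm (Z' r \<omega>))"
            using iZ by (simp add: set_integrable_def)
          have "(\<lambda>r. norm (indicator {0..t} r *\<^sub>R Z r \<omega> - indicator {0..t} r *\<^sub>R Z' r \<omega>)) \<in> borel_measurable lborel"
            using mZ by measurable
          also have "(\<lambda>r. norm (indicator {0..t} r *\<^sub>R Z r \<omega> - indicator {0..t} r *\<^sub>R Z' r \<omega>))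
              = (\<lambda>r. indicator {0..t} r *\<^sub>R norm (Z r \<omega> - Z' r \<omega>))" by (auto simp: indicator_def)
          finally show "(\<lambda>r. indicator {0..t} r *\<^sub>R norm (Z r \<omega> - Z' r \<omega>)) \<in> borel_measurable lborel" .
          show "AE r in lborel. norm (indicator {0..t} r *\<^sub>R norm (Z r \<omega> - Z' r \<omega>))
              \<le> norm (indicator {0..t} r *\<^sub>R norm (Z r \<omega>) + indicator {0..t} r *\<^sub>R norm (Z' r \<omega>))"
            by (intro AE_I2) (auto simp: indicator_def intro: norm_triangle_ineq4)
        qed
        then show ?thesis by (rule set_integrable_subset) (use st in auto)
      qed
      have A: "(LINT r:{s..t}|lborel. ?f r - lam) = (LINT r:{s..t}|lborel. ?f r) - lam * (t - s)"
        "(LINT r:{s..t}|lborel. ?f' r - lam') = (LINT r:{s..t}|lborel. ?f' r) - lam' * (t - s)"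
        using f f' const st by (simp_all add: set_integral_diff set_integral_const mult.commute)
      have Ds: "D t \<omega> = Y t \<omega> - Y' t \<omega>" "D s \<omega> = Y s \<omega> - Y' s \<omega>" using elim(5) st t0 by auto
      \<comment> \<open>The reflection term is the same number in both equations and cancels
        whatever its value is.\<close>
      define \<kappa> where "\<kappa> = (LINT s:{s<..t}|stieltjes (\<lambda>r. K r \<omega>). g (X s \<omega>) - \<mu>)"
      have e1: "Y s \<omega> = Y t \<omega> + ((LINT r:{s..t}|lborel. ?f r) - lam * (t - s)) + \<kappa> - (I t \<omega> - I s \<omega>)"
        using elim(3)[rule_format, of s t] st unfolding A \<kappa>_def by simp
      have e2: "Y' s \<omega> = Y' t \<omega> + ((LINT r:{s..t}|lborel. ?f' r) - lam' * (t - s)) + \<kappa> - (I' t \<omega> - I' s \<omega>)"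
        using elim(4)[rule_format, of s t] st unfolding A \<kappa>_def by simp
      have e3: "(LINT r:{s..t}|lborel. ?f' r - ?f r) = (LINT r:{s..t}|lborel. ?f' r) - (LINT r:{s..t}|lborel. ?f r)"
        by (rule set_integral_diff(2)[OF f' f])
      have "D t \<omega> - D s \<omega> - ((I t \<omega> - I s \<omega>) - (I' t \<omega> - I' s \<omega>)) - (lam - lam') * (t - s)
         = (LINT r:{s..t}|lborel. ?f' r - ?f r)"
        unfolding Ds e3 left_diff_distrib using e1 e2 by linarith
      also have "\<bar>\<dots>\<bar> \<le> (LINT r:{s..t}|lborel. Kz * norm (Z r \<omega> - Z' r \<omega>))"
        unfolding set_lebesgue_integral_def real_norm_def[symmetric]
      proof (rule norm_lebesgue_integral_le)
        show "integrable lborel (\<lambda>r. indicator {s..t} r *\<^sub>R (Kz * norm (Z r \<omega> - Z' r \<omega>)))"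
          using set_integrable_mult_right[of Kz, OF dZ] by (simp add: set_integrable_def)
        \<comment> \<open>Both drivers are evaluated at the same point \<open>X r \<omega>\<close>,
          so the \<open>Kx\<close> part of the Lipschitz bound vanishes.\<close>
        fix r
        have "\<bar>?f' r - ?f r\<bar> \<le> Kz * norm (Z r \<omega> - Z' r \<omega>)" if "0 \<le> r"
          using \<psi>[rule_format, OF Xc[OF that] Xc[OF that], of "Z' r \<omega>" "Z r \<omega>"] by (simp add: norm_minus_commute)
        then show "norm (indicator {s..t} r *\<^sub>R (?f' r - ?f r)) \<le> indicator {s..t} r *\<^sub>R (Kz * norm (Z r \<omega> - Z' r \<omega>))"
          using st by (auto simp: indicator_def)
      qed
      also have "\<dots> = Kz * (LINT r:{s<..t}|lborel. norm (Z r \<omega> - Z' r \<omega>))"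
        using set_integral_Icc_eq_Ioc[OF dZ] by simp
      finally show ?case .
    qed
  qed
  then show ?thesis by simp
qed

end

theorem theorem3p2:
  fixes M :: "'a measure"
    and W :: "real \<Rightarrow> 'a \<Rightarrow> real^('n::finite)"
    and b :: "real^'n \<Rightarrow> real^'n"
    and \<sigma> :: "real^'n \<Rightarrow> real^'n^'n"
    and \<phi> :: "real^'n \<Rightarrow> real"
    and G :: "(real^'n) set"
    and \<psi> :: "real^'n \<Rightarrow> real^'n \<Rightarrow> real"
    and g :: "real^'n \<Rightarrow> real"
    and K\<psi>x K\<psi>z \<mu> lam lam' :: real
    and x :: "real^'n"
    and X :: "real \<Rightarrow> 'a \<Rightarrow> real^'n"
    and K :: "real \<Rightarrow> 'a \<Rightarrow> real"
    and Y Y' :: "real \<Rightarrow> 'a \<Rightarrow> real"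
    and Z Z' :: "real \<Rightarrow> 'a \<Rightarrow> real^'n"
  assumes "brownian_motion M W"
    and "class_C_b 2 \<phi>"
    and "G = {y. \<phi> y > 0}" and "bounded G"
    and "frontier G = {y. \<phi> y = 0}"
    and "\<forall>y\<in>frontier G. norm (grad \<phi> y) = 1"
    and "\<exists>L. L-lipschitz_on UNIV b" and "\<exists>L. L-lipschitz_on UNIV \<sigma>"
    and "K\<psi>x \<ge> 0" and "K\<psi>z \<ge> 0"
    and "\<forall>y\<in>closure G. \<forall>y'\<in>closure G. \<forall>z z'.
           \<bar>\<psi> y z - \<psi> y' z'\<bar> \<le> K\<psi>x * norm (y - y') + K\<psi>z * norm (z - z')"
    and "class_C_lip_closure 2 G g"
    and "x \<in> closure G"
    and "reflected_sde_solution M W b \<sigma> \<phi> G x X K"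
    and "admissible_solution M W X K \<psi> g \<mu> Y Z lam"
    and "admissible_solution M W X K \<psi> g \<mu> Y' Z' lam'"
  shows "lam = lam'"
proof -
  interpret brownian M W by standard (rule assms(1))
  have X: "continuous_process M X" "AE \<omega> in M. \<forall>t\<ge>0. X t \<omega> \<in> closure G"
    using \<open>reflected_sde_solution M W b \<sigma> \<phi> G x X K\<close> by (auto simp: reflected_sde_solution_def)
  note le = ergodic_constant_le[OF \<open>bounded G\<close> \<open>K\<psi>x \<ge> 0\<close> \<open>K\<psi>z \<ge> 0\<close> assms(11) X]
  show ?thesis
    using le[OF assms(15,16)] le[OF assms(16,15)] by simp
qed

end
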